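(* Let $b\in BMO(\mathbb R^n)$. Let $\mathcal T=\{T_t:t\in\mathbb R_+\}$ be a family of linear operators and let $\mathcal T_b=\{T_{t;b}:t\in\mathbb R_+\}$ be the family of commutators formed by the linear operators $T_t$ and $b$. Let $1<p<\infty$, $\rho\ge 1$, $\tau\in\mathbb R$ and $1<s<\infty$. Let $w$ be a non-negative locally integrable function on $\mathbb R^n$ such that $w^\tau\in A_s$. Then $V_\rho\mathcal T_b$ is bounded on $L^p(w)$, that is, $$\|V_\rho\mathcal T_b(f)\|_{L^p(w)}\le C\|b\|_{\ast}\|f\|_{L^p(w)},$$ provided that $V_\rho\mathcal T$ is bounded on $L^p(w)$.
   Context: For a linear operator $T$ on a space of measurable functions on $\mathbb R^n$ and a function $b$, the commutator is $T_bf(x):=T\big((b(x)-b(\cdot))f\big)(x)$, and $T_{t;b}:=(T_t)_b$. $\|b\|_{\ast}$ denotes the $BMO(\mathbb R^n)$ norm of $b$. For a family $\mathfrak a=\{a_t\}$ of complex numbers and $\rho\ge1$, $\|\mathfrak a\|_{V_\rho}=\sup\big(\sum_{k\ge1}|a_{t_k}-a_{t_{k-1}}|^\rho\big)^{1/\rho}$, the supremum running over all increasing sequences $\{t_k:k\ge0\}$ in the index set. For a family of operators $\mathcal T=\{T_t\}_{t>0}$, the strong $\rho$-variation operator is $V_\rho\mathcal T(f)(x)=\|\{T_tf(x)\}_{t>0}\|_{V_\rho}$. $L^p(w)$ is the weighted space with norm $\|f\|_{L^p(w)}=\big(\int_{\mathbb R^n}|f(x)|^pw(x)\,dx\big)^{1/p}$.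 For $1<s<\infty$, a non-negative locally integrable function $v$ on $\mathbb R^n$ belongs to $A_s$ if there is a constant $C>0$ such that $\sup_Q\big(\frac1{|Q|}\int_Q v(x)\,dx\big)\big(\frac1{|Q|}\int_Q v(x)^{1-s'}\,dx\big)^{s-1}\le C$, the supremum being over all cubes $Q$, where $s'=s/(s-1)$. The letter $C$ stands for a positive constant independent of the essential variables.
   Formalization: Boundedness of the variation operator is assumed for all weights w with w^τ in A_s, with constant depending on w only via the A_s constant of w^τ, and concluded likewise; for one fixed w the claim fails (w=1, T_t f(x)=1_{t=1}f(-x), b=log|x-e_1|). *)

theory Defs
  imports "HOL-Analysis.Analysis"
begin

text \<open>Only used for exponents \<open>a > 0\<close>, so that \<open>0\<close> and \<open>\<infinity>\<close> are fixed.\<close>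

definition epowr :: "ennreal \<Rightarrow> real \<Rightarrow> ennreal" where
  "epowr x a = (if x = \<infinity> then \<infinity> else ennreal (enn2real x powr a))"

definition cubes :: "'a::euclidean_space set set" where
  "cubes = {cbox a (a + r *\<^sub>R One) | a r. r > 0}"

definition average :: "'a::euclidean_space set \<Rightarrow> ('a \<Rightarrow> 'b::{banach,second_countable_topology}) \<Rightarrow> 'b" where
  "average Q f = (1 / measure lebesgue Q) *\<^sub>R set_lebesgue_integral lebesgue Q f"

definition locally_integrable :: "('a::euclidean_space \<Rightarrow> 'b::{banach,second_countable_topology}) \<Rightarrow> bool" where
  "locally_integrable f \<longleftrightarrow> (\<forall>K. compact K \<longrightarrow> set_integrable lebesgue K f)"

definition mean_oscillation :: "('a::euclidean_space \<Rightarrow> 'b::{banach,second_countable_topology}) \<Rightarrow> 'a set \<Rightarrow> real" where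
  "mean_oscillation b Q = average Q (\<lambda>x. norm (b x - average Q b))"

definition BMO :: "('a::euclidean_space \<Rightarrow> 'b::{banach,second_countable_topology}) set" where
  "BMO = {b. locally_integrable b \<and> bdd_above (mean_oscillation b ` cubes)}"

definition bmo_norm :: "('a::euclidean_space \<Rightarrow> 'b::{banach,second_countable_topology}) \<Rightarrow> real" where
  "bmo_norm b = (SUP Q\<in>cubes. mean_oscillation b Q)"

text \<open>
  \<open>muckenhoupt_le s K v\<close>: \<open>v \<in> A_s\<close> and the supremum over cubes in the \<open>A_s\<close> condition is at
  most \<open>K\<close>.  Since \<open>1 - s' < 0\<close>, that supremum can only be finite if \<open>v\<close> is positive almost
  everywhere and \<open>v\<close> to the power \<open>1 - s'\<close> is locally integrable, apart from \<open>v = 0\<close> almost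
  everywhere with \<open>0 * \<infinity>\<close> read as \<open>0\<close>, which is not regarded as a weight.  Both facts have to be
  listed because \<open>0 powr a = 0\<close> and because the integral of a non-integrable function is \<open>0\<close>.
\<close>

definition muckenhoupt_le :: "real \<Rightarrow> real \<Rightarrow> ('a::euclidean_space \<Rightarrow> real) \<Rightarrow> bool" where
  "muckenhoupt_le s K v \<longleftrightarrow>
     (let s' = s / (s - 1) in
       (\<forall>x. 0 \<le> v x) \<and> (AE x in lebesgue. 0 < v x) \<and>
       locally_integrable v \<and> locally_integrable (\<lambda>x. v x powr (1 - s')) \<and>
       (\<forall>Q\<in>cubes. average Q v * average Q (\<lambda>x. v x powr (1 - s')) powr (s - 1) \<le> K))"

definition muckenhoupt :: "real \<Rightarrow> ('a::euclidean_space \<Rightarrow> real) set" where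
  "muckenhoupt s = {v. \<exists>K>0. muckenhoupt_le s K v}"

definition Lp_wnorm :: "real \<Rightarrow> ('a::euclidean_space \<Rightarrow> real) \<Rightarrow> ('a \<Rightarrow> ennreal) \<Rightarrow> ennreal" where
  "Lp_wnorm p w g = epowr (\<integral>\<^sup>+x. epowr (g x) p * ennreal (w x) \<partial>lebesgue) (1 / p)"

definition Lp_weighted :: "real \<Rightarrow> ('a::euclidean_space \<Rightarrow> real) \<Rightarrow> ('a \<Rightarrow> complex) set" where
  "Lp_weighted p w =
     {f \<in> borel_measurable lebesgue. Lp_wnorm p w (\<lambda>x. ennreal (norm (f x))) < \<infinity>}"

text \<open>The values of \<open>S\<close> may be infinite; measurability is part of \<open>S f\<close> lying in the target space.\<close>

definition Lp_bounded_by ::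
  "real \<Rightarrow> ('a::euclidean_space \<Rightarrow> real) \<Rightarrow> real \<Rightarrow> (('a \<Rightarrow> complex) \<Rightarrow> ('a \<Rightarrow> ennreal)) \<Rightarrow> bool" where
  "Lp_bounded_by p w C S \<longleftrightarrow>
     (\<forall>f\<in>Lp_weighted p w. S f \<in> borel_measurable lebesgue \<and>
        Lp_wnorm p w (S f) \<le> ennreal C * Lp_wnorm p w (\<lambda>x. ennreal (norm (f x))))"

text \<open>
  Operators act on functions rather than on almost-everywhere classes: both the commutator, which
  evaluates at \<open>x\<close> the image of a function depending on \<open>x\<close>, and the variation, a supremum over
  uncountably many indices, use pointwise values.
\<close>

definition linear_operator_on ::
  "('a::euclidean_space \<Rightarrow> complex) set \<Rightarrow> (('a \<Rightarrow> complex) \<Rightarrow> ('a \<Rightarrow> complex)) \<Rightarrow> bool" where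
  "linear_operator_on D S \<longleftrightarrow>
     (\<lambda>x. 0) \<in> D \<and>
     (\<forall>f\<in>D. f \<in> borel_measurable lebesgue \<and> S f \<in> borel_measurable lebesgue) \<and>
     (\<forall>f\<in>D. \<forall>g\<in>D. (\<lambda>x. f x + g x) \<in> D \<and> S (\<lambda>x. f x + g x) = (\<lambda>x. S f x + S g x)) \<and>
     (\<forall>c. \<forall>f\<in>D. (\<lambda>x. c * f x) \<in> D \<and> S (\<lambda>x. c * f x) = (\<lambda>x. c * S f x))"

definition commutator ::
  "(('a \<Rightarrow> complex) \<Rightarrow> ('a \<Rightarrow> complex)) \<Rightarrow> ('a \<Rightarrow> complex) \<Rightarrow> ('a \<Rightarrow> complex) \<Rightarrow> ('a \<Rightarrow> complex)" where
  "commutator S b f x = S (\<lambda>y. (b x - b y) * f y) x"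

text \<open>
  Sequences with repeated entries are allowed; in an index set without a largest element this does
  not change the supremum.
\<close>

definition variation_norm :: "real \<Rightarrow> real set \<Rightarrow> (real \<Rightarrow> complex) \<Rightarrow> ennreal" where
  "variation_norm \<rho> I a =
     (SUP t\<in>{t :: nat \<Rightarrow> real. incseq t \<and> range t \<subseteq> I}.
        epowr (\<Sum>k. ennreal (norm (a (t (Suc k)) - a (t k)) powr \<rho>)) (1 / \<rho>))"

definition variation_op ::
  "real \<Rightarrow> (real \<Rightarrow> ('a \<Rightarrow> complex) \<Rightarrow> ('a \<Rightarrow> complex)) \<Rightarrow> ('a \<Rightarrow> complex) \<Rightarrow> ('a \<Rightarrow> ennreal)" where
  "variation_op \<rho> T f x = variation_norm \<rho> {0<..} (\<lambda>t. T t f x)"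

end

theory Submission
  imports Defs
begin

text \<open>
  The proof is the conjugation method of Coifman, Rochberg and Weiss. For linear \<open>T\<close> the commutator
  is the derivative at \<open>z = 0\<close> of \<open>exp (z b) T (exp (- z b) f)\<close>, so Cauchy's formula represents it as an
  average over a circle of radius \<open>\<delta>\<close> of these conjugated operators, divided by \<open>z\<close>. The variation is a
  seminorm; hence its norm on the commutator is at most \<open>1 / \<delta>\<close> times the worst norm of the variation
  of \<open>T\<close> on \<open>L\<^sup>p\<close> with the weight \<open>w exp (p Re (z b))\<close>. It remains to see that the \<open>\<tau>\<close>-th powers of these
  weights belong to \<open>A\<^sub>s\<close> with one constant when \<open>\<delta>\<close> is a small multiple of \<open>1 / bmo_norm b\<close>.

  \<^bold>\<open>Weights.\<close> An \<open>A\<^sub>s\<close> weight \<open>v\<close> gives a set that fills at most half of a cube at most a fixed fraction,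
  less than one, of the mass of the cube (\<open>muckenhoupt_half\<close>). With this, the usual stopping-time proof
  of the John--Nirenberg inequality works with \<open>v dx\<close> in place of \<open>dx\<close> and bounds the \<open>v\<close>-mean of
  \<open>exp \<bar>\<phi> - c\<bar>\<close>, where \<open>c\<close> is the Lebesgue average of a function \<open>\<phi>\<close> of small mean oscillation
  (\<open>weighted_John_Nirenberg\<close>). Applied to \<open>v\<close> and to the dual weight it shows that \<open>v exp \<phi>\<close> is again
  an \<open>A\<^sub>s\<close> weight (\<open>muckenhoupt_perturbation\<close>).

  \<^bold>\<open>Operators.\<close> The operators act on functions pointwise, and nothing is known about the dependence of
  \<open>T (exp (- z b) f) x\<close> on \<open>z\<close>; an integral over the circle need not make sense. The contour integral is
  therefore replaced by an average over \<open>2 K\<close>-th roots of unity of products of Taylor polynomials,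
  which reproduces \<open>b x - b y\<close> exactly (\<open>circle_average_extracts_difference\<close>) and uses only finite
  linear combinations. The Taylor remainders tend to zero in \<open>L\<^sup>p\<close> with the damped weight \<open>w exp (- 2 p \<delta> \<bar>b\<bar>)\<close>, fast
  enough to vanish almost everywhere (\<open>mean_errors_vanish\<close>), and Fatou's lemma gives the estimate
  (\<open>commutator_estimate\<close>).

  \<^bold>\<open>Local integrability.\<close> Only \<open>w\<^sup>\<tau>\<close> is an \<open>A\<^sub>s\<close> weight, while \<open>w\<close> is just locally integrable, so
  \<open>w exp (p Re (z b))\<close> may fail to be locally integrable. All weights to which the hypothesis is applied
  are therefore of the form \<open>w exp (G \<circ> b)\<close> with \<open>G\<close> Lipschitz and bounded above, and the full
  conjugated weight is reached as a pointwise limit (\<open>conjugated_estimate\<close>).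
\<close>

section \<open>Half-open cubes and grids\<close>

text \<open>
  Half-open cubes, because such a cube is the disjoint union of its dyadic children; the closed
  cube of the same side differs from it by a null set.
\<close>

definition hcube :: "'a::euclidean_space \<Rightarrow> real \<Rightarrow> 'a set" where
  "hcube a r = {x. \<forall>i\<in>Basis. a \<bullet> i \<le> x \<bullet> i \<and> x \<bullet> i < a \<bullet> i + r}"

lemma hcube_borel [measurable]: "hcube a r \<in> sets borel"
  unfolding hcube_def by measurable

lemma hcube_lebesgue [measurable]: "hcube a r \<in> sets lebesgue"
  by (simp add: hcube_borel)

lemma AE_hcube_iff_cbox:
  "AE x in lebesgue. x \<in> hcube a r \<longleftrightarrow> x \<in> cbox a (a + r *\<^sub>R One)"
proof -
  have "negligible (cbox a (a + r *\<^sub>R One) - box a (a + r *\<^sub>R One))"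
    by (rule negligible_frontier_interval)
  then have "AE x in lebesgue. x \<notin> cbox a (a + r *\<^sub>R One) - box a (a + r *\<^sub>R One)"
    unfolding negligible_iff_null_sets by (rule AE_not_in)
  then show ?thesis
  proof eventually_elim
    case (elim x)
    have "x \<in> hcube a r \<Longrightarrow> x \<in> cbox a (a + r *\<^sub>R One)"
      by (auto simp: hcube_def mem_box inner_add_left intro: less_imp_le)
    moreover have "x \<in> box a (a + r *\<^sub>R One) \<Longrightarrow> x \<in> hcube a r"
      by (auto simp: hcube_def mem_box inner_add_left intro: less_imp_le)
    ultimately show ?case using elim by auto
  qed
qed

lemma emeasure_cube:
  assumes "r \<ge> 0"
  shows "emeasure lebesgue (cbox a (a + r *\<^sub>R One :: 'a::euclidean_space)) = ennreal (r ^ DIM('a))"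
  using assms by (simp add: emeasure_lborel_cbox_eq inner_add_left inner_diff_left)

lemma emeasure_hcube:
  assumes "r \<ge> 0"
  shows "emeasure lebesgue (hcube a r :: 'a::euclidean_space set) = ennreal (r ^ DIM('a))"
proof -
  have "emeasure lebesgue (hcube a r) = emeasure lebesgue (cbox a (a + r *\<^sub>R One))"
    using AE_hcube_iff_cbox[of a r] by (intro emeasure_eq_AE) auto
  then show ?thesis using emeasure_cube[OF assms] by simp
qed

lemma measure_hcube:
  assumes "r \<ge> 0"
  shows "measure lebesgue (hcube a r :: 'a::euclidean_space set) = r ^ DIM('a)"
  using emeasure_hcube[OF assms, of a] assms by (simp add: measure_def)

lemma measure_cube:
  assumes "r \<ge> 0"
  shows "measure lebesgue (cbox a (a + r *\<^sub>R One :: 'a::euclidean_space)) = r ^ DIM('a)"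
  using emeasure_cube[OF assms, of a] assms by (simp add: measure_def)

text \<open>
  The simplifier turns volumes for the completed measure into volumes for \<open>lborel\<close>, so this is the
  form in which the volume of a cube can serve as a rewrite rule.
\<close>

lemma lborel_hcube [simp]:
  assumes "r \<ge> 0"
  shows "emeasure lborel (hcube a r :: 'a::euclidean_space set) = ennreal (r ^ DIM('a))"
    and "measure lborel (hcube a r :: 'a::euclidean_space set) = r ^ DIM('a)"
  using emeasure_hcube[OF assms, of a] measure_hcube[OF assms, of a] by simp_all

lemma inner_sum_subset_Basis:
  assumes "S \<subseteq> Basis" "j \<in> Basis"
  shows "(\<Sum>S) \<bullet> j = (if j \<in> S then 1 else 0 :: real)"
proof -
  have "finite S" using assms(1) finite_subset[OF _ finite_Basis] by blast
  have "(\<Sum>S) \<bullet> j = (\<Sum>i\<in>S. if i = j then 1 else 0)"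
    unfolding inner_sum_left using assms by (intro sum.cong) (auto simp: inner_Basis)
  then show ?thesis using \<open>finite S\<close> by simp
qed

text \<open>
  A child is named by the set of coordinates in which it occupies the upper half.
\<close>

lemma hcube_split:
  fixes a :: "'a::euclidean_space"
  assumes "r > 0"
  shows "hcube a (2 * r) = (\<Union>S\<in>Pow Basis. hcube (a + r *\<^sub>R \<Sum>S) r)"
    and "disjoint_family_on (\<lambda>S. hcube (a + r *\<^sub>R \<Sum>S) r) (Pow Basis)"
proof -
  have mem: "x \<in> hcube (a + r *\<^sub>R \<Sum>S) r \<longleftrightarrow> x \<in> hcube a (2 * r) \<and> S = {i\<in>Basis. a \<bullet> i + r \<le> x \<bullet> i}"
    if "S \<in> Pow Basis" for S x
  proof -
    have *: "(a + r *\<^sub>R \<Sum>S) \<bullet> i = a \<bullet> i + (if i \<in> S then r else 0)" if "i \<in> Basis" for i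
      using inner_sum_subset_Basis[of S i] that \<open>S \<in> Pow Basis\<close> by (simp add: inner_add_left)
    show ?thesis
    proof (intro iffI conjI)
      assume x: "x \<in> hcube (a + r *\<^sub>R \<Sum>S) r"
      have "a \<bullet> i + (if i \<in> S then r else 0) \<le> x \<bullet> i \<and> x \<bullet> i < a \<bullet> i + (if i \<in> S then r else 0) + r"
        if "i \<in> Basis" for i
        using x that * by (auto simp: hcube_def)
      note ** = this
      show "x \<in> hcube a (2 * r)"
        unfolding hcube_def using assms ** by (force split: if_splits)
      show "S = {i\<in>Basis. a \<bullet> i + r \<le> x \<bullet> i}"
        using ** that assms by (force split: if_splits)
    next
      assume "x \<in> hcube a (2 * r) \<and> S = {i\<in>Basis. a \<bullet> i + r \<le> x \<bullet> i}"
      then show "x \<in> hcube (a + r *\<^sub>R \<Sum>S) r"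
        unfolding hcube_def using * by auto
    qed
  qed
  show "hcube a (2 * r) = (\<Union>S\<in>Pow Basis. hcube (a + r *\<^sub>R \<Sum>S) r)"
  proof (intro set_eqI iffI)
    fix x assume "x \<in> hcube a (2 * r)"
    then have "x \<in> hcube (a + r *\<^sub>R \<Sum>{i\<in>Basis. a \<bullet> i + r \<le> x \<bullet> i}) r"
      by (subst mem) auto
    then show "x \<in> (\<Union>S\<in>Pow Basis. hcube (a + r *\<^sub>R \<Sum>S) r)"
      by (rule UN_I[rotated]) auto
  next
    fix x assume "x \<in> (\<Union>S\<in>Pow Basis. hcube (a + r *\<^sub>R \<Sum>S) r)"
    then obtain S where "S \<in> Pow Basis" "x \<in> hcube (a + r *\<^sub>R \<Sum>S) r" by (rule UN_E)
    then show "x \<in> hcube a (2 * r)" by (simp only: mem)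
  qed
  show "disjoint_family_on (\<lambda>S. hcube (a + r *\<^sub>R \<Sum>S) r) (Pow Basis)"
    unfolding disjoint_family_on_def
  proof (intro ballI impI)
    fix S S' :: "'a set" assume "S \<in> Pow Basis" "S' \<in> Pow Basis" "S \<noteq> S'"
    then show "hcube (a + r *\<^sub>R \<Sum>S) r \<inter> hcube (a + r *\<^sub>R \<Sum>S') r = {}"
      using mem[of S] mem[of S'] by auto
  qed
qed

lemma nn_integral_finite_disjoint_UN:
  assumes [measurable]: "f \<in> borel_measurable M" "\<And>i. i \<in> I \<Longrightarrow> B i \<in> sets M"
    and I: "finite I" "disjoint_family_on B I"
  shows "(\<integral>\<^sup>+x\<in>(\<Union>i\<in>I. B i). f x \<partial>M) = (\<Sum>i\<in>I. \<integral>\<^sup>+x\<in>B i. f x \<partial>M)"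
proof -
  have "(\<integral>\<^sup>+x\<in>(\<Union>i\<in>I. B i). f x \<partial>M) = (\<integral>\<^sup>+x. (\<Sum>i\<in>I. f x * indicator (B i) x) \<partial>M)"
    by (simp add: indicator_UN_disjoint[OF I] sum_distrib_left)
  also have "\<dots> = (\<Sum>i\<in>I. \<integral>\<^sup>+x\<in>B i. f x \<partial>M)"
    by (intro nn_integral_sum) auto
  finally show ?thesis .
qed

lemma nn_integral_hcube_split:
  fixes a :: "'a::euclidean_space"
  assumes [measurable]: "f \<in> borel_measurable lebesgue" and "r > 0"
  shows "(\<integral>\<^sup>+x\<in>hcube a (2 * r). f x \<partial>lebesgue)
    = (\<Sum>S\<in>Pow Basis. \<integral>\<^sup>+x\<in>hcube (a + r *\<^sub>R \<Sum>S) r. f x \<partial>lebesgue)"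
  unfolding hcube_split(1)[OF \<open>r > 0\<close>]
  by (intro nn_integral_finite_disjoint_UN hcube_split(2) assms) auto

definition grid_aligned :: "'a::euclidean_space \<Rightarrow> real \<Rightarrow> 'a \<Rightarrow> bool" where
  "grid_aligned q h a \<longleftrightarrow> (\<forall>i\<in>Basis. \<exists>k::int. a \<bullet> i = q \<bullet> i + h * k)"

definition grid_corner :: "'a::euclidean_space \<Rightarrow> real \<Rightarrow> 'a \<Rightarrow> 'a" where
  "grid_corner q h x = (\<Sum>i\<in>Basis. (q \<bullet> i + h * \<lfloor>(x \<bullet> i - q \<bullet> i) / h\<rfloor>) *\<^sub>R i)"

text \<open>
  The conditional expectation of \<open>f\<close> with respect to the grid of mesh \<open>h\<close> with origin \<open>q\<close>.
  The dyadic subcubes, down to side \<open>h\<close>, of a cube with corner \<open>q\<close> and side \<open>h * 2 ^ m\<close> have their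
  corners on this grid, so one function serves the recursion over all of them.
\<close>

definition grid_average ::
  "'a::euclidean_space \<Rightarrow> real \<Rightarrow> ('a \<Rightarrow> real) \<Rightarrow> 'a \<Rightarrow> real" where
  "grid_average q h f x = average (hcube (grid_corner q h x) h) f"

lemma grid_aligned_origin: "grid_aligned q h q"
  unfolding grid_aligned_def by (intro ballI exI[of _ 0]) simp

lemma grid_aligned_child:
  assumes "grid_aligned q h a" "S \<subseteq> Basis"
  shows "grid_aligned q h (a + (h * 2 ^ m) *\<^sub>R \<Sum>S)"
  unfolding grid_aligned_def
proof
  fix i :: 'a assume i: "i \<in> Basis"
  then obtain k :: int where k: "a \<bullet> i = q \<bullet> i + h * k"
    using assms(1) unfolding grid_aligned_def by blast
  have "(a + (h * 2 ^ m) *\<^sub>R \<Sum>S) \<bullet> i = q \<bullet> i + h * of_int (k + (if i \<in> S then 2 ^ m else 0))"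
    using inner_sum_subset_Basis[OF assms(2) i] k by (simp add: inner_add_left algebra_simps)
  then show "\<exists>k::int. (a + (h * 2 ^ m) *\<^sub>R \<Sum>S) \<bullet> i = q \<bullet> i + h * k" by blast
qed

lemma grid_corner_inner:
  "i \<in> Basis \<Longrightarrow> grid_corner q h x \<bullet> i = q \<bullet> i + h * \<lfloor>(x \<bullet> i - q \<bullet> i) / h\<rfloor>"
  unfolding grid_corner_def by simp

lemma mem_hcube_grid_corner:
  assumes "h > 0" shows "x \<in> hcube (grid_corner q h x) h"
  unfolding hcube_def
proof (intro CollectI ballI)
  fix i :: 'a assume i: "i \<in> Basis"
  define t where "t = (x \<bullet> i - q \<bullet> i) / h"
  have "x \<bullet> i = q \<bullet> i + h * t" using assms by (simp add: t_def)
  moreover have "h * of_int \<lfloor>t\<rfloor> \<le> h * t" using assms by (intro mult_left_mono) auto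
  moreover have "h * t < h * (of_int \<lfloor>t\<rfloor> + 1)" using assms
    by (intro mult_strict_left_mono) linarith+
  ultimately show "grid_corner q h x \<bullet> i \<le> x \<bullet> i \<and> x \<bullet> i < grid_corner q h x \<bullet> i + h"
    unfolding grid_corner_inner[OF i] t_def[symmetric] by (simp add: algebra_simps)
qed

lemma grid_corner_eq:
  assumes "h > 0" "grid_aligned q h a" "x \<in> hcube a h"
  shows "grid_corner q h x = a"
proof (rule euclidean_eqI)
  fix i :: 'a assume i: "i \<in> Basis"
  then obtain k :: int where k: "a \<bullet> i = q \<bullet> i + h * k"
    using assms(2) unfolding grid_aligned_def by blast
  have "a \<bullet> i \<le> x \<bullet> i" "x \<bullet> i < a \<bullet> i + h" using assms(3) i by (auto simp: hcube_def)
  then have "\<lfloor>(x \<bullet> i - q \<bullet> i) / h\<rfloor> = k"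
    using assms(1) k by (intro floor_unique) (auto simp: field_simps)
  then show "grid_corner q h x \<bullet> i = a \<bullet> i" using k i by (simp add: grid_corner_inner)
qed

lemma grid_aligned_corner: "grid_aligned q h (grid_corner q h x)"
  unfolding grid_aligned_def using grid_corner_inner by blast

lemma countable_range_grid_corner:
  "countable (range (grid_corner q h :: 'a::euclidean_space \<Rightarrow> 'a))"
proof -
  define F :: "('a \<Rightarrow> int) \<Rightarrow> 'a" where "F k = (\<Sum>i\<in>Basis. (q \<bullet> i + h * k i) *\<^sub>R i)" for k
  have "range (grid_corner q h) \<subseteq> F ` (PiE Basis (\<lambda>_. UNIV))"
  proof
    fix y assume "y \<in> range (grid_corner q h)"
    then obtain x where y: "y = grid_corner q h x" by blast
    have "y = F (restrict (\<lambda>i. \<lfloor>(x \<bullet> i - q \<bullet> i) / h\<rfloor>) Basis)"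
      unfolding y F_def grid_corner_def by (intro sum.cong) auto
    then show "y \<in> F ` (PiE Basis (\<lambda>_. UNIV))" by auto
  qed
  moreover have "countable (F ` (PiE Basis (\<lambda>_. UNIV)))"
    by (intro countable_image countable_PiE) auto
  ultimately show ?thesis by (rule countable_subset)
qed

lemma grid_average_measurable [measurable]:
  assumes "h > 0"
  shows "grid_average q h f \<in> borel_measurable lebesgue"
proof -
  have "grid_corner q h \<in> measurable lebesgue (count_space (range (grid_corner q h)))"
  proof (subst measurable_count_space_eq_countable[OF countable_range_grid_corner], intro conjI ballI)
    fix a assume "a \<in> range (grid_corner q h)"
    then have "grid_aligned q h a" using grid_aligned_corner by blast
    then have "grid_corner q h -` {a} \<inter> space lebesgue = hcube a h"
      using grid_corner_eq[OF assms] mem_hcube_grid_corner[OF assms, of _ q] by auto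
    then show "grid_corner q h -` {a} \<inter> space lebesgue \<in> sets lebesgue"
      by (simp only: hcube_lebesgue)
  qed auto
  then show ?thesis unfolding grid_average_def
    by (rule measurable_compose_countable'[OF _ _ countable_range_grid_corner, rotated]) simp
qed

lemma grid_average_on_hcube:
  assumes "h > 0" "grid_aligned q h a" "x \<in> hcube a h"
  shows "grid_average q h f x = average (hcube a h) f"
  unfolding grid_average_def grid_corner_eq[OF assms] ..

section \<open>Averages over cubes\<close>

lemma locally_integrable_measurable:
  assumes "locally_integrable f"
  shows "f \<in> borel_measurable lebesgue"
proof (rule borel_measurable_LIMSEQ_metric)
  show "(\<lambda>x. indicator (cball 0 (real n)) x *\<^sub>R f x) \<in> borel_measurable lebesgue" for n :: nat
    using assms unfolding locally_integrable_def set_integrable_def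
    by (intro borel_measurable_integrable) simp
next
  fix x :: 'a
  have "eventually (\<lambda>n. indicator (cball 0 (real n)) x *\<^sub>R f x = f x) sequentially"
    using eventually_ge_at_top[of "nat \<lceil>norm x\<rceil>"]
    by eventually_elim (auto simp: indicator_def)
  then show "(\<lambda>n. indicator (cball 0 (real n)) x *\<^sub>R f x) \<longlonglongrightarrow> f x"
    by (rule tendsto_eventually)
qed

lemma hcube_subset_cube: "hcube a r \<subseteq> cbox a (a + r *\<^sub>R One)"
  by (force simp: hcube_def mem_box inner_add_left intro: less_imp_le)

lemma locally_integrable_on_hcube:
  assumes "locally_integrable f"
  shows "set_integrable lebesgue (hcube a r) f"
proof -
  have "set_integrable lebesgue (cbox a (a + r *\<^sub>R One)) f"
    using assms by (auto simp: locally_integrable_def compact_cbox)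
  then show ?thesis by (rule set_integrable_subset) (auto simp: hcube_subset_cube)
qed

lemma set_integral_hcube:
  fixes f :: "'a::euclidean_space \<Rightarrow> 'b::{banach,second_countable_topology}"
  assumes [measurable]: "f \<in> borel_measurable lebesgue"
  shows "set_lebesgue_integral lebesgue (cbox a (a + r *\<^sub>R One)) f
    = set_lebesgue_integral lebesgue (hcube a r) f"
proof (rule set_integral_cong_set)
  show "set_borel_measurable lebesgue (hcube a r) f"
    "set_borel_measurable lebesgue (cbox a (a + r *\<^sub>R One)) f"
    unfolding set_borel_measurable_def
    by (intro borel_measurable_scaleR borel_measurable_indicator assms; simp)+
qed (rule AE_hcube_iff_cbox)

lemma average_hcube:
  fixes f :: "'a::euclidean_space \<Rightarrow> 'b::{banach,second_countable_topology}"
  assumes "f \<in> borel_measurable lebesgue" "r > 0"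
  shows "average (cbox a (a + r *\<^sub>R One)) f = average (hcube a r) f"
  using assms by (simp add: average_def set_integral_hcube del: measure_completion)
    (simp add: measure_hcube measure_cube del: measure_completion)

lemma set_nn_integral_eq_set_integral:
  fixes f :: "'a \<Rightarrow> real"
  assumes "set_integrable M A f" "\<And>x. 0 \<le> f x"
  shows "(\<integral>\<^sup>+x\<in>A. ennreal (f x) \<partial>M) = ennreal (set_lebesgue_integral M A f)"
proof -
  have "(\<integral>\<^sup>+x\<in>A. ennreal (f x) \<partial>M) = (\<integral>\<^sup>+x. ennreal (indicator A x *\<^sub>R f x) \<partial>M)"
    by (intro nn_integral_cong) (auto simp: indicator_def)
  also have "\<dots> = ennreal (set_lebesgue_integral M A f)"
    unfolding set_lebesgue_integral_def using assms
    by (intro nn_integral_eq_integral) (auto simp: set_integrable_def)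
  finally show ?thesis .
qed

lemma set_integrable_hcube_const: "set_integrable lebesgue (hcube (a::'a::euclidean_space) r) (\<lambda>x. c::real)"
proof -
  have "locally_integrable (\<lambda>x::'a. c)"
    unfolding locally_integrable_def set_integrable_def
    by (auto simp flip: lmeasurable_iff_integrable intro: lmeasurable_compact)
  then show ?thesis by (rule locally_integrable_on_hcube)
qed

text \<open>
  Both sides are multiplied by the volume of the cube, which keeps the inequality free of
  division in the extended reals.
\<close>

lemma average_deviation:
  fixes f :: "'a::euclidean_space \<Rightarrow> real"
  assumes f: "locally_integrable f" and r: "r > 0"
  shows "ennreal \<bar>average (hcube a r) f - c\<bar> * ennreal (r ^ DIM('a))
    \<le> (\<integral>\<^sup>+x\<in>hcube a r. ennreal \<bar>f x - c\<bar> \<partial>lebesgue)"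
proof -
  let ?H = "hcube a r"
  have i: "set_integrable lebesgue ?H (\<lambda>x. f x - c)"
    using locally_integrable_on_hcube[OF f] set_integrable_hcube_const
    by (rule set_integral_diff(1))
  have pos: "0 < r ^ DIM('a)" using r by simp
  have "(LINT x:?H|lebesgue. c) = r ^ DIM('a) * c"
    using r unfolding set_lebesgue_integral_def by simp
  then have "(LINT x:?H|lebesgue. f x - c) = r ^ DIM('a) * (average ?H f - c)"
    using set_integral_diff(2)[OF locally_integrable_on_hcube[OF f, of a r] set_integrable_hcube_const[of a r c]] pos r
    by (simp add: average_def less_imp_le[OF r] right_diff_distrib)
  then have "\<bar>average ?H f - c\<bar> * r ^ DIM('a) = \<bar>LINT x:?H|lebesgue. f x - c\<bar>"
    using pos by (simp add: abs_mult)
  also have "\<dots> \<le> (LINT x:?H|lebesgue. \<bar>f x - c\<bar>)"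
    using set_integral_norm_bound[OF i] by simp
  finally have "ennreal (\<bar>average ?H f - c\<bar> * r ^ DIM('a)) \<le> ennreal (LINT x:?H|lebesgue. \<bar>f x - c\<bar>)"
    by (rule ennreal_leI)
  also have "\<dots> = (\<integral>\<^sup>+x\<in>?H. ennreal \<bar>f x - c\<bar> \<partial>lebesgue)"
    using set_integrable_abs[OF i] by (intro set_nn_integral_eq_set_integral[symmetric]) auto
  finally show ?thesis using pos by (simp add: ennreal_mult)
qed

lemma oscillation_hcube:
  fixes f :: "'a::euclidean_space \<Rightarrow> real"
  assumes f: "locally_integrable f" and r: "r > 0"
    and osc: "\<And>Q. Q \<in> cubes \<Longrightarrow> mean_oscillation f Q \<le> \<kappa>"
  shows "(\<integral>\<^sup>+x\<in>hcube a r. ennreal \<bar>f x - average (hcube a r) f\<bar> \<partial>lebesgue)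
    \<le> ennreal (\<kappa> * r ^ DIM('a))"
proof -
  let ?H = "hcube a r" and ?Q = "cbox a (a + r *\<^sub>R One)"
  have m[measurable]: "f \<in> borel_measurable lebesgue" using f by (rule locally_integrable_measurable)
  have i: "set_integrable lebesgue ?H (\<lambda>x. \<bar>f x - average ?H f\<bar>)"
    by (intro set_integrable_abs set_integral_diff(1) locally_integrable_on_hcube[OF f]
        set_integrable_hcube_const)
  have "mean_oscillation f ?Q \<le> \<kappa>" using r by (intro osc) (auto simp: cubes_def)
  moreover have "mean_oscillation f ?Q = average ?H (\<lambda>x. \<bar>f x - average ?H f\<bar>)"
    unfolding mean_oscillation_def using r by (simp add: average_hcube)
  ultimately have "(LINT x:?H|lebesgue. \<bar>f x - average ?H f\<bar>) \<le> \<kappa> * r ^ DIM('a)"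
    using r by (simp add: average_def pos_divide_le_eq less_imp_le)
  then show ?thesis
    by (subst set_nn_integral_eq_set_integral[OF i]) (auto intro: ennreal_leI)
qed

text \<open>
  On a single grid cube this is the triangle inequality for the integral; larger aligned cubes
  are split into children.
\<close>

lemma grid_average_L1_contraction:
  fixes f :: "'a::euclidean_space \<Rightarrow> real"
  assumes f: "locally_integrable f" and h: "h > 0" and "grid_aligned q h a"
  shows "(\<integral>\<^sup>+x\<in>hcube a (h * 2 ^ m). ennreal \<bar>grid_average q h f x\<bar> \<partial>lebesgue)
    \<le> (\<integral>\<^sup>+x\<in>hcube a (h * 2 ^ m). ennreal \<bar>f x\<bar> \<partial>lebesgue)"
  using assms(3)
proof (induction m arbitrary: a)
  case 0
  have "(\<integral>\<^sup>+x\<in>hcube a h. ennreal \<bar>grid_average q h f x\<bar> \<partial>lebesgue)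
    = (\<integral>\<^sup>+x. ennreal \<bar>average (hcube a h) f\<bar> * indicator (hcube a h) x \<partial>lebesgue)"
    using 0 by (intro nn_integral_cong) (auto simp: indicator_def grid_average_on_hcube[OF h])
  also have "\<dots> = ennreal \<bar>average (hcube a h) f - 0\<bar> * ennreal (h ^ DIM('a))"
    using h by (simp add: nn_integral_cmult)
  also have "\<dots> \<le> (\<integral>\<^sup>+x\<in>hcube a h. ennreal \<bar>f x - 0\<bar> \<partial>lebesgue)"
    by (rule average_deviation[OF f h])
  finally show ?case by simp
next
  case (Suc m)
  have [measurable]: "f \<in> borel_measurable lebesgue" "grid_average q h f \<in> borel_measurable lebesgue"
    using f h by (auto intro: locally_integrable_measurable grid_average_measurable)
  have e: "h * 2 ^ Suc m = 2 * (h * 2 ^ m)" by simp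
  have p: "h * 2 ^ m > 0" using h by simp
  show ?case unfolding e
    by (subst (1 2) nn_integral_hcube_split[OF _ p], measurable)
       (intro sum_mono Suc.IH grid_aligned_child Suc.prems, auto)
qed

lemma dist_in_hcube:
  assumes "x \<in> hcube a r" "y \<in> hcube (a::'a::euclidean_space) r"
  shows "dist x y \<le> real DIM('a) * r"
proof -
  have "dist x y \<le> (\<Sum>i\<in>Basis. \<bar>(x - y) \<bullet> i\<bar>)"
    unfolding dist_norm by (rule norm_le_l1)
  also have "\<dots> \<le> (\<Sum>i\<in>(Basis::'a set). r)"
  proof (rule sum_mono)
    fix i :: 'a assume "i \<in> Basis"
    then show "\<bar>(x - y) \<bullet> i\<bar> \<le> r" using assms unfolding hcube_def
      by (auto simp: inner_diff_left abs_le_iff) (smt (verit))+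
  qed
  finally show ?thesis by simp
qed

text \<open>
  A truncation of \<open>f\<close> is close to \<open>f\<close> in \<open>L\<^sup>1\<close>. Lebesgue measurability supplies continuous
  functions converging to \<open>f\<close> almost everywhere, and once they are truncated at the same level a
  constant dominates them on the cube.
\<close>

lemma continuous_L1_approximation:
  fixes f :: "'a::euclidean_space \<Rightarrow> real"
  assumes f: "locally_integrable f" and e: "e > 0"
  obtains g where "continuous_on UNIV g"
    "(\<integral>\<^sup>+x\<in>hcube a r. ennreal \<bar>f x - g x\<bar> \<partial>lebesgue) \<le> ennreal e"
proof -
  let ?H = "hcube a r"
  have fm[measurable]: "f \<in> borel_measurable lebesgue" using f by (rule locally_integrable_measurable)
  define cl where "cl M t = max (- M) (min M t)" for M t :: real
  have fin: "(\<integral>\<^sup>+x\<in>?H. ennreal \<bar>f x\<bar> \<partial>lebesgue) < \<infinity>"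
    using locally_integrable_on_hcube[OF f, of a r]
    by (subst set_nn_integral_eq_set_integral) (auto intro: set_integrable_abs)
  have "(\<lambda>n. \<integral>\<^sup>+x\<in>?H. ennreal \<bar>f x - cl (real n) (f x)\<bar> \<partial>lebesgue) \<longlonglongrightarrow> (\<integral>\<^sup>+x. 0 \<partial>(lebesgue::'a measure))"
  proof (rule nn_integral_dominated_convergence[where w="\<lambda>x. ennreal \<bar>f x\<bar> * indicator ?H x"])
    show "AE x in lebesgue. (\<lambda>n. ennreal \<bar>f x - cl (real n) (f x)\<bar> * indicator ?H x) \<longlonglongrightarrow> 0"
    proof (rule AE_I2)
      fix x
      have "eventually (\<lambda>n. ennreal \<bar>f x - cl (real n) (f x)\<bar> * indicator ?H x = 0) sequentially"
        using eventually_ge_at_top[of "nat \<lceil>\<bar>f x\<bar>\<rceil>"]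
        by eventually_elim (auto simp: cl_def min_def max_def)
      then show "(\<lambda>n. ennreal \<bar>f x - cl (real n) (f x)\<bar> * indicator ?H x) \<longlonglongrightarrow> 0"
        by (rule tendsto_eventually)
    qed
    show "AE x in lebesgue. ennreal \<bar>f x - cl (real n) (f x)\<bar> * indicator ?H x \<le> ennreal \<bar>f x\<bar> * indicator ?H x" for n
      by (intro AE_I2 mult_right_mono ennreal_leI) (auto simp: cl_def min_def max_def)
    show "(\<integral>\<^sup>+x. ennreal \<bar>f x\<bar> * indicator ?H x \<partial>lebesgue) < \<infinity>" by (rule fin)
  qed (auto simp: cl_def)
  then have "eventually (\<lambda>n. (\<integral>\<^sup>+x\<in>?H. ennreal \<bar>f x - cl (real n) (f x)\<bar> \<partial>lebesgue) < ennreal (e/2)) sequentially"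
    using e by (intro order_tendstoD(2)) auto
  then obtain n :: nat where n: "(\<integral>\<^sup>+x\<in>?H. ennreal \<bar>f x - cl n (f x)\<bar> \<partial>lebesgue) < ennreal (e/2)"
    by (auto simp: eventually_sequentially)
  have "f measurable_on UNIV"
    using fm by (simp add: measurable_on_iff_borel_measurable)
  then obtain N g where N: "negligible N" and g: "\<And>k. continuous_on UNIV (g k)"
    "\<And>x. x \<notin> N \<Longrightarrow> (\<lambda>k. g k x) \<longlonglongrightarrow> f x"
    unfolding measurable_on_def by auto
  have gm[measurable]: "g k \<in> borel_measurable lebesgue" for k
    by (rule measurable_completion) (simp add: borel_measurable_continuous_onI g)
  have "(\<lambda>k. \<integral>\<^sup>+x\<in>?H. ennreal \<bar>cl n (f x) - cl n (g k x)\<bar> \<partial>lebesgue) \<longlonglongrightarrow> (\<integral>\<^sup>+x. 0 \<partial>(lebesgue::'a measure))"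
  proof (rule nn_integral_dominated_convergence[where w="\<lambda>x. ennreal (2 * real n) * indicator ?H x"])
    have "AE x in lebesgue. x \<notin> N" using N unfolding negligible_iff_null_sets by (rule AE_not_in)
    then show "AE x in lebesgue. (\<lambda>k. ennreal \<bar>cl n (f x) - cl n (g k x)\<bar> * indicator ?H x) \<longlonglongrightarrow> 0"
    proof eventually_elim
      case (elim x)
      have "(\<lambda>k. \<bar>cl n (f x) - cl n (g k x)\<bar>) \<longlonglongrightarrow> \<bar>cl n (f x) - cl n (f x)\<bar>"
        unfolding cl_def by (intro tendsto_intros g(2) elim)
      then have "(\<lambda>k. ennreal \<bar>cl n (f x) - cl n (g k x)\<bar>) \<longlonglongrightarrow> ennreal 0"
        by (intro tendsto_ennrealI) simp
      then show ?case by (cases "x \<in> ?H") auto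
    qed
    show "AE x in lebesgue. ennreal \<bar>cl n (f x) - cl n (g k x)\<bar> * indicator ?H x \<le> ennreal (2 * real n) * indicator ?H x" for k
      by (intro AE_I2 mult_right_mono ennreal_leI) (auto simp: cl_def min_def max_def)
    show "(\<integral>\<^sup>+x. ennreal (2 * real n) * indicator ?H x \<partial>lebesgue) < \<infinity>"
    proof -
      have "emeasure lebesgue ?H \<le> emeasure lebesgue (cbox a (a + r *\<^sub>R One))"
        by (intro emeasure_mono hcube_subset_cube) auto
      also have "\<dots> < \<infinity>"
        using emeasure_lborel_cbox_finite[of a "a + r *\<^sub>R One"] by simp
      finally show ?thesis
        by (simp add: nn_integral_cmult_indicator ennreal_mult_less_top)
    qed
  qed (auto simp: cl_def)
  then have "eventually (\<lambda>k. (\<integral>\<^sup>+x\<in>?H. ennreal \<bar>cl n (f x) - cl n (g k x)\<bar> \<partial>lebesgue) < ennreal (e/2)) sequentially"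
    using e by (intro order_tendstoD(2)) auto
  then obtain k where k: "(\<integral>\<^sup>+x\<in>?H. ennreal \<bar>cl n (f x) - cl n (g k x)\<bar> \<partial>lebesgue) < ennreal (e/2)"
    by (auto simp: eventually_sequentially)
  have "(\<integral>\<^sup>+x\<in>?H. ennreal \<bar>f x - cl n (g k x)\<bar> \<partial>lebesgue)
    \<le> (\<integral>\<^sup>+x. ennreal \<bar>f x - cl n (f x)\<bar> * indicator ?H x + ennreal \<bar>cl n (f x) - cl n (g k x)\<bar> * indicator ?H x \<partial>lebesgue)"
    by (intro nn_integral_mono) (auto simp: indicator_def ennreal_plus[symmetric] simp del: ennreal_plus intro!: ennreal_leI)
  also have "\<dots> = (\<integral>\<^sup>+x\<in>?H. ennreal \<bar>f x - cl n (f x)\<bar> \<partial>lebesgue) + (\<integral>\<^sup>+x\<in>?H. ennreal \<bar>cl n (f x) - cl n (g k x)\<bar> \<partial>lebesgue)"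
    by (intro nn_integral_add) (auto simp: cl_def)
  also have "\<dots> \<le> ennreal (e/2) + ennreal (e/2)" using n k by (intro add_mono) auto
  also have "\<dots> = ennreal e" using e by (simp add: ennreal_plus[symmetric] del: ennreal_plus)
  finally have "(\<integral>\<^sup>+x\<in>?H. ennreal \<bar>f x - cl n (g k x)\<bar> \<partial>lebesgue) \<le> ennreal e" .
  moreover have "continuous_on UNIV (\<lambda>x. cl n (g k x))"
    unfolding cl_def by (intro continuous_intros g)
  ultimately show ?thesis by (rule that[rotated])
qed

section \<open>Convergence of grid averages\<close>

lemma tendsto_zero_ennrealI:
  fixes u :: "nat \<Rightarrow> ennreal"
  assumes "\<And>e::real. e > 0 \<Longrightarrow> eventually (\<lambda>n. u n \<le> ennreal e) sequentially"
  shows "u \<longlonglongrightarrow> 0"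
proof (rule order_tendstoI)
  fix y :: ennreal assume "0 < y"
  then obtain e where e: "0 < e" "e < y" using dense by blast
  then obtain e' where "e = ennreal e'" "e' \<ge> 0" by (cases e) auto
  then show "eventually (\<lambda>n. u n < y) sequentially"
    using assms[of e'] e by (auto elim!: eventually_mono)
qed auto

text \<open>
  The sum of the functions has finite integral, hence is finite almost everywhere, and the terms
  of a convergent series tend to zero.
\<close>

lemma AE_tendsto_zero_of_summable:
  fixes F :: "nat \<Rightarrow> 'a \<Rightarrow> ennreal"
  assumes [measurable]: "\<And>k. F k \<in> borel_measurable M"
    and fin: "(\<Sum>k. \<integral>\<^sup>+x. F k x \<partial>M) < \<infinity>"
  shows "AE x in M. (\<lambda>k. F k x) \<longlonglongrightarrow> 0"
proof -
  have "(\<integral>\<^sup>+x. (\<Sum>k. F k x) \<partial>M) \<noteq> \<infinity>"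
    using fin by (subst nn_integral_suminf) auto
  then have "AE x in M. (\<Sum>k. F k x) \<noteq> \<infinity>"
    by (intro nn_integral_noteq_infinite) auto
  then show ?thesis
  proof eventually_elim
    case (elim x)
    have t: "F k x \<noteq> top" for k
    proof
      assume "F k x = top"
      moreover have "(\<Sum>i\<in>{k}. F i x) \<le> (\<Sum>i. F i x)" by (rule sum_le_suminf) auto
      ultimately show False using elim by (simp add: top_unique)
    qed
    have e: "F k x = ennreal (enn2real (F k x))" for k
      using t[of k] by (simp add: less_top)
    have "(\<Sum>k. ennreal (enn2real (F k x))) \<noteq> top" using elim e by simp
    then have "summable (\<lambda>k. enn2real (F k x))"
      by (intro summable_suminf_not_top) auto
    then have "(\<lambda>k. ennreal (enn2real (F k x))) \<longlonglongrightarrow> ennreal 0"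
      by (intro tendsto_ennrealI summable_LIMSEQ_zero)
    then show ?case using e by simp
  qed
qed

lemma continuous_imp_locally_integrable:
  fixes g :: "'a::euclidean_space \<Rightarrow> 'b::{banach,second_countable_topology}"
  assumes "continuous_on UNIV g"
  shows "locally_integrable g"
  unfolding locally_integrable_def set_integrable_def
proof (intro allI impI)
  fix K :: "'a set" assume K: "compact K"
  have "integrable lborel (\<lambda>x. indicator K x *\<^sub>R g x)"
    by (rule borel_integrable_compact[OF K continuous_on_subset[OF assms]]) auto
  then show "integrable lebesgue (\<lambda>x. indicator K x *\<^sub>R g x)"
    by (subst integrable_completion) (auto dest: borel_measurable_integrable)
qed

lemma grid_average_diff:
  assumes "locally_integrable f" "locally_integrable g"
  shows "grid_average q h (\<lambda>x. f x - g x) x = grid_average q h f x - grid_average q h g x"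
  unfolding grid_average_def average_def
  using assms by (simp add: set_integral_diff(2) locally_integrable_on_hcube right_diff_distrib diff_divide_distrib)

lemma locally_integrable_diff:
  assumes "locally_integrable f" "locally_integrable g"
  shows "locally_integrable (\<lambda>x. f x - g x)"
  using assms unfolding locally_integrable_def by (auto intro: set_integral_diff(1))

lemma grid_average_continuous_approx:
  fixes g :: "'a::euclidean_space \<Rightarrow> real"
  assumes g: "continuous_on UNIV g" and "e > 0" "r > 0"
  shows "eventually (\<lambda>m. \<forall>x\<in>hcube q r. \<bar>grid_average q (r / 2 ^ m) g x - g x\<bar> \<le> e) sequentially"
proof -
  define n where "n = real DIM('a)"
  have n: "n \<ge> 1" using DIM_positive[where 'a='a] by (simp add: n_def Suc_le_eq)
  let ?K = "cball q (2 * n * r)"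
  have "uniformly_continuous_on ?K g"
    by (intro compact_uniformly_continuous continuous_on_subset[OF g]) auto
  then obtain d where d: "d > 0" "\<And>x y. x \<in> ?K \<Longrightarrow> y \<in> ?K \<Longrightarrow> dist y x < d \<Longrightarrow> dist (g y) (g x) < e"
    unfolding uniformly_continuous_on_def using \<open>e > 0\<close> by metis
  have "(\<lambda>m. n * r * (1 / 2) ^ m) \<longlonglongrightarrow> n * r * 0"
    by (intro tendsto_intros LIMSEQ_realpow_zero) auto
  then have "eventually (\<lambda>m. n * r * (1 / 2) ^ m < d) sequentially"
    using d(1) by (intro order_tendstoD(2)) auto
  then show ?thesis
  proof eventually_elim
    case (elim m)
    define h where "h = r / 2 ^ m"
    have h: "h > 0" "h \<le> r" "n * h < d"
      using \<open>r > 0\<close> elim by (auto simp: h_def field_simps power_one_over)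
    show ?case unfolding h_def[symmetric]
    proof
      fix x assume x: "x \<in> hcube q r"
      let ?c = "hcube (grid_corner q h x) h"
      have xc: "x \<in> ?c" using mem_hcube_grid_corner[OF h(1)] by auto
      have q: "q \<in> hcube q r" using \<open>r > 0\<close> by (auto simp: hcube_def)
      have bound: "\<bar>g y - g x\<bar> \<le> e" if "y \<in> ?c" for y
      proof -
        have 1: "dist y x \<le> n * h" using dist_in_hcube[OF that xc] by (simp add: n_def)
        have 2: "dist q x \<le> n * r" using dist_in_hcube[OF q x] by (simp add: n_def)
        have "n * h \<le> n * r" "0 \<le> n * r" "2 * n * r = n * r + n * r" using n h by auto
        then have "dist q y \<le> 2 * n * r" "dist q x \<le> 2 * n * r"
          using 1 2 dist_triangle[of q y x] dist_commute[of x y] by linarith+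
        then show ?thesis using d(2)[of x y] 1 h by (simp add: dist_real_def)
      qed
      have "ennreal \<bar>grid_average q h g x - g x\<bar> * ennreal (h ^ DIM('a))
        \<le> (\<integral>\<^sup>+y\<in>?c. ennreal \<bar>g y - g x\<bar> \<partial>lebesgue)"
        unfolding grid_average_def
        by (rule average_deviation[OF continuous_imp_locally_integrable[OF g] h(1)])
      also have "\<dots> \<le> (\<integral>\<^sup>+y. ennreal e * indicator ?c y \<partial>lebesgue)"
        by (intro nn_integral_mono) (auto simp: indicator_def bound intro: ennreal_leI)
      also have "\<dots> = ennreal e * ennreal (h ^ DIM('a))"
        using h by (simp add: nn_integral_cmult_indicator)
      finally have "\<bar>grid_average q h g x - g x\<bar> * h ^ DIM('a) \<le> e * h ^ DIM('a)"
        using h \<open>e > 0\<close> by (simp add: ennreal_mult[symmetric])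
      then show "\<bar>grid_average q h g x - g x\<bar> \<le> e" using h by simp
    qed
  qed
qed

text \<open>
  Averaging is an \<open>L\<^sup>1\<close> contraction and continuous functions are dense, so only a continuous
  function has to be considered, where uniform continuity suffices. Through this convergence the
  bounds for grid averages pass to \<open>f\<close>.
\<close>

lemma grid_average_tendsto_L1:
  fixes f :: "'a::euclidean_space \<Rightarrow> real"
  assumes f: "locally_integrable f" and r: "r > 0"
  shows "(\<lambda>m. \<integral>\<^sup>+x\<in>hcube q r. ennreal \<bar>grid_average q (r / 2 ^ m) f x - f x\<bar> \<partial>lebesgue) \<longlonglongrightarrow> 0"
proof (rule tendsto_zero_ennrealI)
  fix e :: real assume e: "e > 0"
  let ?H = "hcube q r"
  have rn: "r ^ DIM('a) > 0" using r by simp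
  obtain g where g: "continuous_on UNIV g"
    "(\<integral>\<^sup>+x\<in>?H. ennreal \<bar>f x - g x\<bar> \<partial>lebesgue) \<le> ennreal (e / 3)"
    using continuous_L1_approximation[OF f, of "e / 3" q r] e by auto
  have gl: "locally_integrable g" by (rule continuous_imp_locally_integrable[OF g(1)])
  have d: "locally_integrable (\<lambda>x. f x - g x)" by (rule locally_integrable_diff[OF f gl])
  have [measurable]: "f \<in> borel_measurable lebesgue" "g \<in> borel_measurable lebesgue"
    using f gl by (auto intro: locally_integrable_measurable)
  have "e / 3 / r ^ DIM('a) > 0" using e rn by simp
  from grid_average_continuous_approx[OF g(1) this r, of q]
  show "eventually (\<lambda>m. (\<integral>\<^sup>+x\<in>?H. ennreal \<bar>grid_average q (r / 2 ^ m) f x - f x\<bar> \<partial>lebesgue) \<le> ennreal e) sequentially"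
  proof eventually_elim
    case (elim m)
    define h where "h = r / 2 ^ m"
    have h: "h > 0" "h * 2 ^ m = r" using r by (auto simp: h_def)
    note [measurable] = grid_average_measurable[OF h(1)]
    have "(\<integral>\<^sup>+x\<in>?H. ennreal \<bar>grid_average q h f x - f x\<bar> \<partial>lebesgue)
      \<le> (\<integral>\<^sup>+x. ennreal \<bar>grid_average q h (\<lambda>x. f x - g x) x\<bar> * indicator ?H x +
          (ennreal (e / 3 / r ^ DIM('a)) * indicator ?H x + ennreal \<bar>f x - g x\<bar> * indicator ?H x) \<partial>lebesgue)"
    proof (rule nn_integral_mono)
      fix x
      have "\<bar>grid_average q h f x - f x\<bar>
        \<le> \<bar>grid_average q h (\<lambda>x. f x - g x) x\<bar> + (e / 3 / r ^ DIM('a) + \<bar>f x - g x\<bar>)" if "x \<in> ?H"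
        using elim[folded h_def, rule_format, OF that] grid_average_diff[OF f gl, of q h x] by linarith
      then show "ennreal \<bar>grid_average q h f x - f x\<bar> * indicator ?H x
        \<le> ennreal \<bar>grid_average q h (\<lambda>x. f x - g x) x\<bar> * indicator ?H x +
          (ennreal (e / 3 / r ^ DIM('a)) * indicator ?H x + ennreal \<bar>f x - g x\<bar> * indicator ?H x)"
        using e rn by (auto simp: indicator_def ennreal_plus[symmetric] simp del: ennreal_plus intro!: ennreal_leI)
    qed
    also have "\<dots> = (\<integral>\<^sup>+x\<in>?H. ennreal \<bar>grid_average q h (\<lambda>x. f x - g x) x\<bar> \<partial>lebesgue)
      + ((\<integral>\<^sup>+x. ennreal (e / 3 / r ^ DIM('a)) * indicator ?H x \<partial>lebesgue) + (\<integral>\<^sup>+x\<in>?H. ennreal \<bar>f x - g x\<bar> \<partial>lebesgue))"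
      by (simp add: nn_integral_add)
    also have "(\<integral>\<^sup>+x. ennreal (e / 3 / r ^ DIM('a)) * indicator ?H x \<partial>lebesgue) = ennreal (e / 3)"
      using r e by (simp add: nn_integral_cmult_indicator ennreal_mult[symmetric])
    also have "(\<integral>\<^sup>+x\<in>?H. ennreal \<bar>grid_average q h (\<lambda>x. f x - g x) x\<bar> \<partial>lebesgue) + (ennreal (e / 3) + (\<integral>\<^sup>+x\<in>?H. ennreal \<bar>f x - g x\<bar> \<partial>lebesgue))
      \<le> ennreal (e / 3) + (ennreal (e / 3) + ennreal (e / 3))"
      using grid_average_L1_contraction[OF d h(1) grid_aligned_origin, of q m] g(2)
      unfolding h(2) by (intro add_mono order_refl) (auto intro: order_trans)
    also have "\<dots> = ennreal e"
      using e by (simp add: ennreal_plus[symmetric] del: ennreal_plus)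
    finally show ?case unfolding h_def .
  qed
qed

lemma grid_average_AE_subsequence:
  fixes f :: "'a::euclidean_space \<Rightarrow> real"
  assumes f: "locally_integrable f" and r: "r > 0"
  obtains s :: "nat \<Rightarrow> nat" where
    "AE x in lebesgue. x \<in> hcube q r \<longrightarrow> (\<lambda>j. grid_average q (r / 2 ^ s j) f x) \<longlonglongrightarrow> f x"
proof -
  let ?H = "hcube q r"
  let ?u = "\<lambda>m x. ennreal \<bar>grid_average q (r / 2 ^ m) f x - f x\<bar> * indicator ?H x"
  have "\<exists>m. (\<integral>\<^sup>+x. ?u m x \<partial>lebesgue) < ennreal ((1/2) ^ j)" for j :: nat
    using order_tendstoD(2)[OF grid_average_tendsto_L1[OF f r, of q], of "ennreal ((1/2) ^ j)"]
    by (auto simp: eventually_sequentially)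
  then obtain s where s: "\<And>j. (\<integral>\<^sup>+x. ?u (s j) x \<partial>lebesgue) < ennreal ((1/2) ^ j)" by metis
  have "(\<Sum>j. \<integral>\<^sup>+x. ?u (s j) x \<partial>lebesgue) \<le> (\<Sum>j. ennreal ((1/2) ^ j))"
    using s by (intro suminf_le) (auto intro: less_imp_le)
  also have "\<dots> = ennreal (\<Sum>j. (1/2) ^ j)"
    by (intro suminf_ennreal2 summable_geometric) auto
  also have "\<dots> < \<infinity>" by simp
  finally have fin: "(\<Sum>j. \<integral>\<^sup>+x. ?u (s j) x \<partial>lebesgue) < \<infinity>" .
  have [measurable]: "f \<in> borel_measurable lebesgue" "\<And>m. grid_average q (r / 2 ^ m) f \<in> borel_measurable lebesgue"
    using f r by (auto intro: locally_integrable_measurable grid_average_measurable)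
  have "AE x in lebesgue. (\<lambda>j. ?u (s j) x) \<longlonglongrightarrow> 0"
    by (rule AE_tendsto_zero_of_summable[OF _ fin]) measurable
  then have "AE x in lebesgue. x \<in> ?H \<longrightarrow> (\<lambda>j. grid_average q (r / 2 ^ s j) f x) \<longlonglongrightarrow> f x"
  proof eventually_elim
    case (elim x)
    show ?case
    proof
      assume "x \<in> ?H"
      then have "(\<lambda>j. ennreal \<bar>grid_average q (r / 2 ^ s j) f x - f x\<bar>) \<longlonglongrightarrow> ennreal 0"
        using elim by simp
      then have "(\<lambda>j. \<bar>grid_average q (r / 2 ^ s j) f x - f x\<bar>) \<longlonglongrightarrow> 0"
        by (subst (asm) tendsto_ennreal_iff) auto
      then show "(\<lambda>j. grid_average q (r / 2 ^ s j) f x) \<longlonglongrightarrow> f x"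
        by (simp add: tendsto_rabs_zero_iff LIM_zero_iff)
    qed
  qed
  then show ?thesis by (rule that)
qed

section \<open>A weighted John--Nirenberg inequality\<close>

lemma deviation_le_of_integral_le:
  fixes f :: "'a::euclidean_space \<Rightarrow> real"
  assumes f: "locally_integrable f" and r: "r > 0" and b: "b \<ge> 0"
    and le: "(\<integral>\<^sup>+x\<in>hcube a r. ennreal \<bar>f x - c\<bar> \<partial>lebesgue) \<le> ennreal (b * r ^ DIM('a))"
  shows "\<bar>average (hcube a r) f - c\<bar> \<le> b"
proof -
  have p: "r ^ DIM('a) > 0" using r by simp
  have "ennreal (\<bar>average (hcube a r) f - c\<bar> * r ^ DIM('a)) \<le> ennreal (b * r ^ DIM('a))"
    using order_trans[OF average_deviation[OF f r, of a c] le] p by (simp add: ennreal_mult)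
  then have "\<bar>average (hcube a r) f - c\<bar> * r ^ DIM('a) \<le> b * r ^ DIM('a)"
    using p b by simp
  then show ?thesis using p by simp
qed

text \<open>
  The Calderon--Zygmund stopping argument, run down to the mesh of the grid only. The set \<open>E\<close> is
  the union of the maximal dyadic subcubes on which the mean of \<open>\<bar>f - c\<bar>\<close> exceeds \<open>2\<kappa>\<close>. Outside \<open>E\<close>
  the grid average stays within \<open>2\<kappa>\<close> of \<open>c\<close>. A stopped cube has a parent that was not stopped, so
  its mean lies within \<open>2 * 2 ^ DIM('a) * \<kappa>\<close> of \<open>c\<close>, and there the assumed exponential bound for
  smaller cubes applies with the mean shifted by that amount. In the recursion over \<open>m\<close> every child
  is either stopped or passed on.
\<close>

lemma stopping_decomposition:
  fixes f :: "'a::euclidean_space \<Rightarrow> real" and v :: "'a \<Rightarrow> ennreal"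
  assumes f: "locally_integrable f" and vm[measurable]: "v \<in> borel_measurable lebesgue"
    and h: "h > 0" and \<kappa>: "\<kappa> > 0" and X: "X \<ge> 0"
    and smaller: "\<And>j a. j < M \<Longrightarrow> grid_aligned q h a \<Longrightarrow>
      (\<integral>\<^sup>+x\<in>hcube a (h * 2 ^ j).
          ennreal (exp \<bar>grid_average q h f x - average (hcube a (h * 2 ^ j)) f\<bar>) * v x \<partial>lebesgue)
        \<le> ennreal X * (\<integral>\<^sup>+x\<in>hcube a (h * 2 ^ j). v x \<partial>lebesgue)"
    and "m \<le> M" "grid_aligned q h a"
    and "(\<integral>\<^sup>+x\<in>hcube a (h * 2 ^ m). ennreal \<bar>f x - c\<bar> \<partial>lebesgue)
      \<le> ennreal (2 * \<kappa> * (h * 2 ^ m) ^ DIM('a))"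
  shows "\<exists>E\<in>sets lebesgue. E \<subseteq> hcube a (h * 2 ^ m) \<and>
      ennreal (2 * \<kappa>) * emeasure lebesgue E \<le> (\<integral>\<^sup>+x\<in>E. ennreal \<bar>f x - c\<bar> \<partial>lebesgue) \<and>
      (\<integral>\<^sup>+x\<in>hcube a (h * 2 ^ m). ennreal (exp \<bar>grid_average q h f x - c\<bar>) * v x \<partial>lebesgue)
        \<le> ennreal (exp (2 * \<kappa>)) * (\<integral>\<^sup>+x\<in>hcube a (h * 2 ^ m). v x \<partial>lebesgue)
          + ennreal (exp (2 * 2 ^ DIM('a) * \<kappa>) * X) * (\<integral>\<^sup>+x\<in>E. v x \<partial>lebesgue)"
  using assms(7-)
proof (induction m arbitrary: a)
  case 0
  have dev: "\<bar>average (hcube a h) f - c\<bar> \<le> 2 * \<kappa>"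
    using 0 \<kappa> by (intro deviation_le_of_integral_le[OF f h]) auto
  have "(\<integral>\<^sup>+x\<in>hcube a h. ennreal (exp \<bar>grid_average q h f x - c\<bar>) * v x \<partial>lebesgue)
    \<le> (\<integral>\<^sup>+x. ennreal (exp (2 * \<kappa>)) * (v x * indicator (hcube a h) x) \<partial>lebesgue)"
    using 0(2) dev
    by (intro nn_integral_mono)
       (auto simp: indicator_def grid_average_on_hcube[OF h] intro!: mult_right_mono ennreal_leI)
  also have "\<dots> = ennreal (exp (2 * \<kappa>)) * (\<integral>\<^sup>+x\<in>hcube a h. v x \<partial>lebesgue)"
    by (intro nn_integral_cmult) auto
  finally show ?case by (intro bexI[of _ "{}"]) auto
next
  case (Suc m)
  define r where "r = h * 2 ^ m"
  have r: "r > 0" and r2: "h * 2 ^ Suc m = 2 * r" using h by (auto simp: r_def)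
  note [measurable] = grid_average_measurable[OF h]
  have fm[measurable]: "f \<in> borel_measurable lebesgue" using f by (rule locally_integrable_measurable)
  let ?child = "\<lambda>S. hcube (a + r *\<^sub>R \<Sum>S) r"
  let ?w = "\<lambda>x. ennreal (exp \<bar>grid_average q h f x - c\<bar>) * v x"
  let ?D = "exp (2 * 2 ^ DIM('a) * \<kappa>) * X"
  define good where "good S E \<longleftrightarrow> E \<in> sets lebesgue \<and> E \<subseteq> ?child S \<and>
      ennreal (2 * \<kappa>) * emeasure lebesgue E \<le> (\<integral>\<^sup>+x\<in>E. ennreal \<bar>f x - c\<bar> \<partial>lebesgue) \<and>
      (\<integral>\<^sup>+x\<in>?child S. ?w x \<partial>lebesgue)
        \<le> ennreal (exp (2 * \<kappa>)) * (\<integral>\<^sup>+x\<in>?child S. v x \<partial>lebesgue)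
          + ennreal ?D * (\<integral>\<^sup>+x\<in>E. v x \<partial>lebesgue)" for S E
  have "\<exists>E. good S E" if S: "S \<in> Pow Basis" for S
  proof -
    have al: "grid_aligned q h (a + r *\<^sub>R \<Sum>S)"
      unfolding r_def using S by (intro grid_aligned_child Suc.prems) auto
    show ?thesis
    proof (cases "(\<integral>\<^sup>+x\<in>?child S. ennreal \<bar>f x - c\<bar> \<partial>lebesgue) \<le> ennreal (2 * \<kappa> * r ^ DIM('a))")
      case True
      then show ?thesis using Suc.IH[of "a + r *\<^sub>R \<Sum>S"] Suc.prems(1) al
        unfolding r_def good_def Bex_def by simp
    next
      case False
      let ?A = "average (?child S) f"
      have sub: "?child S \<subseteq> hcube a (2 * r)" unfolding hcube_split(1)[OF r] using S by blast
      have "(\<integral>\<^sup>+x\<in>?child S. ennreal \<bar>f x - c\<bar> \<partial>lebesgue)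
        \<le> (\<integral>\<^sup>+x\<in>hcube a (2 * r). ennreal \<bar>f x - c\<bar> \<partial>lebesgue)"
        by (rule nn_set_integral_set_mono[OF sub])
      also have "\<dots> \<le> ennreal (2 * 2 ^ DIM('a) * \<kappa> * r ^ DIM('a))"
        using Suc.prems(3) unfolding r2 by (simp add: power_mult_distrib mult_ac)
      finally have dev: "\<bar>?A - c\<bar> \<le> 2 * 2 ^ DIM('a) * \<kappa>"
        using \<kappa> by (intro deviation_le_of_integral_le[OF f r]) auto
      have "(\<integral>\<^sup>+x\<in>?child S. ?w x \<partial>lebesgue)
        \<le> (\<integral>\<^sup>+x. ennreal (exp (2 * 2 ^ DIM('a) * \<kappa>)) *
            (ennreal (exp \<bar>grid_average q h f x - ?A\<bar>) * v x * indicator (?child S) x) \<partial>lebesgue)"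
      proof (rule nn_integral_mono)
        fix x
        have "exp \<bar>grid_average q h f x - c\<bar>
          \<le> exp (2 * 2 ^ DIM('a) * \<kappa> + \<bar>grid_average q h f x - ?A\<bar>)"
          using dev by (subst exp_le_cancel_iff) linarith
        then have "ennreal (exp \<bar>grid_average q h f x - c\<bar>)
          \<le> ennreal (exp (2 * 2 ^ DIM('a) * \<kappa>)) * ennreal (exp \<bar>grid_average q h f x - ?A\<bar>)"
          by (simp add: ennreal_mult[symmetric] exp_add)
        then show "?w x * indicator (?child S) x \<le> ennreal (exp (2 * 2 ^ DIM('a) * \<kappa>)) *
            (ennreal (exp \<bar>grid_average q h f x - ?A\<bar>) * v x * indicator (?child S) x)"
          by (auto simp: indicator_def mult.assoc[symmetric] intro!: mult_right_mono)
      qed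
      also have "\<dots> = ennreal (exp (2 * 2 ^ DIM('a) * \<kappa>)) *
          (\<integral>\<^sup>+x\<in>?child S. ennreal (exp \<bar>grid_average q h f x - ?A\<bar>) * v x \<partial>lebesgue)"
        by (intro nn_integral_cmult) auto
      also have "\<dots> \<le> ennreal (exp (2 * 2 ^ DIM('a) * \<kappa>)) * (ennreal X * (\<integral>\<^sup>+x\<in>?child S. v x \<partial>lebesgue))"
        using smaller[OF _ al, of m] Suc.prems(1) unfolding r_def by (intro mult_left_mono) auto
      also have "\<dots> = ennreal ?D * (\<integral>\<^sup>+x\<in>?child S. v x \<partial>lebesgue)"
        using X by (simp add: ennreal_mult mult.assoc)
      finally have 1: "(\<integral>\<^sup>+x\<in>?child S. ?w x \<partial>lebesgue) \<le> ennreal ?D * (\<integral>\<^sup>+x\<in>?child S. v x \<partial>lebesgue)" .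
      have 2: "ennreal (2 * \<kappa>) * emeasure lebesgue (?child S) \<le> (\<integral>\<^sup>+x\<in>?child S. ennreal \<bar>f x - c\<bar> \<partial>lebesgue)"
        using False r \<kappa> by (simp add: ennreal_mult)
      show ?thesis unfolding good_def
        by (intro exI[of _ "?child S"] conjI order_refl 2 order_trans[OF 1]) auto
    qed
  qed
  then obtain E where "\<forall>S\<in>Pow Basis. good S (E S)"
    using bchoice[of "Pow Basis" good] by blast
  then have E: "\<And>S. S \<in> Pow Basis \<Longrightarrow> E S \<in> sets lebesgue"
    "\<And>S. S \<in> Pow Basis \<Longrightarrow> E S \<subseteq> ?child S"
    "\<And>S. S \<in> Pow Basis \<Longrightarrow> ennreal (2 * \<kappa>) * emeasure lebesgue (E S)
        \<le> (\<integral>\<^sup>+x\<in>E S. ennreal \<bar>f x - c\<bar> \<partial>lebesgue)"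
    "\<And>S. S \<in> Pow Basis \<Longrightarrow> (\<integral>\<^sup>+x\<in>?child S. ?w x \<partial>lebesgue)
        \<le> ennreal (exp (2 * \<kappa>)) * (\<integral>\<^sup>+x\<in>?child S. v x \<partial>lebesgue)
          + ennreal ?D * (\<integral>\<^sup>+x\<in>E S. v x \<partial>lebesgue)"
    unfolding good_def by blast+
  have fin: "finite (Pow Basis :: 'a set set)" by simp
  have disj: "disjoint_family_on E (Pow Basis)"
    using hcube_split(2)[OF r, of a] E(2) unfolding disjoint_family_on_def by blast
  let ?E = "\<Union>S\<in>Pow Basis. E S"
  have UN: "(\<integral>\<^sup>+x\<in>?E. g x \<partial>lebesgue) = (\<Sum>S\<in>Pow Basis. \<integral>\<^sup>+x\<in>E S. g x \<partial>lebesgue)"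
    if "g \<in> borel_measurable lebesgue" for g :: "'a \<Rightarrow> ennreal"
    by (intro nn_integral_finite_disjoint_UN disj fin E that)
  show ?case unfolding r2
  proof (intro bexI[of _ ?E] conjI)
    show "?E \<in> sets lebesgue" using E(1) by (intro sets.finite_UN) auto
    show "?E \<subseteq> hcube a (2 * r)" unfolding hcube_split(1)[OF r] using E(2) by (intro UN_mono) auto
    have "ennreal (2 * \<kappa>) * emeasure lebesgue ?E = (\<Sum>S\<in>Pow Basis. ennreal (2 * \<kappa>) * emeasure lebesgue (E S))"
      using E(1) disj fin by (subst sum_emeasure[symmetric]) (auto simp: sum_distrib_left)
    also have "\<dots> \<le> (\<Sum>S\<in>Pow Basis. \<integral>\<^sup>+x\<in>E S. ennreal \<bar>f x - c\<bar> \<partial>lebesgue)"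
      by (intro sum_mono E(3))
    finally show "ennreal (2 * \<kappa>) * emeasure lebesgue ?E \<le> (\<integral>\<^sup>+x\<in>?E. ennreal \<bar>f x - c\<bar> \<partial>lebesgue)"
      by (subst UN) auto
    have "(\<integral>\<^sup>+x\<in>hcube a (2 * r). ?w x \<partial>lebesgue) = (\<Sum>S\<in>Pow Basis. \<integral>\<^sup>+x\<in>?child S. ?w x \<partial>lebesgue)"
      using r by (intro nn_integral_hcube_split) auto
    also have "\<dots> \<le> (\<Sum>S\<in>Pow Basis. ennreal (exp (2 * \<kappa>)) * (\<integral>\<^sup>+x\<in>?child S. v x \<partial>lebesgue)
          + ennreal ?D * (\<integral>\<^sup>+x\<in>E S. v x \<partial>lebesgue))"
      by (intro sum_mono E(4))
    also have "\<dots> = ennreal (exp (2 * \<kappa>)) * (\<integral>\<^sup>+x\<in>hcube a (2 * r). v x \<partial>lebesgue)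
          + ennreal ?D * (\<integral>\<^sup>+x\<in>?E. v x \<partial>lebesgue)"
      by (subst nn_integral_hcube_split[OF _ r], measurable)
         (simp add: UN sum.distrib sum_distrib_left)
    finally show "(\<integral>\<^sup>+x\<in>hcube a (2 * r). ?w x \<partial>lebesgue)
      \<le> ennreal (exp (2 * \<kappa>)) * (\<integral>\<^sup>+x\<in>hcube a (2 * r). v x \<partial>lebesgue)
          + ennreal ?D * (\<integral>\<^sup>+x\<in>?E. v x \<partial>lebesgue)" .
  qed
qed

text \<open>
  Take \<open>c\<close> to be the average of \<open>f\<close> over the cube. The stopped set then fills at most half of
  the cube and hence carries at most the fraction \<open>\<theta>\<close> of the mass of \<open>v\<close>. The condition on \<open>X\<close> says
  exactly that the bound \<open>X\<close> for smaller cubes reproduces itself.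
\<close>

lemma grid_John_Nirenberg:
  fixes f :: "'a::euclidean_space \<Rightarrow> real" and v :: "'a \<Rightarrow> ennreal"
  assumes f: "locally_integrable f" and v: "v \<in> borel_measurable lebesgue"
    and h: "h > 0" and \<kappa>: "\<kappa> > 0" and \<theta>: "\<theta> \<ge> 0"
    and osc: "\<And>a r. r > 0 \<Longrightarrow>
      (\<integral>\<^sup>+x\<in>hcube a r. ennreal \<bar>f x - average (hcube a r) f\<bar> \<partial>lebesgue) \<le> ennreal (\<kappa> * r ^ DIM('a))"
    and half: "\<And>a r E. r > 0 \<Longrightarrow> E \<in> sets lebesgue \<Longrightarrow> E \<subseteq> hcube a r \<Longrightarrow>
      2 * emeasure lebesgue E \<le> ennreal (r ^ DIM('a)) \<Longrightarrow>
      (\<integral>\<^sup>+x\<in>E. v x \<partial>lebesgue) \<le> ennreal \<theta> * (\<integral>\<^sup>+x\<in>hcube a r. v x \<partial>lebesgue)"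
    and X: "X \<ge> 0" "exp (2 * \<kappa>) + exp (2 * 2 ^ DIM('a) * \<kappa>) * X * \<theta> \<le> X"
    and "grid_aligned q h a"
  shows "(\<integral>\<^sup>+x\<in>hcube a (h * 2 ^ m).
          ennreal (exp \<bar>grid_average q h f x - average (hcube a (h * 2 ^ m)) f\<bar>) * v x \<partial>lebesgue)
        \<le> ennreal X * (\<integral>\<^sup>+x\<in>hcube a (h * 2 ^ m). v x \<partial>lebesgue)"
  using \<open>grid_aligned q h a\<close>
proof (induction m arbitrary: a rule: less_induct)
  case (less m)
  define r where "r = h * 2 ^ m"
  have r: "r > 0" using h by (simp add: r_def)
  let ?c = "average (hcube a r) f"
  let ?V = "\<integral>\<^sup>+x\<in>hcube a r. v x \<partial>lebesgue"
  have "ennreal (\<kappa> * r ^ DIM('a)) \<le> ennreal (2 * \<kappa> * r ^ DIM('a))"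
    using \<kappa> r by (intro ennreal_leI) auto
  with osc[OF r, of a] have "(\<integral>\<^sup>+x\<in>hcube a r. ennreal \<bar>f x - ?c\<bar> \<partial>lebesgue) \<le> ennreal (2 * \<kappa> * r ^ DIM('a))"
    by (rule order_trans)
  with stopping_decomposition[OF f v h \<kappa> X(1) less.IH order_refl less.prems, of m ?c]
  obtain E where E: "E \<in> sets lebesgue" "E \<subseteq> hcube a r"
    "ennreal (2 * \<kappa>) * emeasure lebesgue E \<le> (\<integral>\<^sup>+x\<in>E. ennreal \<bar>f x - ?c\<bar> \<partial>lebesgue)"
    "(\<integral>\<^sup>+x\<in>hcube a r. ennreal (exp \<bar>grid_average q h f x - ?c\<bar>) * v x \<partial>lebesgue)
        \<le> ennreal (exp (2 * \<kappa>)) * ?V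
          + ennreal (exp (2 * 2 ^ DIM('a) * \<kappa>) * X) * (\<integral>\<^sup>+x\<in>E. v x \<partial>lebesgue)"
    unfolding r_def by blast
  have "ennreal \<kappa> * (2 * emeasure lebesgue E) = ennreal (2 * \<kappa>) * emeasure lebesgue E"
    using \<kappa> by (simp add: ennreal_mult mult_ac)
  also have "\<dots> \<le> (\<integral>\<^sup>+x\<in>hcube a r. ennreal \<bar>f x - ?c\<bar> \<partial>lebesgue)"
    by (rule order_trans[OF E(3) nn_set_integral_set_mono[OF E(2)]])
  also have "\<dots> \<le> ennreal \<kappa> * ennreal (r ^ DIM('a))"
    using osc[OF r, of a] \<kappa> r by (simp add: ennreal_mult)
  finally have "2 * emeasure lebesgue E \<le> ennreal (r ^ DIM('a))"
    using \<kappa> by (simp add: ennreal_mult_le_mult_iff)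
  from half[OF r E(1,2) this]
  have "ennreal (exp (2 * \<kappa>)) * ?V + ennreal (exp (2 * 2 ^ DIM('a) * \<kappa>) * X) * (\<integral>\<^sup>+x\<in>E. v x \<partial>lebesgue)
    \<le> ennreal (exp (2 * \<kappa>)) * ?V + ennreal (exp (2 * 2 ^ DIM('a) * \<kappa>) * X) * (ennreal \<theta> * ?V)"
    by (intro add_left_mono mult_left_mono) auto
  also have "\<dots> = ennreal (exp (2 * \<kappa>) + exp (2 * 2 ^ DIM('a) * \<kappa>) * X * \<theta>) * ?V"
    using X(1) \<theta> by (simp add: ennreal_mult ennreal_plus distrib_right mult.assoc)
  also have "\<dots> \<le> ennreal X * ?V"
    by (intro mult_right_mono ennreal_leI X) auto
  finally show ?case using E(4) unfolding r_def by (rule order_trans[rotated])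
qed

text \<open>
  The bound on grids is uniform in the mesh, so Fatou's lemma carries it to \<open>f\<close> along a sequence
  of meshes for which the grid averages converge almost everywhere.
\<close>

lemma weighted_John_Nirenberg:
  fixes f :: "'a::euclidean_space \<Rightarrow> real" and v :: "'a \<Rightarrow> ennreal"
  assumes f: "locally_integrable f" and v[measurable]: "v \<in> borel_measurable lebesgue"
    and \<kappa>: "\<kappa> > 0" and \<theta>: "\<theta> \<ge> 0"
    and osc: "\<And>Q. Q \<in> cubes \<Longrightarrow> mean_oscillation f Q \<le> \<kappa>"
    and half: "\<And>a r E. r > 0 \<Longrightarrow> E \<in> sets lebesgue \<Longrightarrow> E \<subseteq> hcube a r \<Longrightarrow>
      2 * emeasure lebesgue E \<le> ennreal (r ^ DIM('a)) \<Longrightarrow>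
      (\<integral>\<^sup>+x\<in>E. v x \<partial>lebesgue) \<le> ennreal \<theta> * (\<integral>\<^sup>+x\<in>hcube a r. v x \<partial>lebesgue)"
    and X: "X \<ge> 0" "exp (2 * \<kappa>) + exp (2 * 2 ^ DIM('a) * \<kappa>) * X * \<theta> \<le> X"
    and r: "r > 0"
  shows "(\<integral>\<^sup>+x\<in>hcube a r. ennreal (exp \<bar>f x - average (hcube a r) f\<bar>) * v x \<partial>lebesgue)
        \<le> ennreal X * (\<integral>\<^sup>+x\<in>hcube a r. v x \<partial>lebesgue)"
proof -
  let ?c = "average (hcube a r) f"
  obtain s :: "nat \<Rightarrow> nat" where s: "AE x in lebesgue. x \<in> hcube a r \<longrightarrow>
      (\<lambda>j. grid_average a (r / 2 ^ s j) f x) \<longlonglongrightarrow> f x"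
    using grid_average_AE_subsequence[OF f r] .
  let ?u = "\<lambda>j x. ennreal (exp \<bar>grid_average a (r / 2 ^ s j) f x - ?c\<bar>) * v x * indicator (hcube a r) x"
  have [measurable]: "\<And>m. grid_average a (r / 2 ^ m) f \<in> borel_measurable lebesgue"
    using r by (auto intro: grid_average_measurable)
  have "(\<integral>\<^sup>+x\<in>hcube a r. ennreal (exp \<bar>f x - ?c\<bar>) * v x \<partial>lebesgue)
    \<le> (\<integral>\<^sup>+x. liminf (\<lambda>j. ?u j x) \<partial>lebesgue)"
  proof (rule nn_integral_mono_AE, use s in eventually_elim)
    case (elim x)
    show ?case
    proof (cases "x \<in> hcube a r")
      case True
      have "ennreal (exp \<bar>f x - ?c\<bar>) * v x
        \<le> liminf (\<lambda>j. ennreal (exp \<bar>grid_average a (r / 2 ^ s j) f x - ?c\<bar>) * v x)"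
      proof (cases "v x = top")
        case True
        then show ?thesis by (simp add: ennreal_mult_top Liminf_const)
      next
        case False
        then obtain y where y: "v x = ennreal y" "y \<ge> 0" by (cases "v x") auto
        have "(\<lambda>j. ennreal (exp \<bar>grid_average a (r / 2 ^ s j) f x - ?c\<bar> * y)) \<longlonglongrightarrow> ennreal (exp \<bar>f x - ?c\<bar> * y)"
          using elim \<open>x \<in> hcube a r\<close> by (intro tendsto_ennrealI tendsto_intros) auto
        from lim_imp_Liminf[OF sequentially_bot this] show ?thesis
          using y by (simp add: ennreal_mult)
      qed
      then show ?thesis using True by simp
    qed simp
  qed
  also have "\<dots> \<le> liminf (\<lambda>j. \<integral>\<^sup>+x. ?u j x \<partial>lebesgue)"
    by (rule nn_integral_liminf) measurable
  also have "\<dots> \<le> liminf (\<lambda>j. ennreal X * (\<integral>\<^sup>+x\<in>hcube a r. v x \<partial>lebesgue))"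
  proof (intro Liminf_mono always_eventually allI)
    fix j
    have p: "r / 2 ^ s j > 0" and e: "r / 2 ^ s j * 2 ^ s j = r" using r by auto
    have o: "(\<integral>\<^sup>+x\<in>hcube b t. ennreal \<bar>f x - average (hcube b t) f\<bar> \<partial>lebesgue)
      \<le> ennreal (\<kappa> * t ^ DIM('a))" if "t > 0" for b t
      using f that osc by (rule oscillation_hcube)
    have "(\<integral>\<^sup>+x\<in>hcube a (r / 2 ^ s j * 2 ^ s j).
          ennreal (exp \<bar>grid_average a (r / 2 ^ s j) f x - average (hcube a (r / 2 ^ s j * 2 ^ s j)) f\<bar>) * v x \<partial>lebesgue)
        \<le> ennreal X * (\<integral>\<^sup>+x\<in>hcube a (r / 2 ^ s j * 2 ^ s j). v x \<partial>lebesgue)"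
      by (rule grid_John_Nirenberg[OF f v p \<kappa> \<theta> o half X grid_aligned_origin])
    then show "(\<integral>\<^sup>+x. ?u j x \<partial>lebesgue) \<le> ennreal X * (\<integral>\<^sup>+x\<in>hcube a r. v x \<partial>lebesgue)"
      unfolding e .
  qed
  finally show ?thesis by (simp add: Liminf_const)
qed

section \<open>Perturbation of Muckenhoupt weights\<close>

lemma average_nonneg: "(\<And>x. 0 \<le> f x) \<Longrightarrow> 0 \<le> average Q (f :: _ \<Rightarrow> real)"
  unfolding average_def set_lebesgue_integral_def by (simp add: integral_nonneg_AE)

lemma powr_conjugate:
  assumes "s > (1::real)"
  shows "(s / (s - 1) - 1) * (s - 1) = 1" "(1 - s / (s - 1)) * (1 - s) = 1"
    "s / (s - 1) > 1" "s / (s - 1) / (s / (s - 1) - 1) = s"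
  using assms by (simp_all add: field_simps)

lemma locally_integrable_of_hcube:
  fixes f :: "'a::euclidean_space \<Rightarrow> real"
  assumes "\<And>a r. r > 0 \<Longrightarrow> set_integrable lebesgue (hcube a r) f"
  shows "locally_integrable f"
  unfolding locally_integrable_def
proof (intro allI impI)
  fix C :: "'a set" assume C: "compact C"
  then obtain R where R: "R > 0" "\<And>x. x \<in> C \<Longrightarrow> norm x < R"
    using bounded_pos_less[of C] compact_imp_bounded by blast
  have "C \<subseteq> hcube (- R *\<^sub>R One) (2 * R)"
  proof
    fix x assume "x \<in> C"
    then have "\<bar>x \<bullet> i\<bar> < R" if "i \<in> Basis" for i
      using R(2) Basis_le_norm[OF that, of x] by force
    then show "x \<in> hcube (- R *\<^sub>R One) (2 * R)" unfolding hcube_def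
      by (force simp: abs_less_iff)
  qed
  then show "set_integrable lebesgue C f"
    using R(1) C by (intro set_integrable_subset[OF assms]) (auto simp: lmeasurable_compact fmeasurableD)
qed

lemma cubesE:
  assumes "Q \<in> cubes" obtains a r where "r > 0" "Q = cbox a (a + r *\<^sub>R One)"
  using assms unfolding cubes_def by blast

text \<open>
  For every \<open>t > 0\<close> one has \<open>1 \<le> t v + t\<^sup>1\<^sup>-\<^sup>s\<^sup>' v\<^sup>1\<^sup>-\<^sup>s\<^sup>'\<close> where \<open>v > 0\<close>, since one of the two
  summands is at least \<open>1\<close>. Integrate this over the complement of \<open>E\<close> in the cube, which fills at least
  half of it, and choose \<open>t\<close> so that the second integral is at most a quarter of the volume; then
  the first is at least another quarter, and the \<open>A\<^sub>s\<close> condition compares it with the mass of the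
  whole cube.
\<close>

lemma muckenhoupt_half:
  fixes v :: "'a::euclidean_space \<Rightarrow> real"
  assumes s: "s > 1" and K: "K \<ge> 1" and A: "muckenhoupt_le s K v"
    and r: "r > 0" and E: "E \<in> sets lebesgue" "E \<subseteq> hcube a r"
    and small: "2 * emeasure lebesgue E \<le> ennreal (r ^ DIM('a))"
  shows "(\<integral>\<^sup>+x\<in>E. ennreal (v x) \<partial>lebesgue)
    \<le> ennreal (1 - 4 powr (- s) / K) * (\<integral>\<^sup>+x\<in>hcube a r. ennreal (v x) \<partial>lebesgue)"
proof -
  define s' where "s' = s / (s - 1)"
  define \<sigma> where "\<sigma> x = v x powr (1 - s')" for x
  have s': "s' > 1" "(s' - 1) * (s - 1) = 1" using powr_conjugate[OF s] by (auto simp: s'_def)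
  let ?H = "hcube a r" let ?F = "?H - E" and ?n = "r ^ DIM('a)"
  have n: "?n > 0" using r by simp
  have v: "\<And>x. 0 \<le> v x" "AE x in lebesgue. 0 < v x" "locally_integrable v" "locally_integrable \<sigma>"
    and AK: "\<And>Q. Q \<in> cubes \<Longrightarrow> average Q v * average Q \<sigma> powr (s - 1) \<le> K"
    using A unfolding muckenhoupt_le_def Let_def s'_def \<sigma>_def by auto
  have [measurable]: "v \<in> borel_measurable lebesgue" "\<sigma> \<in> borel_measurable lebesgue" "E \<in> sets lebesgue"
    using v E by (auto intro: locally_integrable_measurable)
  have int: "set_integrable lebesgue B v" "set_integrable lebesgue B \<sigma>"
    if "B \<subseteq> ?H" "B \<in> sets lebesgue" for B
    using that by (auto intro!: set_integrable_subset[OF locally_integrable_on_hcube[OF v(3)]]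
        set_integrable_subset[OF locally_integrable_on_hcube[OF v(4)]])
  define V where "V B = set_lebesgue_integral lebesgue B v" for B
  define S where "S = average ?H \<sigma>"
  have \<sigma>0: "\<And>x. 0 \<le> \<sigma> x" by (simp add: \<sigma>_def)
  have S0: "S \<ge> 0" unfolding S_def by (intro average_nonneg \<sigma>0)
  have S: "set_lebesgue_integral lebesgue ?H \<sigma> = S * ?n"
    using r by (simp add: S_def average_def)
  have V0: "V B \<ge> 0" for B
    unfolding V_def set_lebesgue_integral_def using v by (intro integral_nonneg_AE) auto
  have mE: "emeasure lebesgue E < \<infinity>"
    using emeasure_mono[OF E(2), of lebesgue] emeasure_hcube[of r a] r by (simp add: le_less_trans)
  have "measure lebesgue E \<le> ?n / 2"
  proof -
    have "ennreal (2 * measure lebesgue E) \<le> ennreal ?n"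
      using small mE by (simp add: ennreal_mult emeasure_eq_ennreal_measure less_top del: measure_completion emeasure_completion)
    then show ?thesis using n by simp
  qed
  moreover have "measure lebesgue ?F = ?n - measure lebesgue E"
    using r E by (subst measure_Diff) (auto simp: less_top)
  ultimately have F: "?n / 2 \<le> measure lebesgue ?F" by simp
  have mF: "integrable lebesgue (indicator ?F :: 'a \<Rightarrow> real)"
  proof -
    have "?H \<in> lmeasurable" using r by (intro fmeasurableI) auto
    then have "?F \<in> lmeasurable" by (rule fmeasurable_Diff) (rule E)
    then show ?thesis by (simp add: lmeasurable_iff_integrable)
  qed
  \<comment> \<open>The pointwise inequality \<open>1 \<le> t v + t\<^sup>1\<^sup>-\<^sup>s\<^sup>' v\<^sup>1\<^sup>-\<^sup>s\<^sup>'\<close>, integrated over the complement of \<open>E\<close>.\<close>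
  have key: "?n / 2 \<le> t * V ?F + t powr (1 - s') * (S * ?n)" if t: "t > 0" for t
  proof -
    have iF: "set_integrable lebesgue ?F (\<lambda>x. t * v x)"
      "set_integrable lebesgue ?F (\<lambda>x. t powr (1 - s') * \<sigma> x)"
      by (auto intro!: set_integrable_mult_right int)
    have "measure lebesgue ?F = (LINT x:?F|lebesgue. 1)"
      by (simp add: set_lebesgue_integral_def)
    also have "\<dots> \<le> (LINT x:?F|lebesgue. t * v x + t powr (1 - s') * \<sigma> x)"
      unfolding set_lebesgue_integral_def
    proof (rule integral_mono_AE)
      show "integrable lebesgue (\<lambda>x. indicat_real ?F x *\<^sub>R (t * v x + t powr (1 - s') * \<sigma> x))"
        using set_integral_add(1)[OF iF] unfolding set_integrable_def .
      show "AE x in lebesgue. indicat_real ?F x *\<^sub>R 1 \<le> indicat_real ?F x *\<^sub>R (t * v x + t powr (1 - s') * \<sigma> x)"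
        using v(2)
      proof eventually_elim
        case (elim x)
        have "1 \<le> t * v x + (t * v x) powr (1 - s')"
        proof (cases "t * v x \<ge> 1")
          case True
          then show ?thesis by (simp add: add_increasing2)
        next
          case False
          then have "(t * v x) powr (s' - 1) \<le> 1"
            using t elim s' by (intro powr_le1) auto
          moreover have "(t * v x) powr (s' - 1) > 0" using t elim by simp
          ultimately have "1 \<le> 1 / (t * v x) powr (s' - 1)" by (simp add: le_divide_eq)
          also have "\<dots> = (t * v x) powr (1 - s')"
            using powr_minus_divide[of "t * v x" "s' - 1"] by simp
          finally have "1 \<le> (t * v x) powr (1 - s')" .
          then show ?thesis using t elim by (simp add: add_increasing)
        qed
        then show ?case using t elim by (auto simp: indicator_def powr_mult \<sigma>_def)
      qed
    qed (use mF in simp)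
    also have "\<dots> = t * V ?F + t powr (1 - s') * (LINT x:?F|lebesgue. \<sigma> x)"
      using set_integral_add(2)[OF iF] by (simp add: V_def)
    also have "\<dots> \<le> t * V ?F + t powr (1 - s') * (S * ?n)"
    proof -
      have "(LINT x:?F|lebesgue. \<sigma> x) \<le> (LINT x:?H|lebesgue. \<sigma> x)"
        using int(2)[of ?F] int(2)[of ?H] unfolding set_lebesgue_integral_def set_integrable_def
        by (intro integral_mono) (auto simp: \<sigma>0 indicator_def)
      then show ?thesis using S by (intro add_left_mono mult_left_mono) auto
    qed
    finally show ?thesis using F by linarith
  qed
  \<comment> \<open>If the dual weight had mean zero, the key inequality with a small \<open>t\<close> would be violated.\<close>
  have S_pos: "S > 0"
  proof (rule ccontr)
    assume "\<not> S > 0"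
    then have "S = 0" using S0 by simp
    define t where "t = ?n / (4 * (V ?F + 1))"
    have t: "t > 0" using n V0[of ?F] by (auto simp: t_def intro!: divide_pos_pos)
    have "t * V ?F \<le> t * (V ?F + 1)" using t by simp
    also have "\<dots> = ?n / 4" using V0[of ?F] by (simp add: t_def field_simps)
    finally show False using key[OF t] \<open>S = 0\<close> n by simp
  qed
  \<comment> \<open>This choice turns the second term of the key inequality into exactly a quarter of the volume.\<close>
  define t where "t = (4 * S) powr (s - 1)"
  have t: "t > 0" using S_pos by (simp add: t_def)
  have "t powr (1 - s') = (4 * S) powr (- 1)"
    using s' by (simp add: t_def powr_powr algebra_simps)
  then have "t powr (1 - s') * (S * ?n) = ?n / 4" using S_pos by (simp add: powr_minus_divide)
  then have VF: "?n / 4 \<le> t * V ?F" using key[OF t] by linarith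
  have "average ?H v * S powr (s - 1) \<le> K"
    using AK[of "cbox a (a + r *\<^sub>R One)"] r by (auto simp: S_def average_hcube cubes_def)
  then have VH: "V ?H * S powr (s - 1) \<le> K * ?n"
    using n r by (simp add: average_def V_def field_simps)
  have t4: "t = 4 powr s / 4 * S powr (s - 1)"
    using S_pos by (simp add: t_def powr_mult powr_diff)
  have "?n \<le> 4 * (t * V ?F)" using VF by linarith
  then have "K * ?n \<le> K * (4 * (t * V ?F))" using K by (intro mult_left_mono) auto
  with VH have "V ?H * S powr (s - 1) \<le> K * (4 * (t * V ?F))" by (rule order_trans)
  also have "\<dots> = K * 4 powr s * V ?F * S powr (s - 1)" by (simp add: t4)
  finally have "V ?H \<le> K * 4 powr s * V ?F" using S_pos by simp
  then have "4 powr (- s) / K * V ?H \<le> V ?F"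
    using K by (simp add: powr_minus field_simps)
  moreover have "V ?F = V ?H - V E"
    using set_integral_Un[of E ?F lebesgue v] int(1)[of E] int(1)[of ?F] E
    by (simp add: V_def Un_absorb1)
  ultimately have le: "V E \<le> (1 - 4 powr (- s) / K) * V ?H" by (simp add: algebra_simps)
  have "4 powr (- s) \<le> (4::real) powr 0" using s by (intro powr_mono) auto
  then have th: "0 \<le> 1 - 4 powr (- s) / K" using K by simp
  show ?thesis
    using le th V0 int[of E] int[of ?H] E v(1)
    by (simp add: set_nn_integral_eq_set_integral V_def[symmetric] ennreal_mult[symmetric] ennreal_leI)
qed

text \<open>
  The dual weight \<open>v\<^sup>1\<^sup>-\<^sup>s\<^sup>'\<close> of an \<open>A\<^sub>s\<close> weight is an \<open>A\<^sub>s\<^sub>'\<close> weight, since \<open>(1 - s') (1 - s) = 1\<close>; this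
  makes the comparison of masses above available for both factors of the \<open>A\<^sub>s\<close> product.
\<close>

lemma muckenhoupt_dual:
  fixes v :: "'a::euclidean_space \<Rightarrow> real"
  assumes s: "s > 1" and K: "K > 0" and A: "muckenhoupt_le s K v"
  defines "s' \<equiv> s / (s - 1)"
  shows "muckenhoupt_le s' (K powr (s' - 1)) (\<lambda>x. v x powr (1 - s'))"
proof -
  have s': "s' > 1" "(s' - 1) * (s - 1) = 1" "(1 - s') * (1 - s) = 1" "s' / (s' - 1) = s"
    using powr_conjugate[OF s] by (auto simp: s'_def)
  have v: "\<And>x. 0 \<le> v x" "AE x in lebesgue. 0 < v x" "locally_integrable v" "locally_integrable (\<lambda>x. v x powr (1 - s'))"
    and AK: "\<And>Q. Q \<in> cubes \<Longrightarrow> average Q v * average Q (\<lambda>x. v x powr (1 - s')) powr (s - 1) \<le> K"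
    using A unfolding muckenhoupt_le_def Let_def s'_def by auto
  have recover: "(v x powr (1 - s')) powr (1 - s) = v x" for x
    using v(1)[of x] s' by (simp add: powr_powr)
  have "average Q (\<lambda>x. v x powr (1 - s')) * average Q v powr (s' - 1) \<le> K powr (s' - 1)"
    if "Q \<in> cubes" for Q
  proof -
    let ?a = "average Q v" and ?b = "average Q (\<lambda>x. v x powr (1 - s'))"
    have ab: "?a \<ge> 0" "?b \<ge> 0" using v by (auto intro: average_nonneg)
    have "(?a * ?b powr (s - 1)) powr (s' - 1) \<le> K powr (s' - 1)"
      using AK[OF that] ab s' by (intro powr_mono2) auto
    also have "(?a * ?b powr (s - 1)) powr (s' - 1) = ?a powr (s' - 1) * ?b"
      using ab s' by (simp add: powr_mult powr_powr mult.commute)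
    finally show ?thesis by (simp add: mult.commute)
  qed
  moreover have "AE x in lebesgue. 0 < v x powr (1 - s')"
    using v(2) by eventually_elim simp
  ultimately show ?thesis using v unfolding muckenhoupt_le_def Let_def s'(4) recover by auto
qed

lemma muckenhoupt_le_mono: "muckenhoupt_le s K v \<Longrightarrow> K \<le> K' \<Longrightarrow> muckenhoupt_le s K' v"
  unfolding muckenhoupt_le_def Let_def by force

text \<open>
  The bound \<open>\<kappa>0\<close> makes the exponential factor at most \<open>2 / (1 + \<theta>)\<close>, and
  \<open>2 \<theta> / (1 + \<theta>) \<le> (1 + \<theta>) / 2 < 1\<close>; \<open>X\<close> then only has to absorb \<open>exp (2 * \<kappa>) \<le> exp 2\<close>.
\<close>

lemma stopping_constants:
  assumes "0 \<le> \<theta>" "\<theta> < (1::real)"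
  obtains \<kappa>0 X where "\<kappa>0 > 0" "X > 0"
    "\<And>\<kappa>. 0 < \<kappa> \<Longrightarrow> \<kappa> \<le> \<kappa>0 \<Longrightarrow> exp (2 * \<kappa>) + exp (2 * 2 ^ n * \<kappa>) * X * \<theta> \<le> X"
proof -
  define N where "N = 2 * (2::real) ^ n"
  define \<kappa>0 where "\<kappa>0 = min 1 (ln (2 / (1 + \<theta>)) / N)"
  define X where "X = 2 * exp 2 / (1 - \<theta>)"
  have N: "N > 0" by (simp add: N_def)
  have "1 < 2 / (1 + \<theta>)" using assms by simp
  then have k: "\<kappa>0 > 0" using N by (simp add: \<kappa>0_def ln_gt_zero)
  have X: "X > 0" using assms by (simp add: X_def)
  have "exp (2 * \<kappa>) + exp (N * \<kappa>) * X * \<theta> \<le> X" if "0 < \<kappa>" "\<kappa> \<le> \<kappa>0" for \<kappa>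
  proof -
    have "N * \<kappa> \<le> N * (ln (2 / (1 + \<theta>)) / N)"
      using that N unfolding \<kappa>0_def by (intro mult_left_mono) auto
    then have "exp (N * \<kappa>) \<le> exp (ln (2 / (1 + \<theta>)))" using N by (subst exp_le_cancel_iff) simp
    then have "exp (N * \<kappa>) \<le> 2 / (1 + \<theta>)" using assms by simp
    then have "exp (N * \<kappa>) * X * \<theta> \<le> 2 / (1 + \<theta>) * X * \<theta>"
      using X assms by (intro mult_right_mono) auto
    also have "\<dots> = 2 / (1 + \<theta>) * \<theta> * X" by simp
    also have "\<dots> \<le> (1 + \<theta>) / 2 * X"
    proof (rule mult_right_mono)
      have "4 * \<theta> \<le> (1 + \<theta>)^2"
        using zero_le_power2[of "1 - \<theta>"] by (simp add: power2_eq_square algebra_simps)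
      then show "2 / (1 + \<theta>) * \<theta> \<le> (1 + \<theta>) / 2"
        using assms by (simp add: field_simps power2_eq_square)
    qed (use X in simp)
    finally have "exp (N * \<kappa>) * X * \<theta> \<le> (1 + \<theta>) / 2 * X" .
    moreover have "exp (2 * \<kappa>) \<le> exp 2" using that by (simp add: \<kappa>0_def)
    moreover have "exp 2 = (1 - \<theta>) / 2 * X" using assms by (simp add: X_def)
    moreover have "(1 - \<theta>) / 2 * X + (1 + \<theta>) / 2 * X = X" by (simp add: field_simps)
    ultimately show ?thesis by linarith
  qed
  then show ?thesis by (intro that[OF k X]) (simp add: N_def)
qed

text \<open>
  This comes from \<open>exp \<phi> \<le> exp c * exp \<bar>\<phi> - c\<bar>\<close>, with \<open>c\<close> the average of \<open>\<phi>\<close>. The factor \<open>exp c\<close> is kept explicit because it cancels in the \<open>A\<^sub>s\<close> product.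
\<close>

lemma exp_perturbation_of_weight:
  fixes v \<phi> :: "'a::euclidean_space \<Rightarrow> real"
  assumes v: "locally_integrable v" "\<And>x. 0 \<le> v x" and \<phi>: "locally_integrable \<phi>" and X: "X > 0"
    and JN: "\<And>a r. r > 0 \<Longrightarrow>
      (\<integral>\<^sup>+x\<in>hcube a r. ennreal (exp \<bar>\<phi> x - average (hcube a r) \<phi>\<bar>) * ennreal (v x) \<partial>lebesgue)
        \<le> ennreal X * (\<integral>\<^sup>+x\<in>hcube a r. ennreal (v x) \<partial>lebesgue)"
  shows "locally_integrable (\<lambda>x. v x * exp (\<phi> x))"
    and "\<And>Q. Q \<in> cubes \<Longrightarrow> average Q (\<lambda>x. v x * exp (\<phi> x)) \<le> X * exp (average Q \<phi>) * average Q v"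
proof -
  have [measurable]: "v \<in> borel_measurable lebesgue" "\<phi> \<in> borel_measurable lebesgue"
    using v \<phi> by (auto intro: locally_integrable_measurable)
  have bound: "(\<integral>\<^sup>+x\<in>hcube a r. ennreal (v x * exp (\<phi> x)) \<partial>lebesgue)
    \<le> ennreal (X * exp (average (hcube a r) \<phi>) * (LINT x:hcube a r|lebesgue. v x))" if r: "r > 0" for a r
  proof -
    let ?H = "hcube a r" let ?c = "average ?H \<phi>"
    have iv: "0 \<le> (LINT x:?H|lebesgue. v x)"
      unfolding set_lebesgue_integral_def using v(2) by (intro integral_nonneg_AE) auto
    have "(\<integral>\<^sup>+x\<in>?H. ennreal (v x * exp (\<phi> x)) \<partial>lebesgue)
      \<le> (\<integral>\<^sup>+x. ennreal (exp ?c) * (ennreal (exp \<bar>\<phi> x - ?c\<bar>) * ennreal (v x) * indicator ?H x) \<partial>lebesgue)"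
    proof (rule nn_integral_mono)
      fix x
      have "exp (\<phi> x) \<le> exp ?c * exp \<bar>\<phi> x - ?c\<bar>" by (simp add: exp_add[symmetric])
      then have "v x * exp (\<phi> x) \<le> exp ?c * (exp \<bar>\<phi> x - ?c\<bar> * v x)"
        using mult_right_mono[OF _ v(2)[of x], of "exp (\<phi> x)" "exp ?c * exp \<bar>\<phi> x - ?c\<bar>"] by (simp add: mult_ac)
      then show "ennreal (v x * exp (\<phi> x)) * indicator ?H x
        \<le> ennreal (exp ?c) * (ennreal (exp \<bar>\<phi> x - ?c\<bar>) * ennreal (v x) * indicator ?H x)"
        using v(2) by (auto simp: indicator_def ennreal_mult[symmetric] intro: ennreal_leI)
    qed
    also have "\<dots> = ennreal (exp ?c) * (\<integral>\<^sup>+x\<in>?H. ennreal (exp \<bar>\<phi> x - ?c\<bar>) * ennreal (v x) \<partial>lebesgue)"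
      by (intro nn_integral_cmult) auto
    also have "\<dots> \<le> ennreal (exp ?c) * (ennreal X * (\<integral>\<^sup>+x\<in>?H. ennreal (v x) \<partial>lebesgue))"
      by (intro mult_left_mono JN r) auto
    also have "(\<integral>\<^sup>+x\<in>?H. ennreal (v x) \<partial>lebesgue) = ennreal (LINT x:?H|lebesgue. v x)"
      by (intro set_nn_integral_eq_set_integral locally_integrable_on_hcube v)
    also have "ennreal (exp ?c) * (ennreal X * ennreal (LINT x:?H|lebesgue. v x))
      = ennreal (X * exp ?c * (LINT x:?H|lebesgue. v x))"
      using X iv by (simp add: ennreal_mult[symmetric] mult_ac)
    finally show ?thesis .
  qed
  have int: "set_integrable lebesgue (hcube a r) (\<lambda>x. v x * exp (\<phi> x))" if "r > 0" for a r
    unfolding set_integrable_def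
  proof (rule integrableI_bounded)
    have "(\<integral>\<^sup>+x. ennreal (norm (indicat_real (hcube a r) x *\<^sub>R (v x * exp (\<phi> x)))) \<partial>lebesgue)
      = (\<integral>\<^sup>+x\<in>hcube a r. ennreal (v x * exp (\<phi> x)) \<partial>lebesgue)"
      using v(2) by (intro nn_integral_cong) (auto simp: indicator_def abs_mult)
    also have "\<dots> < \<infinity>" using bound[OF that, of a] by (simp add: le_less_trans)
    finally show "(\<integral>\<^sup>+x. ennreal (norm (indicat_real (hcube a r) x *\<^sub>R (v x * exp (\<phi> x)))) \<partial>lebesgue) < \<infinity>" .
  qed measurable
  show "locally_integrable (\<lambda>x. v x * exp (\<phi> x))"
    by (rule locally_integrable_of_hcube[OF int])
  fix Q :: "'a set" assume "Q \<in> cubes"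
  then obtain a r where r: "r > 0" "Q = cbox a (a + r *\<^sub>R One)" by (rule cubesE)
  let ?H = "hcube a r"
  have n: "r ^ DIM('a) > 0" using r by simp
  have iv: "0 \<le> (LINT x:?H|lebesgue. v x)"
      unfolding set_lebesgue_integral_def using v(2) by (intro integral_nonneg_AE) auto
  have "ennreal (LINT x:?H|lebesgue. v x * exp (\<phi> x)) \<le> ennreal (X * exp (average ?H \<phi>) * (LINT x:?H|lebesgue. v x))"
    using bound[OF r(1), of a] by (subst (asm) set_nn_integral_eq_set_integral[OF int[OF r(1)]]) (auto simp: v)
  then have "(LINT x:?H|lebesgue. v x * exp (\<phi> x)) \<le> X * exp (average ?H \<phi>) * (LINT x:?H|lebesgue. v x)"
    using X iv by (subst (asm) ennreal_le_iff) auto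
  then have "average ?H (\<lambda>x. v x * exp (\<phi> x)) \<le> X * exp (average ?H \<phi>) * average ?H v"
    using n r by (simp add: average_def divide_right_mono)
  then show "average Q (\<lambda>x. v x * exp (\<phi> x)) \<le> X * exp (average Q \<phi>) * average Q v"
    unfolding r(2) using r(1) by (simp add: average_hcube)
qed

lemma average_cmult: "average Q (\<lambda>x. c * f x :: real) = c * average Q f"
  unfolding average_def by simp

lemma mean_oscillation_cmult: "mean_oscillation (\<lambda>x. c * f x :: real) Q = \<bar>c\<bar> * mean_oscillation f Q"
  unfolding mean_oscillation_def average_cmult
  by (simp add: average_cmult[symmetric] abs_mult[symmetric] right_diff_distrib)

lemma locally_integrable_cmult:
  "locally_integrable f \<Longrightarrow> locally_integrable (\<lambda>x. c * f x :: real)"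
  unfolding locally_integrable_def by (auto intro: set_integrable_mult_right)

text \<open>
  The John--Nirenberg inequality is applied to \<open>\<phi>\<close> with the weight \<open>v\<close> and to \<open>(1 - s') \<phi>\<close> with
  the dual weight. In the \<open>A\<^sub>s\<close> product of \<open>v exp \<phi>\<close> the averages of \<open>\<phi>\<close> appear as
  \<open>exp (c + (1 - s') (s - 1) c) = 1\<close>, so only the constants and the \<open>A\<^sub>s\<close> product of \<open>v\<close> remain.
\<close>

theorem muckenhoupt_perturbation:
  assumes s: "s > 1" and K: "K \<ge> 1"
  obtains \<kappa> K' where "\<kappa> > 0" "K' > 0"
    "\<And>v \<phi> :: 'a::euclidean_space \<Rightarrow> real. muckenhoupt_le s K v \<Longrightarrow> locally_integrable \<phi> \<Longrightarrow>
      (\<And>Q. Q \<in> cubes \<Longrightarrow> mean_oscillation \<phi> Q \<le> \<kappa>) \<Longrightarrow> muckenhoupt_le s K' (\<lambda>x. v x * exp (\<phi> x))"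
proof -
  define s' where "s' = s / (s - 1)"
  have s': "s' > 1" "(s' - 1) * (s - 1) = 1" using powr_conjugate[OF s] by (auto simp: s'_def)
  define L where "L = K powr (s' - 1)"
  have L: "L \<ge> 1" using K s' by (auto simp: L_def ge_one_powr_ge_zero)
  define \<theta> where "\<theta> t J = 1 - 4 powr (- t) / J" for t J :: real
  have \<theta>: "0 \<le> \<theta> t J" "\<theta> t J < 1" if "t > 1" "J \<ge> 1" for t J
  proof -
    have "4 powr (- t) \<le> (4::real) powr 0" using that by (intro powr_mono) auto
    then show "0 \<le> \<theta> t J" "\<theta> t J < 1" using that by (auto simp: \<theta>_def)
  qed
  obtain \<kappa>1 X where 1: "\<kappa>1 > 0" "X > 0"
    "\<And>\<kappa>. 0 < \<kappa> \<Longrightarrow> \<kappa> \<le> \<kappa>1 \<Longrightarrow> exp (2 * \<kappa>) + exp (2 * 2 ^ DIM('a) * \<kappa>) * X * \<theta> s K \<le> X"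
    using stopping_constants[OF \<theta>[OF s K], of "DIM('a)"] by metis
  obtain \<kappa>2 Y where 2: "\<kappa>2 > 0" "Y > 0"
    "\<And>\<kappa>. 0 < \<kappa> \<Longrightarrow> \<kappa> \<le> \<kappa>2 \<Longrightarrow> exp (2 * \<kappa>) + exp (2 * 2 ^ DIM('a) * \<kappa>) * Y * \<theta> s' L \<le> Y"
    using stopping_constants[OF \<theta>[OF s'(1) L], of "DIM('a)"] by metis
  define \<kappa> where "\<kappa> = min \<kappa>1 (\<kappa>2 / (s' - 1))"
  define K' where "K' = X * Y powr (s - 1) * K"
  have \<kappa>: "\<kappa> > 0" using 1 2 s' by (simp add: \<kappa>_def)
  have K': "K' > 0" using 1 2 K by (simp add: K'_def)
  have "muckenhoupt_le s K' (\<lambda>x. v x * exp (\<phi> x))"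
    if A: "muckenhoupt_le s K v" and \<phi>: "locally_integrable \<phi>"
      and osc: "\<And>Q. Q \<in> cubes \<Longrightarrow> mean_oscillation \<phi> Q \<le> \<kappa>" for v \<phi> :: "'a \<Rightarrow> real"
  proof -
    define \<sigma> where "\<sigma> x = v x powr (1 - s')" for x
    define \<psi> where "\<psi> x = (1 - s') * \<phi> x" for x
    have v: "\<And>x. 0 \<le> v x" "AE x in lebesgue. 0 < v x" "locally_integrable v" "locally_integrable \<sigma>"
      and AK: "\<And>Q. Q \<in> cubes \<Longrightarrow> average Q v * average Q \<sigma> powr (s - 1) \<le> K"
      using A unfolding muckenhoupt_le_def Let_def s'_def \<sigma>_def by auto
    have \<sigma>0: "0 \<le> \<sigma> x" for x by (simp add: \<sigma>_def)
    have [measurable]: "v \<in> borel_measurable lebesgue" "\<sigma> \<in> borel_measurable lebesgue"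
      using v by (auto intro: locally_integrable_measurable)
    have B: "muckenhoupt_le s' L \<sigma>"
      using muckenhoupt_dual[OF s _ A] K unfolding L_def s'_def \<sigma>_def by simp
    have \<psi>: "locally_integrable \<psi>" unfolding \<psi>_def by (rule locally_integrable_cmult[OF \<phi>])
    have osc\<psi>: "mean_oscillation \<psi> Q \<le> \<kappa>2" if "Q \<in> cubes" for Q
    proof -
      have "mean_oscillation \<psi> Q = (s' - 1) * mean_oscillation \<phi> Q"
        using s' unfolding \<psi>_def mean_oscillation_cmult by simp
      also have "\<dots> \<le> (s' - 1) * (\<kappa>2 / (s' - 1))"
        using osc[OF that] s' unfolding \<kappa>_def by (intro mult_left_mono) auto
      finally show ?thesis using s' by simp
    qed
    have osc1: "mean_oscillation \<phi> Q \<le> \<kappa>1" if "Q \<in> cubes" for Q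
      using osc[OF that] by (simp add: \<kappa>_def)
    have JNv: "(\<integral>\<^sup>+x\<in>hcube a r. ennreal (exp \<bar>\<phi> x - average (hcube a r) \<phi>\<bar>) * ennreal (v x) \<partial>lebesgue)
        \<le> ennreal X * (\<integral>\<^sup>+x\<in>hcube a r. ennreal (v x) \<partial>lebesgue)" if "r > 0" for a r
      by (rule weighted_John_Nirenberg[OF \<phi> _ 1(1) \<theta>(1)[OF s K] osc1 muckenhoupt_half[OF s K A, folded \<theta>_def]
            less_imp_le[OF 1(2)] 1(3) that]) (use 1 in auto)
    have P: "locally_integrable (\<lambda>x. v x * exp (\<phi> x))"
      "\<And>Q. Q \<in> cubes \<Longrightarrow> average Q (\<lambda>x. v x * exp (\<phi> x)) \<le> X * exp (average Q \<phi>) * average Q v"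
      by (rule exp_perturbation_of_weight[OF v(3,1) \<phi> 1(2) JNv]; assumption)+
    have JN\<sigma>: "(\<integral>\<^sup>+x\<in>hcube a r. ennreal (exp \<bar>\<psi> x - average (hcube a r) \<psi>\<bar>) * ennreal (\<sigma> x) \<partial>lebesgue)
        \<le> ennreal Y * (\<integral>\<^sup>+x\<in>hcube a r. ennreal (\<sigma> x) \<partial>lebesgue)" if "r > 0" for a r
      by (rule weighted_John_Nirenberg[OF \<psi> _ 2(1) \<theta>(1)[OF s'(1) L] osc\<psi> muckenhoupt_half[OF s'(1) L B, folded \<theta>_def]
            less_imp_le[OF 2(2)] 2(3) that]) (use 2 in auto)
    have R: "locally_integrable (\<lambda>x. \<sigma> x * exp (\<psi> x))"
      "\<And>Q. Q \<in> cubes \<Longrightarrow> average Q (\<lambda>x. \<sigma> x * exp (\<psi> x)) \<le> Y * exp (average Q \<psi>) * average Q \<sigma>"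
      by (rule exp_perturbation_of_weight[OF v(4) \<sigma>0 \<psi> 2(2) JN\<sigma>]; assumption)+
    have pw: "(v x * exp (\<phi> x)) powr (1 - s') = \<sigma> x * exp (\<psi> x)" for x
      using v(1)[of x] by (simp add: powr_mult \<sigma>_def \<psi>_def exp_powr_real mult.commute)
    have "average Q (\<lambda>x. v x * exp (\<phi> x)) * average Q (\<lambda>x. \<sigma> x * exp (\<psi> x)) powr (s - 1) \<le> K'"
      if Q: "Q \<in> cubes" for Q
    proof -
      have nn: "0 \<le> average Q v" "0 \<le> average Q \<sigma>" "0 \<le> average Q (\<lambda>x. \<sigma> x * exp (\<psi> x))"
        using v \<sigma>0 by (auto intro!: average_nonneg)
      have "average Q (\<lambda>x. v x * exp (\<phi> x)) * average Q (\<lambda>x. \<sigma> x * exp (\<psi> x)) powr (s - 1)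
        \<le> (X * exp (average Q \<phi>) * average Q v) * (Y * exp (average Q \<psi>) * average Q \<sigma>) powr (s - 1)"
        using P(2)[OF Q] R(2)[OF Q] s 1 2 nn by (intro mult_mono powr_mono2) auto
      also have "\<dots> = X * Y powr (s - 1) * (exp (average Q \<phi>) * exp (average Q \<psi>) powr (s - 1))
          * (average Q v * average Q \<sigma> powr (s - 1))"
        using 2 nn by (simp add: powr_mult)
      also have "exp (average Q \<phi>) * exp (average Q \<psi>) powr (s - 1)
        = exp (average Q \<phi> * (1 - (s' - 1) * (s - 1)))"
        unfolding \<psi>_def average_cmult by (simp add: exp_powr_real exp_add[symmetric] algebra_simps)
      also have "\<dots> = 1" using s' by simp
      also have "X * Y powr (s - 1) * 1 * (average Q v * average Q \<sigma> powr (s - 1)) \<le> K'"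
        unfolding K'_def using AK[OF Q] 1 2 by simp
      finally show ?thesis .
    qed
    moreover have "AE x in lebesgue. 0 < v x * exp (\<phi> x)"
      using v(2) by eventually_elim simp
    ultimately show ?thesis using P(1) R(1) v(1)
      unfolding muckenhoupt_le_def Let_def s'_def[symmetric] pw by auto
  qed
  with \<kappa> K' show ?thesis by (rule that)
qed

section \<open>Powers of extended reals and the variation seminorm\<close>

lemma epowr_ennreal: "x \<ge> 0 \<Longrightarrow> epowr (ennreal x) a = ennreal (x powr a)"
  by (simp add: epowr_def)

lemma epowr_top [simp]: "epowr top a = top"
  by (simp add: epowr_def)

lemma epowr_zero [simp]: "epowr 0 a = 0"
  by (simp add: epowr_def)

lemma epowr_mono: "x \<le> y \<Longrightarrow> a \<ge> 0 \<Longrightarrow> epowr x a \<le> epowr y a"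
  by (cases x; cases y) (auto simp: epowr_ennreal powr_mono2 top_unique intro!: ennreal_leI)

lemma epowr_inverse:
  assumes "a > 0"
  shows "epowr (epowr x a) (1 / a) = x" "epowr (epowr x (1 / a)) a = x"
  using assms by (cases x; simp add: epowr_ennreal powr_powr)+

lemma epowr_less_iff:
  assumes "a > 0"
  shows "y < epowr x a \<longleftrightarrow> epowr y (1 / a) < x"
  using assms epowr_mono[of "epowr x a" y "1 / a"] epowr_mono[of x "epowr y (1 / a)" a]
  by (auto simp: epowr_inverse not_le[symmetric])

lemma epowr_mult: "a > 0 \<Longrightarrow> epowr (x * y) a = epowr x a * epowr y a"
  by (cases x; cases y)
     (auto simp: epowr_ennreal powr_mult ennreal_mult[symmetric] ennreal_mult_top ennreal_top_mult)

lemma borel_measurable_epowr [measurable (raw)]: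
  assumes "f \<in> borel_measurable M"
  shows "(\<lambda>x. epowr (f x) a) \<in> borel_measurable M"
  using assms unfolding epowr_def by measurable

text \<open>
  Convexity on the open half-line extends to \<open>0\<close> because \<open>c\<^sup>p \<le> c\<close> for \<open>0 < c < 1\<close>.
\<close>

lemma powr_convex_nonneg:
  assumes "p \<ge> (1::real)"
  shows "convex_on {0..} (\<lambda>x. x powr p)"
proof (rule convex_onI)
  fix t x y :: real
  assume t: "0 < t" "t < 1" and xy: "x \<in> {0..}" "y \<in> {0..}"
  have small: "(c * u) powr p \<le> c * u powr p" if "0 < c" "c < 1" "u \<ge> 0" for c u :: real
  proof -
    have "c powr p \<le> c powr 1" using that assms by (intro powr_mono') auto
    then show ?thesis using that by (simp add: powr_mult mult_right_mono)
  qed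
  show "((1 - t) *\<^sub>R x + t *\<^sub>R y) powr p \<le> (1 - t) * x powr p + t * y powr p"
  proof (cases "x = 0 \<or> y = 0")
    case True
    then show ?thesis using t xy small[of t y] small[of "1 - t" x] by auto
  next
    case False
    then have "x \<in> {0<..}" "y \<in> {0<..}" using xy by auto
    then show ?thesis using convex_onD[OF powr_convex[OF assms], of t x y] t by simp
  qed
qed simp

text \<open>
  Jensen's inequality for a uniform average.
\<close>

lemma epowr_average_le:
  fixes u :: "nat \<Rightarrow> ennreal"
  assumes p: "p \<ge> 1" and N: "N > 0"
  shows "epowr (ennreal (1 / real N) * (\<Sum>j<N. u j)) p \<le> ennreal (1 / real N) * (\<Sum>j<N. epowr (u j) p)"
proof (cases "\<exists>j<N. u j = top")
  case True
  then obtain j where "j < N" "u j = top" by blast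
  then have "(\<Sum>j<N. epowr (u j) p) = top" 
    using member_le_sum[of j "{..<N}" "\<lambda>j. epowr (u j) p"] by (simp add: top_unique)
  then have "ennreal (1 / real N) * (\<Sum>j<N. epowr (u j) p) = top"
    using N by (simp only: ennreal_mult_top) simp
  then show ?thesis by (simp only: top_greatest)
next
  case False
  define v where "v j = enn2real (u j)" for j
  have u: "u j = ennreal (v j)" if "j < N" for j
    using False that by (auto simp: v_def less_top)
  have v0: "v j \<ge> 0" for j by (simp add: v_def)
  have "(\<Sum>j<N. (1 / real N) *\<^sub>R v j) powr p \<le> (\<Sum>j<N. (1 / real N) * v j powr p)"
    using N v0 by (intro convex_on_sum[OF _ _ powr_convex_nonneg[OF p]]) auto
  then have "(1 / real N * (\<Sum>j<N. v j)) powr p \<le> 1 / real N * (\<Sum>j<N. v j powr p)"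
    by (simp add: sum_distrib_left)
  then have "ennreal ((1 / real N * (\<Sum>j<N. v j)) powr p) \<le> ennreal (1 / real N * (\<Sum>j<N. v j powr p))"
    by (rule ennreal_leI)
  moreover have "ennreal (1 / real N) * (\<Sum>j<N. u j) = ennreal (1 / real N * (\<Sum>j<N. v j))"
    using v0 by (simp add: u ennreal_mult[symmetric] sum_nonneg)
  moreover have "ennreal (1 / real N) * (\<Sum>j<N. epowr (u j) p) = ennreal (1 / real N * (\<Sum>j<N. v j powr p))"
    using v0 by (simp add: u epowr_ennreal ennreal_mult[symmetric] sum_nonneg)
  ultimately show ?thesis using v0 by (simp add: epowr_ennreal sum_nonneg)
qed

definition jump_sum :: "real \<Rightarrow> (nat \<Rightarrow> real) \<Rightarrow> (real \<Rightarrow> complex) \<Rightarrow> ennreal" where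
  "jump_sum \<rho> t a = (\<Sum>k. ennreal (norm (a (t (Suc k)) - a (t k)) powr \<rho>))"

lemma variation_norm_jump_sum:
  "variation_norm \<rho> I a = (SUP t\<in>{t. incseq t \<and> range t \<subseteq> I}. epowr (jump_sum \<rho> t a) (1 / \<rho>))"
  unfolding variation_norm_def jump_sum_def ..

lemma variation_norm_cong:
  assumes "\<And>t. t \<in> I \<Longrightarrow> a t = b t"
  shows "variation_norm \<rho> I a = variation_norm \<rho> I b"
  unfolding variation_norm_def using assms
  by (intro SUP_cong refl arg_cong2[where f=epowr] arg_cong[where f=suminf] ext) (auto simp: image_subset_iff)

lemma variation_norm_scale:
  assumes "\<rho> > 0"
  shows "variation_norm \<rho> I (\<lambda>t. c * a t) \<le> ennreal (norm c) * variation_norm \<rho> I a"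
  unfolding variation_norm_jump_sum
proof (rule SUP_least)
  fix t assume t: "t \<in> {t. incseq t \<and> range t \<subseteq> I}"
  have "jump_sum \<rho> t (\<lambda>t. c * a t) = ennreal (norm c powr \<rho>) * jump_sum \<rho> t a"
    unfolding jump_sum_def ennreal_suminf_cmult[symmetric]
    by (simp add: norm_mult powr_mult ennreal_mult flip: right_diff_distrib)
  then have "epowr (jump_sum \<rho> t (\<lambda>t. c * a t)) (1 / \<rho>) = ennreal (norm c) * epowr (jump_sum \<rho> t a) (1 / \<rho>)"
    using assms by (simp add: epowr_mult epowr_ennreal powr_powr)
  also have "\<dots> \<le> ennreal (norm c) * (SUP t\<in>{t. incseq t \<and> range t \<subseteq> I}. epowr (jump_sum \<rho> t a) (1 / \<rho>))"
    using t by (intro mult_left_mono SUP_upper) auto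
  finally show "epowr (jump_sum \<rho> t (\<lambda>t. c * a t)) (1 / \<rho>)
    \<le> ennreal (norm c) * (SUP t\<in>{t. incseq t \<and> range t \<subseteq> I}. epowr (jump_sum \<rho> t a) (1 / \<rho>))" .
qed

text \<open>
  Convexity at the points \<open>x / \<alpha>\<close> and \<open>y / \<beta>\<close> with weights proportional to \<open>\<alpha>\<close> and \<open>\<beta>\<close>. If \<open>\<alpha>\<close> and
  \<open>\<beta>\<close> are the norms of the two sequences, summation over the jumps yields Minkowski's inequality.
\<close>

lemma powr_add_le_weighted:
  assumes "\<rho> \<ge> 1" "\<alpha> > 0" "\<beta> > 0" "x \<ge> 0" "y \<ge> (0::real)"
  shows "(x + y) powr \<rho> \<le> (\<alpha> + \<beta>) powr (\<rho> - 1) * (\<alpha> powr (1 - \<rho>) * x powr \<rho> + \<beta> powr (1 - \<rho>) * y powr \<rho>)"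
proof -
  define l where "l = \<beta> / (\<alpha> + \<beta>)"
  have l: "0 \<le> l" "l \<le> 1" "1 - l = \<alpha> / (\<alpha> + \<beta>)" using assms by (auto simp: l_def field_simps)
  have "((1 - l) * (x / \<alpha>) + l * (y / \<beta>)) powr \<rho> \<le> (1 - l) * (x / \<alpha>) powr \<rho> + l * (y / \<beta>) powr \<rho>"
    using convex_onD[OF powr_convex_nonneg[OF assms(1)] l(1,2), of "x / \<alpha>" "y / \<beta>"] assms by simp
  moreover have "(1 - l) * (x / \<alpha>) + l * (y / \<beta>) = (x + y) / (\<alpha> + \<beta>)"
    unfolding l(3) using assms by (simp add: l_def add_divide_distrib)
  ultimately have "((x + y) / (\<alpha> + \<beta>)) powr \<rho> \<le> \<alpha> / (\<alpha> + \<beta>) * (x / \<alpha>) powr \<rho> + \<beta> / (\<alpha> + \<beta>) * (y / \<beta>) powr \<rho>"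
    unfolding l(3) by (simp add: l_def)
  then have "(\<alpha> + \<beta>) powr \<rho> * ((x + y) / (\<alpha> + \<beta>)) powr \<rho>
    \<le> (\<alpha> + \<beta>) powr \<rho> * (\<alpha> / (\<alpha> + \<beta>) * (x / \<alpha>) powr \<rho> + \<beta> / (\<alpha> + \<beta>) * (y / \<beta>) powr \<rho>)"
    by (intro mult_left_mono) auto
  moreover have "(\<alpha> + \<beta>) powr \<rho> * ((x + y) / (\<alpha> + \<beta>)) powr \<rho> = (x + y) powr \<rho>"
    using assms by (simp add: powr_divide)
  moreover have "(\<alpha> + \<beta>) powr \<rho> * (\<alpha> / (\<alpha> + \<beta>) * (x / \<alpha>) powr \<rho> + \<beta> / (\<alpha> + \<beta>) * (y / \<beta>) powr \<rho>)
    = (\<alpha> + \<beta>) powr (\<rho> - 1) * (\<alpha> powr (1 - \<rho>) * x powr \<rho> + \<beta> powr (1 - \<rho>) * y powr \<rho>)"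
    using assms by (simp add: powr_divide powr_diff distrib_left mult_ac)
  ultimately show ?thesis by simp
qed

text \<open>
  Minkowski's inequality in \<open>\<ell>\<^sup>\<rho>\<close> along each partition. The norms are increased by \<open>e / 2\<close> since
  the weighted convexity inequality divides by them.
\<close>

lemma variation_norm_triangle:
  assumes \<rho>: "\<rho> \<ge> 1"
  shows "variation_norm \<rho> I (\<lambda>t. a t + b t) \<le> variation_norm \<rho> I a + variation_norm \<rho> I b"
proof (cases "variation_norm \<rho> I a = top \<or> variation_norm \<rho> I b = top")
  case False
  then obtain A B where AB: "variation_norm \<rho> I a = ennreal A" "A \<ge> 0" "variation_norm \<rho> I b = ennreal B" "B \<ge> 0"
    by (cases "variation_norm \<rho> I a"; cases "variation_norm \<rho> I b") auto
  show ?thesis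
  proof (rule ennreal_le_epsilon)
    fix e :: real assume e: "e > 0"
    define \<alpha> \<beta> where "\<alpha> = A + e / 2" and "\<beta> = B + e / 2"
    have ab: "\<alpha> > 0" "\<beta> > 0" using AB e by (auto simp: \<alpha>_def \<beta>_def intro: add_nonneg_pos)
    have le: "jump_sum \<rho> t a \<le> ennreal (\<alpha> powr \<rho>)" "jump_sum \<rho> t b \<le> ennreal (\<beta> powr \<rho>)"
      if t: "t \<in> {t. incseq t \<and> range t \<subseteq> I}" for t
    proof -
      have "epowr (jump_sum \<rho> t a) (1 / \<rho>) \<le> ennreal \<alpha>" "epowr (jump_sum \<rho> t b) (1 / \<rho>) \<le> ennreal \<beta>"
        using SUP_upper[OF t, of "\<lambda>t. epowr (jump_sum \<rho> t a) (1 / \<rho>)"]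
          SUP_upper[OF t, of "\<lambda>t. epowr (jump_sum \<rho> t b) (1 / \<rho>)"] AB e
        unfolding variation_norm_jump_sum[symmetric] \<alpha>_def \<beta>_def
        by (auto intro: order_trans ennreal_leI)
      from this[THEN epowr_mono, of \<rho>]
      show "jump_sum \<rho> t a \<le> ennreal (\<alpha> powr \<rho>)" "jump_sum \<rho> t b \<le> ennreal (\<beta> powr \<rho>)"
        using \<rho> ab by (auto simp: epowr_inverse epowr_ennreal)
    qed
    have "variation_norm \<rho> I (\<lambda>t. a t + b t) \<le> ennreal (\<alpha> + \<beta>)"
      unfolding variation_norm_jump_sum
    proof (rule SUP_least)
      fix t assume t: "t \<in> {t. incseq t \<and> range t \<subseteq> I}"
      let ?g = "(\<alpha> + \<beta>) powr (\<rho> - 1)"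
      have "jump_sum \<rho> t (\<lambda>t. a t + b t)
        \<le> (\<Sum>k. ennreal (?g * \<alpha> powr (1 - \<rho>)) * ennreal (norm (a (t (Suc k)) - a (t k)) powr \<rho>)
              + ennreal (?g * \<beta> powr (1 - \<rho>)) * ennreal (norm (b (t (Suc k)) - b (t k)) powr \<rho>))"
        unfolding jump_sum_def
      proof (intro suminf_le)
        fix k
        let ?x = "norm (a (t (Suc k)) - a (t k))" and ?y = "norm (b (t (Suc k)) - b (t k))"
        have "norm (a (t (Suc k)) + b (t (Suc k)) - (a (t k) + b (t k))) powr \<rho> \<le> (?x + ?y) powr \<rho>"
          using \<rho> by (intro powr_mono2 norm_diff_triangle_ineq) auto
        also have "\<dots> \<le> ?g * (\<alpha> powr (1 - \<rho>) * ?x powr \<rho> + \<beta> powr (1 - \<rho>) * ?y powr \<rho>)"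
          using \<rho> ab by (intro powr_add_le_weighted) auto
        finally show "ennreal (norm (a (t (Suc k)) + b (t (Suc k)) - (a (t k) + b (t k))) powr \<rho>)
          \<le> ennreal (?g * \<alpha> powr (1 - \<rho>)) * ennreal (?x powr \<rho>) + ennreal (?g * \<beta> powr (1 - \<rho>)) * ennreal (?y powr \<rho>)"
          by (simp add: ennreal_mult[symmetric] ennreal_plus[symmetric] distrib_left mult.assoc ennreal_leI del: ennreal_plus)
      qed auto
      also have "\<dots> = ennreal (?g * \<alpha> powr (1 - \<rho>)) * jump_sum \<rho> t a + ennreal (?g * \<beta> powr (1 - \<rho>)) * jump_sum \<rho> t b"
        unfolding jump_sum_def by (subst suminf_add[symmetric]) (auto simp: ennreal_suminf_cmult)
      also have "\<dots> \<le> ennreal (?g * \<alpha> powr (1 - \<rho>)) * ennreal (\<alpha> powr \<rho>) + ennreal (?g * \<beta> powr (1 - \<rho>)) * ennreal (\<beta> powr \<rho>)"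
        by (intro add_mono mult_left_mono le t) auto
      also have "\<dots> = ennreal (?g * (\<alpha> powr (1 - \<rho>) * \<alpha> powr \<rho> + \<beta> powr (1 - \<rho>) * \<beta> powr \<rho>))"
        by (simp add: ennreal_mult[symmetric] ennreal_plus[symmetric] distrib_left mult.assoc del: ennreal_plus)
      also have "?g * (\<alpha> powr (1 - \<rho>) * \<alpha> powr \<rho> + \<beta> powr (1 - \<rho>) * \<beta> powr \<rho>) = (\<alpha> + \<beta>) powr \<rho>"
        using ab by (simp add: powr_add[symmetric] powr_diff)
      finally have "epowr (jump_sum \<rho> t (\<lambda>t. a t + b t)) (1 / \<rho>) \<le> epowr (ennreal ((\<alpha> + \<beta>) powr \<rho>)) (1 / \<rho>)"
        using \<rho> by (intro epowr_mono) auto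
      also have "\<dots> = ennreal (\<alpha> + \<beta>)" using \<rho> ab by (simp add: epowr_ennreal powr_powr)
      finally show "epowr (jump_sum \<rho> t (\<lambda>t. a t + b t)) (1 / \<rho>) \<le> ennreal (\<alpha> + \<beta>)" .
    qed
    also have "\<dots> = variation_norm \<rho> I a + variation_norm \<rho> I b + ennreal e"
      using AB e by (simp add: \<alpha>_def \<beta>_def ennreal_plus[symmetric] del: ennreal_plus)
    finally show "variation_norm \<rho> I (\<lambda>t. a t + b t) \<le> variation_norm \<rho> I a + variation_norm \<rho> I b + ennreal e" .
  qed
qed auto

section \<open>Weighted norms and almost everywhere limits\<close>

lemma Lp_weighted_iff:
  assumes "p > 0"
  shows "f \<in> Lp_weighted p w \<longleftrightarrow> f \<in> borel_measurable lebesgue \<and>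
    (\<integral>\<^sup>+x. ennreal (norm (f x) powr p) * ennreal (w x) \<partial>lebesgue) < \<infinity>"
proof -
  have "epowr A (1 / p) < top \<longleftrightarrow> A < top" for A
    by (cases A) (auto simp: epowr_ennreal)
  then show ?thesis by (simp add: Lp_weighted_def Lp_wnorm_def epowr_ennreal)
qed

lemma Lp_bounded_byD:
  assumes "p > 0" "C \<ge> 0" "Lp_bounded_by p w C S" "f \<in> Lp_weighted p w"
  shows "S f \<in> borel_measurable lebesgue"
    and "(\<integral>\<^sup>+x. epowr (S f x) p * ennreal (w x) \<partial>lebesgue)
      \<le> ennreal (C powr p) * (\<integral>\<^sup>+x. ennreal (norm (f x) powr p) * ennreal (w x) \<partial>lebesgue)"
proof -
  show "S f \<in> borel_measurable lebesgue" using assms by (auto simp: Lp_bounded_by_def)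
  have "Lp_wnorm p w (S f) \<le> ennreal C * Lp_wnorm p w (\<lambda>x. ennreal (norm (f x)))"
    using assms by (auto simp: Lp_bounded_by_def)
  from epowr_mono[OF this, of p]
  show "(\<integral>\<^sup>+x. epowr (S f x) p * ennreal (w x) \<partial>lebesgue)
      \<le> ennreal (C powr p) * (\<integral>\<^sup>+x. ennreal (norm (f x) powr p) * ennreal (w x) \<partial>lebesgue)"
    using assms(1,2) by (simp add: Lp_wnorm_def epowr_mult epowr_inverse epowr_ennreal)
qed

lemma Lp_wnorm_leI:
  assumes "p > 0" "C \<ge> 0"
    "(\<integral>\<^sup>+x. epowr (g x) p * ennreal (w x) \<partial>lebesgue)
      \<le> ennreal (C powr p) * (\<integral>\<^sup>+x. ennreal (norm (f x) powr p) * ennreal (w x) \<partial>lebesgue)"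
  shows "Lp_wnorm p w g \<le> ennreal C * Lp_wnorm p w (\<lambda>x. ennreal (norm (f x)))"
proof -
  have "epowr (\<integral>\<^sup>+x. epowr (g x) p * ennreal (w x) \<partial>lebesgue) (1 / p)
    \<le> epowr (ennreal (C powr p) * (\<integral>\<^sup>+x. ennreal (norm (f x) powr p) * ennreal (w x) \<partial>lebesgue)) (1 / p)"
    using assms by (intro epowr_mono) auto
  then show ?thesis using assms(1,2)
    by (simp add: Lp_wnorm_def epowr_mult epowr_ennreal powr_powr)
qed

lemma borel_measurable_lebesgue_AE:
  fixes f g :: "'a::euclidean_space \<Rightarrow> 'b::topological_space"
  assumes f: "f \<in> borel_measurable lebesgue" and ae: "AE x in lebesgue. f x = g x"
  shows "g \<in> borel_measurable lebesgue"
proof (rule measurableI)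
  obtain N where N: "N \<in> null_sets lebesgue" "\<And>x. x \<notin> N \<Longrightarrow> f x = g x"
    using ae unfolding completion.AE_iff_null_sets by auto
  fix A :: "'b set" assume A: "A \<in> sets borel"
  have "g -` A \<inter> N \<in> null_sets lebesgue"
    by (rule null_sets_completion_subset[OF _ N(1)]) auto
  moreover have "f -` A \<inter> space lebesgue \<in> sets lebesgue" by (rule measurable_sets[OF f A])
  moreover have "g -` A \<inter> space lebesgue = (f -` A \<inter> space lebesgue - N) \<union> (g -` A \<inter> N)"
    using N(2) by auto
  ultimately show "g -` A \<inter> space lebesgue \<in> sets lebesgue"
    using N(1) by (metis null_setsD2 sets.Diff sets.Un)
qed simp

text \<open>
  Subtraction-free form of \<open>\<bar>u k - l\<bar> \<le> e k\<close>, which also covers \<open>l = \<infinity>\<close>.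
\<close>

lemma tendsto_of_le_add:
  fixes u :: "nat \<Rightarrow> ennreal"
  assumes "\<And>k. u k \<le> l + ennreal (e k)" "\<And>k. l \<le> u k + ennreal (e k)"
    and e: "e \<longlonglongrightarrow> 0" "\<And>k. e k \<ge> 0"
  shows "u \<longlonglongrightarrow> l"
proof (cases "l = top")
  case True
  have "u k = top" for k using assms(2)[of k] True by (auto simp: top_unique)
  then have "u = (\<lambda>k. top)" by auto
  then show ?thesis using True by simp
next
  case False
  define L where "L = enn2real l"
  define v where "v k = enn2real (u k)" for k
  have l: "l = ennreal L" "L \<ge> 0" using False by (auto simp: L_def less_top)
  have "u k < top" for k
    using assms(1)[of k] l by (metis ennreal_less_top ennreal_plus e(2) le_less_trans)
  then have u: "u k = ennreal (v k)" "v k \<ge> 0" for k by (auto simp: v_def)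
  have "\<bar>v k - L\<bar> \<le> e k" for k
  proof -
    have "ennreal (v k) \<le> ennreal (L + e k)" "ennreal L \<le> ennreal (v k + e k)"
      using assms(1,2)[of k] u l e(2) by auto
    then have "v k \<le> L + e k" "L \<le> v k + e k"
      using u(2)[of k] l(2) e(2)[of k] by (simp_all del: ennreal_plus)
    then show ?thesis by (simp add: abs_le_iff)
  qed
  then have "(\<lambda>k. v k - L) \<longlonglongrightarrow> 0"
    by (intro Lim_null_comparison[OF _ e(1)]) auto
  then have "v \<longlonglongrightarrow> L" by (simp add: LIM_zero_iff)
  then have "(\<lambda>k. ennreal (v k)) \<longlonglongrightarrow> ennreal L" by (rule tendsto_ennrealI)
  moreover have "u = (\<lambda>k. ennreal (v k))" using u by auto
  ultimately show ?thesis using l by simp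
qed

text \<open>
  Geometric decay makes the \<open>p\<close>-th powers summable, so they tend to zero almost everywhere against
  a weight that is positive almost everywhere.
\<close>

lemma AE_tendsto_zero_Lp:
  fixes U :: "nat \<Rightarrow> 'a \<Rightarrow> ennreal"
  assumes p: "p > 0" and [measurable]: "\<And>k. U k \<in> borel_measurable M" "v \<in> borel_measurable M"
    and pos: "AE x in M. 0 < v x" and A: "A < \<infinity>"
    and bd: "\<And>k. (\<integral>\<^sup>+x. epowr (U k x) p * v x \<partial>M) \<le> ennreal ((1/2) ^ k) * A"
  shows "AE x in M. (\<lambda>k. U k x) \<longlonglongrightarrow> 0"
proof -
  have "(\<Sum>k. \<integral>\<^sup>+x. epowr (U k x) p * v x \<partial>M) \<le> (\<Sum>k. ennreal ((1/2) ^ k) * A)"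
    by (intro suminf_le bd) auto
  also have "\<dots> = (\<Sum>k. ennreal ((1/2) ^ k)) * A" by (rule ennreal_suminf_multc)
  also have "(\<Sum>k. ennreal ((1/2) ^ k)) = ennreal (\<Sum>k. (1/2) ^ k)"
    by (intro suminf_ennreal2 summable_geometric) auto
  also have "\<dots> * A < \<infinity>" using A by (simp add: ennreal_mult_less_top)
  finally have "AE x in M. (\<lambda>k. epowr (U k x) p * v x) \<longlonglongrightarrow> 0"
    by (intro AE_tendsto_zero_of_summable) auto
  with pos show ?thesis
  proof eventually_elim
    case (elim x)
    show ?case
    proof (rule tendsto_zero_ennrealI)
      fix e :: real assume e: "e > 0"
      then have "0 < epowr (ennreal e) p * v x"
        using elim by (simp add: epowr_ennreal ennreal_zero_less_mult_iff)
      with elim(2) have "eventually (\<lambda>k. epowr (U k x) p * v x < epowr (ennreal e) p * v x) sequentially"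
        by (rule order_tendstoD(2))
      then show "eventually (\<lambda>k. U k x \<le> ennreal e) sequentially"
      proof eventually_elim
        case (elim k)
        show ?case
        proof (rule ccontr)
          assume "\<not> U k x \<le> ennreal e"
          then have "epowr (ennreal e) p * v x \<le> epowr (U k x) p * v x"
            using p by (intro mult_right_mono epowr_mono) auto
          then show False using elim by simp
        qed
      qed
    qed
  qed
qed

lemma nn_integral_epowr_average_le:
  assumes p: "p \<ge> 1" and N: "N > 0"
    and [measurable]: "\<And>j. j < N \<Longrightarrow> u j \<in> borel_measurable M" "v \<in> borel_measurable M"
    and bd: "\<And>j. j < N \<Longrightarrow> (\<integral>\<^sup>+x. epowr (u j x) p * v x \<partial>M) \<le> A"
  shows "(\<integral>\<^sup>+x. epowr (ennreal (1 / real N) * (\<Sum>j<N. u j x)) p * v x \<partial>M) \<le> A"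
proof -
  have "(\<integral>\<^sup>+x. epowr (ennreal (1 / real N) * (\<Sum>j<N. u j x)) p * v x \<partial>M)
    \<le> (\<integral>\<^sup>+x. ennreal (1 / real N) * (\<Sum>j<N. epowr (u j x) p * v x) \<partial>M)"
    using mult_right_mono[OF epowr_average_le[OF p N]]
    by (intro nn_integral_mono) (simp add: mult.assoc sum_distrib_right)
  also have "\<dots> = ennreal (1 / real N) * (\<Sum>j<N. \<integral>\<^sup>+x. epowr (u j x) p * v x \<partial>M)"
    by (subst nn_integral_cmult) (auto intro!: nn_integral_sum arg_cong2[where f="(*)"])
  also have "\<dots> \<le> ennreal (1 / real N) * (\<Sum>j<N. A)"
    by (intro mult_left_mono sum_mono bd) auto
  also have "\<dots> = ennreal (1 / real N) * ennreal (real N) * A"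
    by (simp add: ennreal_of_nat_eq_real_of_nat mult.assoc)
  also have "\<dots> = A" using N by (simp add: ennreal_mult[symmetric])
  finally show ?thesis .
qed

section \<open>A discrete Cauchy formula\<close>

definition exp_taylor :: "nat \<Rightarrow> complex \<Rightarrow> complex" where
  "exp_taylor K u = (\<Sum>k<K. u ^ k / fact k)"

lemma sum_exp_terms:
  fixes u :: "'a::{real_normed_field,banach}"
  shows "(\<lambda>k. u ^ k / fact k) sums exp u"
  using exp_converges[of u] by (simp add: scaleR_conv_of_real field_simps)

lemma norm_exp_taylor_le: "norm (exp_taylor K u) \<le> exp (norm u)"
proof -
  have "norm (exp_taylor K u) \<le> (\<Sum>k<K. norm u ^ k / fact k)"
    unfolding exp_taylor_def by (rule order_trans[OF norm_sum]) (simp add: norm_divide norm_power)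
  also have "\<dots> \<le> (\<Sum>k. norm u ^ k / fact k)"
    using sum_exp_terms[of "norm u"] by (intro sum_le_suminf) (auto simp: sums_iff)
  also have "\<dots> = exp (norm u)" using sum_exp_terms[of "norm u"] by (simp add: sums_iff)
  finally show ?thesis .
qed

text \<open>
  For \<open>n \<ge> K\<close> the \<open>n\<close>-th term of the series at \<open>norm u\<close> is at most \<open>2 ^ (n - K)\<close> times itself, which is
  \<open>2 ^ (- K)\<close> times the \<open>n\<close>-th term at \<open>2 * norm u\<close>.
\<close>

lemma exp_taylor_remainder:
  "norm (exp u - exp_taylor K u) \<le> (1 / 2) ^ K * exp (2 * norm u)"
proof -
  let ?t = "\<lambda>n. (2 * norm u) ^ n / fact n"
  have s: "summable ?t" "suminf ?t = exp (2 * norm u)"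
    using sum_exp_terms[of "2 * norm u"] by (auto simp: sums_iff)
  have su: "summable (\<lambda>n. u ^ n / fact n)" "(\<Sum>n. u ^ n / fact n) = exp u"
    using sum_exp_terms[of u] by (auto simp: sums_iff)
  have le: "norm (u ^ (n + K) / fact (n + K)) \<le> (1 / 2) ^ K * ?t (n + K)" for n
  proof -
    have "norm (u ^ (n + K) / fact (n + K)) = 1 * (norm u ^ (n + K) / fact (n + K))"
      by (simp add: norm_divide norm_power)
    also have "\<dots> \<le> 2 ^ n * (norm u ^ (n + K) / fact (n + K))"
      by (intro mult_right_mono) auto
    also have "\<dots> = (1 / 2) ^ K * ?t (n + K)"
      by (simp add: power_mult_distrib power_add power_one_over field_simps)
    finally show ?thesis .
  qed
  have st: "summable (\<lambda>n. (1 / 2) ^ K * ?t (n + K))"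
    by (intro summable_mult summable_ignore_initial_segment s)
  have sn: "summable (\<lambda>n. norm (u ^ (n + K) / fact (n + K)))"
    by (rule summable_comparison_test[OF _ st]) (use le in auto)
  have "exp u - exp_taylor K u = (\<Sum>n. u ^ (n + K) / fact (n + K))"
    unfolding exp_taylor_def using suminf_minus_initial_segment[OF su(1), of K] su(2) by simp
  then have "norm (exp u - exp_taylor K u) \<le> (\<Sum>n. norm (u ^ (n + K) / fact (n + K)))"
    using summable_norm[OF sn] by simp
  also have "\<dots> \<le> (\<Sum>n. (1 / 2) ^ K * ?t (n + K))"
    by (intro suminf_le le sn st)
  also have "\<dots> = (1 / 2) ^ K * (\<Sum>n. ?t (n + K))"
    by (intro suminf_mult summable_ignore_initial_segment s)
  also have "(\<Sum>n. ?t (n + K)) \<le> exp (2 * norm u)"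
    using suminf_minus_initial_segment[OF s(1), of K] s(2) sum_nonneg[of "{..<K}" ?t] by simp
  finally show ?thesis by simp
qed

definition circle_point :: "real \<Rightarrow> nat \<Rightarrow> nat \<Rightarrow> complex" where
  "circle_point \<delta> N j = \<delta> * cis (2 * pi * j / N)"

lemma norm_circle_point: "\<delta> > 0 \<Longrightarrow> norm (circle_point \<delta> N j) = \<delta>"
  by (simp add: circle_point_def norm_mult)

text \<open>
  Up to a constant factor the summand is the \<open>j\<close>-th power of an \<open>N\<close>-th root of unity, which is
  \<open>1\<close> only if \<open>N\<close> divides \<open>m - 1\<close>; in the range \<open>0 \<le> m < N\<close> this forces \<open>m = 1\<close>.
\<close>

lemma circle_point_power_sum:
  assumes \<delta>: "\<delta> > 0" and m: "m < N" and N: "N \<ge> 2"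
  shows "(\<Sum>j<N. inverse (circle_point \<delta> N j) * circle_point \<delta> N j ^ m) = (if m = 1 then of_nat N else 0)"
proof (cases "m = 1")
  case True
  have "circle_point \<delta> N j \<noteq> 0" for j using norm_circle_point[OF \<delta>, of N j] \<delta> by auto
  then show ?thesis using True by simp
next
  case False
  define \<theta> where "\<theta> = 2 * pi * (real m - 1) / N"
  have summand: "inverse (circle_point \<delta> N j) * circle_point \<delta> N j ^ m = complex_of_real (\<delta> ^ m / \<delta>) * cis \<theta> ^ j" for j
  proof -
    have "inverse (cis a) * cis a ^ m = cis (real m * a - a)" for a
      unfolding Complex.DeMoivre cis_divide[symmetric] divide_inverse by (rule mult.commute)
    then have "inverse (cis (2 * pi * j / N)) * cis (2 * pi * j / N) ^ m = cis (real m * (2 * pi * j / N) - 2 * pi * j / N)" .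
    also have "real m * (2 * pi * j / N) - 2 * pi * j / N = real j * \<theta>"
      using N by (simp add: \<theta>_def field_simps)
    finally show ?thesis
      by (simp add: circle_point_def power_mult_distrib Complex.DeMoivre field_simps)
  qed
  have "cis \<theta> \<noteq> 1"
  proof
    assume "cis \<theta> = 1"
    then obtain k :: int where "\<theta> = 2 * pi * of_int k"
      by (auto simp: complex_eq_iff cos_one_2pi_int)
    then have "2 * pi * ((real m - 1) / N) = 2 * pi * of_int k" by (simp add: \<theta>_def)
    then have "(real m - 1) / N = of_int k" by (subst (asm) mult_left_cancel) auto
    then have "real m - 1 = real N * of_int k" using N by (simp add: field_simps)
    then have "real_of_int (int m - 1) = real_of_int (int N * k)" by simp
    then have *: "int m - 1 = int N * k" by (simp only: of_int_eq_iff)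
    then have "k \<noteq> 0" using False by auto
    then consider "k \<ge> 1" | "k \<le> - 1" by linarith
    then show False
    proof cases
      case 1
      then have "int N * 1 \<le> int N * k" by (intro mult_left_mono) auto
      then show False using * m by linarith
    next
      case 2
      then have "int N * k \<le> int N * (- 1)" by (intro mult_left_mono) auto
      then show False using * N by linarith
    qed
  qed
  moreover have "cis \<theta> ^ N = 1"
  proof -
    have "cis \<theta> ^ N = cis (2 * pi * of_int (int m - 1))"
      using N by (simp add: Complex.DeMoivre \<theta>_def)
    then show ?thesis by (simp only: cis_multiple_2pi Ints_of_int)
  qed
  ultimately have "(\<Sum>j<N. cis \<theta> ^ j) = 0" by (simp add: geometric_sum)
  then show ?thesis using False unfolding summand sum_distrib_left[symmetric] by simp
qed

text \<open>
  Cauchy's formula for the derivative of \<open>z \<mapsto> exp (z * (B - c))\<close> at \<open>0\<close>, discretized. Once both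
  exponential factors are truncated at degree \<open>K\<close>, the powers of \<open>z\<close> in the average run from \<open>-1\<close>
  to \<open>2 * K - 3\<close>, and averaging over \<open>2 * K\<close> points of the circle kills all of them except the
  zeroth. Hence the discrete formula holds exactly; being a finite sum of products of a
  function of \<open>B\<close> and a function of \<open>c\<close>, it can be inserted into any linear operator.
\<close>

lemma circle_average_extracts_difference:
  assumes \<delta>: "\<delta> > 0" and K: "K \<ge> 2"
  defines "N \<equiv> 2 * K"
  shows "(\<Sum>j<N. (1 / of_nat N) * inverse (circle_point \<delta> N j) * exp_taylor K (circle_point \<delta> N j * B)
      * exp_taylor K (- (circle_point \<delta> N j * c))) = B - c"
proof -
  let ?z = "circle_point \<delta> N"
  define g where "g k l = B ^ k / fact k * ((- c) ^ l / fact l)" for k l :: nat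
  have N: "N \<ge> 2" "N > 0" using K by (auto simp: N_def)
  have "exp_taylor K (?z j * B) * exp_taylor K (- (?z j * c)) = (\<Sum>k<K. \<Sum>l<K. g k l * ?z j ^ (k + l))" for j
    unfolding exp_taylor_def sum_product g_def
    by (intro sum.cong refl) (simp add: power_add power_mult_distrib power_minus[of "_ * _"] power_minus[of c])
  then have "(\<Sum>j<N. (1 / of_nat N) * inverse (?z j) * exp_taylor K (?z j * B) * exp_taylor K (- (?z j * c)))
    = (\<Sum>j<N. \<Sum>k<K. \<Sum>l<K. g k l / of_nat N * (inverse (?z j) * ?z j ^ (k + l)))"
    by (simp add: mult.assoc sum_distrib_left sum_divide_distrib mult_ac)
  also have "\<dots> = (\<Sum>k<K. \<Sum>j<N. \<Sum>l<K. g k l / of_nat N * (inverse (?z j) * ?z j ^ (k + l)))"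
    by (rule sum.swap)
  also have "\<dots> = (\<Sum>k<K. \<Sum>l<K. \<Sum>j<N. g k l / of_nat N * (inverse (?z j) * ?z j ^ (k + l)))"
    by (intro sum.cong refl sum.swap)
  also have "\<dots> = (\<Sum>k<K. \<Sum>l<K. if k + l = 1 then g k l else 0)"
  proof (intro sum.cong refl)
    fix k l assume "k \<in> {..<K}" "l \<in> {..<K}"
    then have "k + l < N" by (simp add: N_def)
    note * = circle_point_power_sum[OF \<delta> this N(1)]
    show "(\<Sum>j<N. g k l / of_nat N * (inverse (?z j) * ?z j ^ (k + l))) = (if k + l = 1 then g k l else 0)"
      unfolding sum_distrib_left[symmetric] * using N by simp
  qed
  also have "\<dots> = B - c"
  proof -
    obtain K' where "K = Suc (Suc K')" using K by (metis add_2_eq_Suc le_Suc_ex)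
    then show ?thesis by (simp add: sum.lessThan_Suc_shift g_def del: sum.lessThan_Suc)
  qed
  finally show ?thesis .
qed

section \<open>Conjugation by exponentials\<close>

text \<open>
  The assumptions are what the perturbation theorem gives for \<open>\<delta>\<close> of order \<open>1 / bmo_norm b\<close>: the
  variation of \<open>T\<close> is bounded, with one constant, for the conjugated weights \<open>w exp (p Re (z b))\<close> on the
  circle of radius \<open>\<delta>\<close> and for a damped weight. The truncation at \<open>M\<close> is there because \<open>w\<close> is merely
  locally integrable, so that \<open>w exp (p Re (z b))\<close> may fail to be so. The damping factor decays so
  fast that \<open>f\<close>, \<open>b f\<close>, \<open>exp (- z b) f\<close> and the Taylor remainders all lie in the one damped space,
  where the linearity of \<open>T\<close> can be used.
\<close>

locale conjugation =
  fixes T :: "real \<Rightarrow> ('a::euclidean_space \<Rightarrow> complex) \<Rightarrow> ('a \<Rightarrow> complex)"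
    and D :: "('a \<Rightarrow> complex) set"
    and p \<rho> C \<delta> :: real and w :: "'a \<Rightarrow> real" and b :: "'a \<Rightarrow> complex"
  assumes p: "1 < p" and \<rho>: "1 \<le> \<rho>" and C: "0 \<le> C" and \<delta>: "0 < \<delta>"
    and linear: "\<And>t. t > 0 \<Longrightarrow> linear_operator_on D (T t)"
    and b_measurable [measurable]: "b \<in> borel_measurable lebesgue"
    and w_measurable [measurable]: "w \<in> borel_measurable lebesgue"
    and w_nonneg: "\<And>x. 0 \<le> w x" and w_pos: "AE x in lebesgue. 0 < w x"
    and damped_domain: "Lp_weighted p (\<lambda>x. w x * exp (- (2 * p * \<delta> * norm (b x)))) \<subseteq> D"
    and damped_bound: "Lp_bounded_by p (\<lambda>x. w x * exp (- (2 * p * \<delta> * norm (b x)))) C (variation_op \<rho> T)"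
    and conjugated_bound: "\<And>z M. norm z = \<delta> \<Longrightarrow>
      Lp_bounded_by p (\<lambda>x. w x * exp (p * min (Re (z * b x)) M)) C (variation_op \<rho> T)"
begin

definition damped :: "'a \<Rightarrow> real" where
  "damped x = w x * exp (- (2 * p * \<delta> * norm (b x)))"

abbreviation V :: "('a \<Rightarrow> complex) \<Rightarrow> 'a \<Rightarrow> ennreal" where "V \<equiv> variation_op \<rho> T"

abbreviation mass :: "('a \<Rightarrow> complex) \<Rightarrow> ennreal" where
  "mass f \<equiv> \<integral>\<^sup>+x. ennreal (norm (f x) powr p) * ennreal (w x) \<partial>lebesgue"

lemma p_pos: "p > 0" using p by simp

lemma damped_measurable [measurable]: "damped \<in> borel_measurable lebesgue"
  unfolding damped_def by measurable

lemma damped_pos: "AE x in lebesgue. 0 < ennreal (damped x)"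
  using w_pos by eventually_elim (simp add: damped_def)

lemma D_zero: "(\<lambda>x. 0) \<in> D"
  using linear[of 1] by (auto simp: linear_operator_on_def)

lemma D_scale: "g \<in> D \<Longrightarrow> (\<lambda>x. c * g x) \<in> D"
  using linear[of 1] by (auto simp: linear_operator_on_def)

lemma D_add: "g \<in> D \<Longrightarrow> h \<in> D \<Longrightarrow> (\<lambda>x. g x + h x) \<in> D"
  using linear[of 1] by (auto simp: linear_operator_on_def)

lemma V_scale:
  assumes "g \<in> D" shows "V (\<lambda>y. c * g y) x \<le> ennreal (norm c) * V g x"
proof -
  have "V (\<lambda>y. c * g y) x = variation_norm \<rho> {0<..} (\<lambda>t. c * T t g x)"
    unfolding variation_op_def using linear assms
    by (intro variation_norm_cong) (auto simp: linear_operator_on_def)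
  also have "\<dots> \<le> ennreal (norm c) * V g x"
    unfolding variation_op_def using \<rho> by (intro variation_norm_scale) auto
  finally show ?thesis .
qed

lemma V_add:
  assumes "g \<in> D" "h \<in> D" shows "V (\<lambda>y. g y + h y) x \<le> V g x + V h x"
proof -
  have "V (\<lambda>y. g y + h y) x = variation_norm \<rho> {0<..} (\<lambda>t. T t g x + T t h x)"
    unfolding variation_op_def using linear assms
    by (intro variation_norm_cong) (auto simp: linear_operator_on_def)
  also have "\<dots> \<le> V g x + V h x"
    unfolding variation_op_def using \<rho> by (intro variation_norm_triangle) auto
  finally show ?thesis .
qed

lemma V_sum:
  assumes "finite I" "\<And>i. i \<in> I \<Longrightarrow> g i \<in> D"
  shows "(\<lambda>y. \<Sum>i\<in>I. c i * g i y) \<in> D \<and>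
    V (\<lambda>y. \<Sum>i\<in>I. c i * g i y) x \<le> (\<Sum>i\<in>I. ennreal (norm (c i)) * V (g i) x)"
  using assms
proof (induction I)
  case empty
  have "V (\<lambda>y. 0 * 0) x \<le> ennreal (norm (0::complex)) * V (\<lambda>x. 0) x" by (rule V_scale[OF D_zero])
  then show ?case using D_zero by simp
next
  case (insert i I)
  then have IH: "(\<lambda>y. \<Sum>i\<in>I. c i * g i y) \<in> D"
    "V (\<lambda>y. \<Sum>i\<in>I. c i * g i y) x \<le> (\<Sum>i\<in>I. ennreal (norm (c i)) * V (g i) x)" by auto
  have gi: "g i \<in> D" using insert by auto
  have "V (\<lambda>y. c i * g i y + (\<Sum>i\<in>I. c i * g i y)) x
    \<le> V (\<lambda>y. c i * g i y) x + V (\<lambda>y. \<Sum>i\<in>I. c i * g i y) x"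
    by (intro V_add D_scale gi IH)
  also have "\<dots> \<le> ennreal (norm (c i)) * V (g i) x + (\<Sum>i\<in>I. ennreal (norm (c i)) * V (g i) x)"
    by (intro add_mono V_scale gi IH)
  finally show ?case using insert.hyps D_add[OF D_scale[OF gi] IH(1)] by simp
qed

lemma V_sub:
  assumes "g \<in> D" "h \<in> D" shows "V (\<lambda>y. g y - h y) x \<le> V g x + V h x"
proof -
  have "V (\<lambda>y. g y + (- 1) * h y) x \<le> V g x + V (\<lambda>y. (- 1) * h y) x"
    by (intro V_add D_scale assms)
  also have "\<dots> \<le> V g x + V h x"
    using V_scale[OF assms(2), of "- 1" x] by (intro add_left_mono) simp
  finally show ?thesis by simp
qed

text \<open>
  The growth \<open>exp (2 * \<delta> * norm (b x))\<close> allowed for \<open>g\<close> is exactly what the damping factor absorbs.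
\<close>

lemma damped_estimate:
  assumes f: "f \<in> Lp_weighted p w" and g [measurable]: "g \<in> borel_measurable lebesgue" and M: "M \<ge> 0"
    and le: "\<And>x. norm (g x) \<le> M * exp (2 * \<delta> * norm (b x)) * norm (f x)"
  shows "g \<in> D" "V g \<in> borel_measurable lebesgue"
    "(\<integral>\<^sup>+x. epowr (V g x) p * ennreal (damped x) \<partial>lebesgue) \<le> ennreal (M powr p) * (ennreal (C powr p) * mass f)"
proof -
  have fm[measurable]: "f \<in> borel_measurable lebesgue" and fin: "mass f < \<infinity>"
    using f by (auto simp: Lp_weighted_iff[OF p_pos])
  have "norm (g x) powr p * damped x \<le> M powr p * (norm (f x) powr p * w x)" for x
  proof -
    have "norm (g x) powr p \<le> (M * exp (2 * \<delta> * norm (b x)) * norm (f x)) powr p"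
      using le p by (intro powr_mono2) auto
    also have "\<dots> = M powr p * exp (2 * p * \<delta> * norm (b x)) * norm (f x) powr p"
      using M by (simp add: powr_mult exp_powr_real mult_ac)
    finally have "norm (g x) powr p * damped x
      \<le> (M powr p * exp (2 * p * \<delta> * norm (b x)) * norm (f x) powr p) * damped x"
      using w_nonneg[of x] by (intro mult_right_mono) (auto simp: damped_def)
    also have "\<dots> = M powr p * (norm (f x) powr p * w x) * (exp (2 * p * \<delta> * norm (b x)) * exp (- (2 * p * \<delta> * norm (b x))))"
      by (simp add: damped_def)
    also have "\<dots> = M powr p * (norm (f x) powr p * w x)" by (simp add: exp_add[symmetric])
    finally show ?thesis .
  qed
  then have "(\<integral>\<^sup>+x. ennreal (norm (g x) powr p) * ennreal (damped x) \<partial>lebesgue)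
    \<le> (\<integral>\<^sup>+x. ennreal (M powr p) * (ennreal (norm (f x) powr p) * ennreal (w x)) \<partial>lebesgue)"
    using w_nonneg by (intro nn_integral_mono) (simp add: ennreal_mult[symmetric] damped_def ennreal_leI)
  also have "\<dots> = ennreal (M powr p) * mass f" by (intro nn_integral_cmult) auto
  finally have mg: "(\<integral>\<^sup>+x. ennreal (norm (g x) powr p) * ennreal (damped x) \<partial>lebesgue) \<le> ennreal (M powr p) * mass f" .
  also have "\<dots> < \<infinity>" using fin by (simp add: ennreal_mult_less_top)
  finally have gL: "g \<in> Lp_weighted p damped" by (simp add: Lp_weighted_iff[OF p_pos] g)
  then show "g \<in> D" using damped_domain by (auto simp: damped_def[abs_def])
  note bd = Lp_bounded_byD[OF p_pos C damped_bound[folded damped_def] gL]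
  show "V g \<in> borel_measurable lebesgue" by (rule bd(1))
  have "(\<integral>\<^sup>+x. epowr (V g x) p * ennreal (damped x) \<partial>lebesgue) \<le> ennreal (C powr p) * (ennreal (M powr p) * mass f)"
    using bd(2) mult_left_mono[OF mg] by (rule order_trans) simp
  then show "(\<integral>\<^sup>+x. epowr (V g x) p * ennreal (damped x) \<partial>lebesgue) \<le> ennreal (M powr p) * (ennreal (C powr p) * mass f)"
    by (simp add: mult_ac)
qed

text \<open>
  For every truncation \<open>M\<close> the \<open>p\<close>-th power of \<open>exp (- z b) f\<close> times the truncated conjugated
  weight is at most \<open>\<bar>f\<bar>\<^sup>p w\<close>, so the bound does not depend on \<open>M\<close>; as \<open>M\<close> grows, the truncated weight
  at each point becomes the full conjugated weight.
\<close>

lemma conjugated_estimate: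
  assumes f: "f \<in> Lp_weighted p w" and z: "norm z = \<delta>"
    and Vm[measurable]: "V (\<lambda>y. exp (- (z * b y)) * f y) \<in> borel_measurable lebesgue"
  shows "(\<integral>\<^sup>+x. epowr (ennreal (exp (Re (z * b x))) * V (\<lambda>y. exp (- (z * b y)) * f y) x) p * ennreal (w x) \<partial>lebesgue)
    \<le> ennreal (C powr p) * mass f"
proof -
  let ?g = "\<lambda>y. exp (- (z * b y)) * f y"
  let ?w = "\<lambda>M x. w x * exp (p * min (Re (z * b x)) M)"
  have fm[measurable]: "f \<in> borel_measurable lebesgue" and fin: "mass f < \<infinity>"
    using f by (auto simp: Lp_weighted_iff[OF p_pos])
  have bd: "(\<integral>\<^sup>+x. epowr (V ?g x) p * ennreal (?w M x) \<partial>lebesgue) \<le> ennreal (C powr p) * mass f" for M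
  proof -
    have le: "norm (?g x) powr p * ?w M x \<le> norm (f x) powr p * w x" for x
    proof -
      have "norm (?g x) powr p * ?w M x = exp (- (p * Re (z * b x)) + p * min (Re (z * b x)) M) * (norm (f x) powr p * w x)"
      proof -
        have "norm (?g x) = exp (- Re (z * b x)) * norm (f x)" by (simp add: norm_mult norm_exp_eq_Re)
        then have "norm (?g x) powr p = exp (- (p * Re (z * b x))) * norm (f x) powr p"
          by (simp only: powr_mult exp_powr_real) (simp add: algebra_simps)
        then show ?thesis by (simp only: exp_add mult_ac)
      qed
      also have "\<dots> \<le> 1 * (norm (f x) powr p * w x)"
        using p w_nonneg by (intro mult_right_mono) (auto simp: min_def)
      finally show ?thesis by simp
    qed
    have mg: "(\<integral>\<^sup>+x. ennreal (norm (?g x) powr p) * ennreal (?w M x) \<partial>lebesgue) \<le> mass f"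
      using le w_nonneg by (intro nn_integral_mono) (simp add: ennreal_mult[symmetric] ennreal_leI)
    then have "?g \<in> Lp_weighted p (?w M)"
      using fin by (simp add: Lp_weighted_iff[OF p_pos] le_less_trans)
    from Lp_bounded_byD(2)[OF p_pos C conjugated_bound[OF z] this] mult_left_mono[OF mg]
    show ?thesis by (rule order_trans) simp
  qed
  let ?h = "\<lambda>x. epowr (ennreal (exp (Re (z * b x))) * V ?g x) p * ennreal (w x)"
  have "(\<integral>\<^sup>+x. ?h x \<partial>lebesgue) \<le> (\<integral>\<^sup>+x. liminf (\<lambda>n. epowr (V ?g x) p * ennreal (?w (real n) x)) \<partial>lebesgue)"
  proof (rule nn_integral_mono)
    fix x
    have h: "?h x = epowr (V ?g x) p * ennreal (w x * exp (p * Re (z * b x)))"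
      using p w_nonneg by (simp add: epowr_mult epowr_ennreal exp_powr_real ennreal_mult mult_ac)
    have "eventually (\<lambda>n. epowr (V ?g x) p * ennreal (?w (real n) x) = ?h x) sequentially"
      using eventually_ge_at_top[of "nat \<lceil>Re (z * b x)\<rceil>"]
    proof eventually_elim
      case (elim n)
      then have "Re (z * b x) \<le> real n" by linarith
      then show ?case unfolding h by (simp add: min_def)
    qed
    then have "(\<lambda>n. epowr (V ?g x) p * ennreal (?w (real n) x)) \<longlonglongrightarrow> ?h x" by (rule tendsto_eventually)
    from lim_imp_Liminf[OF sequentially_bot this]
    show "?h x \<le> liminf (\<lambda>n. epowr (V ?g x) p * ennreal (?w (real n) x))" by simp
  qed
  also have "\<dots> \<le> liminf (\<lambda>n. \<integral>\<^sup>+x. epowr (V ?g x) p * ennreal (?w (real n) x) \<partial>lebesgue)"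
    by (rule nn_integral_liminf) measurable
  also have "\<dots> \<le> liminf (\<lambda>n. ennreal (C powr p) * mass f)"
    by (intro Liminf_mono always_eventually allI bd)
  finally show ?thesis by (simp add: Liminf_const)
qed

lemma commutator_variation_eq:
  "variation_op \<rho> (\<lambda>t. commutator (T t) b) f x = V (\<lambda>y. (b x - b y) * f y) x"
  unfolding variation_op_def commutator_def ..

lemma commutator_inputs:
  assumes f: "f \<in> Lp_weighted p w"
  shows "f \<in> D" "V f \<in> borel_measurable lebesgue" "AE x in lebesgue. V f x < top"
    "(\<lambda>y. (c - b y) * f y) \<in> D" "V (\<lambda>y. (c - b y) * f y) \<in> borel_measurable lebesgue"
proof -
  have fm[measurable]: "f \<in> borel_measurable lebesgue" and fin: "mass f < \<infinity>"
    using f by (auto simp: Lp_weighted_iff[OF p_pos])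
  have 1: "norm (f x) \<le> 1 * exp (2 * \<delta> * norm (b x)) * norm (f x)" for x
    using \<delta> mult_right_mono[of 1 "exp (2 * \<delta> * norm (b x))" "norm (f x)"] by simp
  note est = damped_estimate[OF f fm zero_le_one 1]
  show "f \<in> D" and Vm[measurable]: "V f \<in> borel_measurable lebesgue" using est by auto
  have "(\<integral>\<^sup>+x. epowr (V f x) p * ennreal (damped x) \<partial>lebesgue) < \<infinity>"
    using est(3) fin by (simp add: ennreal_mult_less_top le_less_trans)
  then have "AE x in lebesgue. epowr (V f x) p * ennreal (damped x) \<noteq> \<infinity>"
    by (intro nn_integral_noteq_infinite) auto
  with damped_pos show "AE x in lebesgue. V f x < top"
    by eventually_elim (auto simp: less_top[symmetric] ennreal_top_mult)
  have 2: "norm ((c - b x) * f x) \<le> (norm c + 1 / (2 * \<delta>)) * exp (2 * \<delta> * norm (b x)) * norm (f x)" for x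
  proof -
    have "2 * \<delta> * norm (b x) \<le> exp (2 * \<delta> * norm (b x))"
      using exp_ge_add_one_self[of "2 * \<delta> * norm (b x)"] by linarith
    then have "norm (b x) \<le> 1 / (2 * \<delta>) * exp (2 * \<delta> * norm (b x))"
      using \<delta> by (simp add: field_simps)
    moreover have "norm c * 1 \<le> norm c * exp (2 * \<delta> * norm (b x))"
      using \<delta> by (intro mult_left_mono) auto
    moreover have "norm (c - b x) \<le> norm c + norm (b x)" by (rule norm_triangle_ineq4)
    ultimately have "norm (c - b x) \<le> (norm c + 1 / (2 * \<delta>)) * exp (2 * \<delta> * norm (b x))"
      by (simp add: distrib_right)
    then show ?thesis by (simp add: norm_mult mult_right_mono)
  qed
  have 3: "0 \<le> norm c + 1 / (2 * \<delta>)" using \<delta> by simp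
  have "(\<lambda>y. (c - b y) * f y) \<in> borel_measurable lebesgue" by measurable
  from damped_estimate[OF f this 3 2]
  show "(\<lambda>y. (c - b y) * f y) \<in> D" "V (\<lambda>y. (c - b y) * f y) \<in> borel_measurable lebesgue" by auto
qed

text \<open>
  With \<open>b x\<close> frozen to a constant \<open>c\<close> the variation is measurable in \<open>x\<close> by assumption. As a
  function of \<open>c\<close> it is Lipschitz with constant \<open>V f x\<close>, finite almost everywhere, so \<open>b\<close> may be replaced by
  simple functions converging to it.
\<close>

lemma commutator_variation_measurable:
  assumes f: "f \<in> Lp_weighted p w"
  shows "variation_op \<rho> (\<lambda>t. commutator (T t) b) f \<in> borel_measurable lebesgue"
proof -
  let ?g = "\<lambda>c y. (c - b y) * f y"
  obtain F where F: "\<And>i. simple_function lebesgue (F i)" "\<And>x. (\<lambda>i. F i x) \<longlonglongrightarrow> b x"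
    using borel_measurable_implies_sequence_metric[OF b_measurable, of 0] by auto
  have meas: "(\<lambda>x. V (?g (F i x)) x) \<in> borel_measurable lebesgue" for i
  proof (rule measurable_compose_countable'[where I = "range (F i)" and g = "F i"])
    show "countable (range (F i))"
      using simple_functionD(1)[OF F(1)[of i]] by (simp add: countable_finite)
    then show "F i \<in> measurable lebesgue (count_space (range (F i)))"
      using simple_functionD(2)[OF F(1)[of i]] by (subst measurable_count_space_eq_countable) auto
  qed (rule commutator_inputs(5)[OF f])
  have "(\<lambda>x. liminf (\<lambda>i. V (?g (F i x)) x)) \<in> borel_measurable lebesgue"
    using meas by measurable
  moreover have "AE x in lebesgue. liminf (\<lambda>i. V (?g (F i x)) x) = variation_op \<rho> (\<lambda>t. commutator (T t) b) f x"
    using commutator_inputs(3)[OF f]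
  proof eventually_elim
    case (elim x)
    define v where "v = enn2real (V f x)"
    have v: "V f x = ennreal v" "v \<ge> 0" using elim by (auto simp: v_def)
    have comp: "V (?g c) x \<le> V (?g d) x + ennreal (norm (c - d) * v)" for c d
    proof -
      have "V (\<lambda>y. ?g d y + (c - d) * f y) x \<le> V (?g d) x + V (\<lambda>y. (c - d) * f y) x"
        by (intro V_add D_scale commutator_inputs f)
      also have "\<dots> \<le> V (?g d) x + ennreal (norm (c - d)) * V f x"
        by (intro add_left_mono V_scale commutator_inputs f)
      also have "(\<lambda>y. ?g d y + (c - d) * f y) = ?g c" by (auto simp: algebra_simps)
      finally show ?thesis using v by (simp add: ennreal_mult)
    qed
    have "(\<lambda>i. V (?g (F i x)) x) \<longlonglongrightarrow> V (?g (b x)) x"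
    proof (rule tendsto_of_le_add[where e="\<lambda>i. norm (F i x - b x) * v"])
      show "V (?g (F i x)) x \<le> V (?g (b x)) x + ennreal (norm (F i x - b x) * v)" for i by (rule comp)
      show "V (?g (b x)) x \<le> V (?g (F i x)) x + ennreal (norm (F i x - b x) * v)" for i
        using comp[of "b x" "F i x"] by (simp add: norm_minus_commute)
      have "(\<lambda>i. norm (F i x - b x) * v) \<longlonglongrightarrow> norm (b x - b x) * v"
        by (intro tendsto_intros F)
      then show "(\<lambda>i. norm (F i x - b x) * v) \<longlonglongrightarrow> 0" by simp
    qed (use v in auto)
    from lim_imp_Liminf[OF sequentially_bot this]
    show ?case by (simp add: commutator_variation_eq)
  qed
  ultimately show ?thesis by (rule borel_measurable_lebesgue_AE)
qed

end

section \<open>The commutator as a circle average\<close>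

lemma epowr_le_liminf:
  fixes S e :: "nat \<Rightarrow> ennreal"
  assumes p: "p > 0" and le: "\<And>k. v \<le> S k + e k" and e: "e \<longlonglongrightarrow> 0"
  shows "epowr v p \<le> liminf (\<lambda>k. epowr (S k) p)"
  unfolding le_Liminf_iff
proof (intro allI impI)
  fix y assume "y < epowr v p"
  then have "epowr y (1 / p) < v" by (simp add: epowr_less_iff[OF p])
  then obtain m where m: "epowr y (1 / p) < m" "m < v" using dense by blast
  have "eventually (\<lambda>k. e k < m - epowr y (1 / p)) sequentially"
    using e m(1) by (intro order_tendstoD(2)) (auto simp: diff_gr0_ennreal)
  then show "eventually (\<lambda>k. y < epowr (S k) p) sequentially"
  proof eventually_elim
    case (elim k)
    have "epowr y (1 / p) < S k"
    proof (rule ccontr)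
      assume "\<not> epowr y (1 / p) < S k"
      then have "v \<le> epowr y (1 / p) + (m - epowr y (1 / p))"
        using elim by (intro order_trans[OF le[of k]] add_mono) auto
      also have "\<dots> = m" using m(1) by (simp add: add.commute diff_add_cancel_ennreal)
      finally show False using m(2) by simp
    qed
    then show ?case by (simp add: epowr_less_iff[OF p])
  qed
qed

context conjugation
begin

definition twisted :: "('a \<Rightarrow> complex) \<Rightarrow> complex \<Rightarrow> 'a \<Rightarrow> complex" where
  "twisted f z y = exp (- (z * b y)) * f y"

definition twist_remainder :: "('a \<Rightarrow> complex) \<Rightarrow> nat \<Rightarrow> complex \<Rightarrow> 'a \<Rightarrow> complex" where
  "twist_remainder f K z y = (exp (- (z * b y)) - exp_taylor K (- (z * b y))) * f y"

lemma twisted_bounds: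
  assumes f: "f \<in> Lp_weighted p w" and z: "norm z = \<delta>"
  shows "twisted f z \<in> D" "V (twisted f z) \<in> borel_measurable lebesgue"
    "(\<integral>\<^sup>+x. epowr (V (twisted f z) x) p * ennreal (damped x) \<partial>lebesgue) \<le> ennreal (C powr p) * mass f"
proof -
  have fm[measurable]: "f \<in> borel_measurable lebesgue" using f by (simp add: Lp_weighted_iff[OF p_pos])
  have m: "twisted f z \<in> borel_measurable lebesgue" unfolding twisted_def by measurable
  have "norm (twisted f z x) \<le> 1 * exp (2 * \<delta> * norm (b x)) * norm (f x)" for x
  proof -
    have "norm (exp (- (z * b x))) \<le> exp (norm (- (z * b x)))" by (rule norm_exp)
    also have "\<dots> \<le> exp (2 * \<delta> * norm (b x))" using z \<delta> by (simp add: norm_mult)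
    finally show ?thesis unfolding twisted_def norm_mult by (intro mult_right_mono) auto
  qed
  from damped_estimate[OF f m zero_le_one this]
  show "twisted f z \<in> D" "V (twisted f z) \<in> borel_measurable lebesgue"
    "(\<integral>\<^sup>+x. epowr (V (twisted f z) x) p * ennreal (damped x) \<partial>lebesgue) \<le> ennreal (C powr p) * mass f"
    by auto
qed

lemma twist_remainder_bounds:
  assumes f: "f \<in> Lp_weighted p w" and z: "norm z = \<delta>"
  shows "twist_remainder f K z \<in> D" "V (twist_remainder f K z) \<in> borel_measurable lebesgue"
    "(\<integral>\<^sup>+x. epowr (V (twist_remainder f K z) x) p * ennreal (damped x) \<partial>lebesgue)
      \<le> ennreal (((1 / 2) ^ K) powr p) * (ennreal (C powr p) * mass f)"
proof -
  have fm[measurable]: "f \<in> borel_measurable lebesgue" using f by (simp add: Lp_weighted_iff[OF p_pos])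
  have m: "twist_remainder f K z \<in> borel_measurable lebesgue"
    unfolding twist_remainder_def exp_taylor_def by measurable
  have 1: "norm (twist_remainder f K z x) \<le> (1 / 2) ^ K * exp (2 * \<delta> * norm (b x)) * norm (f x)" for x
    using exp_taylor_remainder[of "- (z * b x)" K] z
    unfolding twist_remainder_def norm_mult by (intro mult_right_mono) (auto simp: norm_mult mult.assoc)
  have 2: "(0::real) \<le> (1 / 2) ^ K" by simp
  from damped_estimate[OF f m 2 1]
  show "twist_remainder f K z \<in> D" "V (twist_remainder f K z) \<in> borel_measurable lebesgue"
    "(\<integral>\<^sup>+x. epowr (V (twist_remainder f K z) x) p * ennreal (damped x) \<partial>lebesgue)
      \<le> ennreal (((1 / 2) ^ K) powr p) * (ennreal (C powr p) * mass f)"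
    by auto
qed

definition mean_conjugate :: "('a \<Rightarrow> complex) \<Rightarrow> nat \<Rightarrow> 'a \<Rightarrow> ennreal" where
  "mean_conjugate f N x = ennreal (1 / real N) * (\<Sum>j<N. ennreal (1 / \<delta>) *
     (ennreal (exp (Re (circle_point \<delta> N j * b x))) * V (twisted f (circle_point \<delta> N j)) x))"

definition mean_twisted :: "('a \<Rightarrow> complex) \<Rightarrow> nat \<Rightarrow> 'a \<Rightarrow> ennreal" where
  "mean_twisted f N x = ennreal (1 / real N) * (\<Sum>j<N. V (twisted f (circle_point \<delta> N j)) x)"

definition mean_remainder :: "('a \<Rightarrow> complex) \<Rightarrow> nat \<Rightarrow> nat \<Rightarrow> 'a \<Rightarrow> ennreal" where
  "mean_remainder f K N x = ennreal (1 / real N) * (\<Sum>j<N. V (twist_remainder f K (circle_point \<delta> N j)) x)"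

text \<open>
  Inserting the discrete Cauchy formula, with \<open>b x\<close> and \<open>b y\<close> for its two arguments, writes the
  commutator as a circle average of \<open>T\<close> applied to truncated exponentials times \<open>f\<close>. Replacing both
  truncated exponentials by full ones gives the main term; the errors carry a factor \<open>2 ^ (- K)\<close> or a
  Taylor remainder, and the dependence on \<open>b x\<close> stays outside the operator.
\<close>

lemma commutator_pointwise_bound:
  assumes f: "f \<in> Lp_weighted p w" and K: "K \<ge> 2"
  shows "variation_op \<rho> (\<lambda>t. commutator (T t) b) f x \<le> mean_conjugate f (2 * K) x
    + ennreal (exp (2 * \<delta> * norm (b x)) / \<delta>) *
      (ennreal ((1 / 2) ^ K) * mean_twisted f (2 * K) x + mean_remainder f K (2 * K) x)"
proof -
  define N where "N = 2 * K"
  have N: "N > 0" using K by (simp add: N_def)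
  let ?z = "circle_point \<delta> N"
  have z: "norm (?z j) = \<delta>" for j by (rule norm_circle_point[OF \<delta>])
  define et where "et j = exp_taylor K (?z j * b x)" for j
  define c where "c j = (1 / of_nat N) * inverse (?z j) * et j" for j
  define e2 where "e2 = exp (2 * \<delta> * norm (b x))"
  define r where "r = (1 / 2 :: real) ^ K"
  let ?E = "\<lambda>j. twisted f (?z j)" and ?R = "\<lambda>j. twist_remainder f K (?z j)"
  have ED: "?E j \<in> D" "?R j \<in> D" for j using twisted_bounds(1) twist_remainder_bounds(1) f z by auto
  have QD: "(\<lambda>y. ?E j y - ?R j y) \<in> D" for j
    using D_add[OF ED(1)[of j] D_scale[OF ED(2)[of j], of "- 1"]] by simp
  have "(b x - b y) * f y = (\<Sum>j<N. c j * (?E j y - ?R j y))" for y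
  proof -
    have "?E j y - ?R j y = exp_taylor K (- (?z j * b y)) * f y" for j
      by (simp add: twisted_def twist_remainder_def algebra_simps)
    then have "(\<Sum>j<N. c j * (?E j y - ?R j y)) = (\<Sum>j<N. c j * exp_taylor K (- (?z j * b y))) * f y"
      by (simp add: sum_distrib_right mult.assoc)
    then show ?thesis
      unfolding c_def et_def N_def by (simp only: circle_average_extracts_difference[OF \<delta> K])
  qed
  then have "variation_op \<rho> (\<lambda>t. commutator (T t) b) f x = V (\<lambda>y. \<Sum>j<N. c j * (?E j y - ?R j y)) x"
    unfolding commutator_variation_eq by simp
  also have "\<dots> \<le> (\<Sum>j<N. ennreal (norm (c j)) * V (\<lambda>y. ?E j y - ?R j y) x)"
    using V_sum[of "{..<N}" "\<lambda>j y. ?E j y - ?R j y" c x] QD by auto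
  also have "\<dots> \<le> (\<Sum>j<N. ennreal (1 / real N) * (ennreal (1 / \<delta>) * (ennreal (exp (Re (?z j * b x))) * V (?E j) x)
      + ennreal (e2 / \<delta>) * (ennreal r * V (?E j) x + V (?R j) x)))"
  proof (rule sum_mono)
    fix j
    have nb: "norm (?z j * b x) = \<delta> * norm (b x)" using z by (simp add: norm_mult)
    have "norm (et j) \<le> exp (\<delta> * norm (b x))"
      using norm_exp_taylor_le[of K "?z j * b x"] nb by (simp add: et_def)
    also have "\<dots> \<le> e2" using \<delta> by (simp add: e2_def)
    finally have et1: "norm (et j) \<le> e2" .
    have "norm (et j) \<le> norm (exp (?z j * b x)) + norm (exp (?z j * b x) - et j)"
      using norm_triangle_sub[of "et j" "exp (?z j * b x)"] by (simp only: norm_minus_commute)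
    also have "\<dots> \<le> exp (Re (?z j * b x)) + r * e2"
      using exp_taylor_remainder[of "?z j * b x" K] nb
      by (intro add_mono) (auto simp: norm_exp_eq_Re et_def r_def e2_def mult.assoc)
    finally have et2: "norm (et j) \<le> exp (Re (?z j * b x)) + r * e2" .
    have nc: "norm (c j) = 1 / real N * (norm (et j) / \<delta>)"
      using z by (simp add: c_def norm_mult norm_divide norm_inverse divide_inverse)
    have "ennreal (norm (c j)) * V (\<lambda>y. ?E j y - ?R j y) x \<le> ennreal (norm (c j)) * (V (?E j) x + V (?R j) x)"
      by (intro mult_left_mono V_sub ED) auto
    also have "\<dots> = ennreal (1 / real N) * (ennreal (norm (et j) / \<delta>) * V (?E j) x + ennreal (norm (et j) / \<delta>) * V (?R j) x)"
      unfolding nc using \<delta> by (simp add: ennreal_mult distrib_left mult.assoc del: times_divide_eq_left times_divide_eq_right)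
    also have "\<dots> \<le> ennreal (1 / real N) * (ennreal ((exp (Re (?z j * b x)) + r * e2) / \<delta>) * V (?E j) x + ennreal (e2 / \<delta>) * V (?R j) x)"
      using et1 et2 \<delta> by (intro mult_left_mono add_mono mult_right_mono ennreal_leI divide_right_mono) auto
    also have "ennreal ((exp (Re (?z j * b x)) + r * e2) / \<delta>)
      = ennreal (1 / \<delta>) * ennreal (exp (Re (?z j * b x))) + ennreal (e2 / \<delta>) * ennreal r"
      using \<delta> by (simp add: ennreal_mult[symmetric] ennreal_plus[symmetric] add_divide_distrib r_def e2_def mult.commute del: ennreal_plus)
    also have "ennreal (1 / real N) * ((ennreal (1 / \<delta>) * ennreal (exp (Re (?z j * b x))) + ennreal (e2 / \<delta>) * ennreal r) * V (?E j) x
        + ennreal (e2 / \<delta>) * V (?R j) x)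
      = ennreal (1 / real N) * (ennreal (1 / \<delta>) * (ennreal (exp (Re (?z j * b x))) * V (?E j) x)
      + ennreal (e2 / \<delta>) * (ennreal r * V (?E j) x + V (?R j) x))"
      by (simp only: distrib_left distrib_right mult.assoc add.assoc)
    finally show "ennreal (norm (c j)) * V (\<lambda>y. ?E j y - ?R j y) x
      \<le> ennreal (1 / real N) * (ennreal (1 / \<delta>) * (ennreal (exp (Re (?z j * b x))) * V (?E j) x)
      + ennreal (e2 / \<delta>) * (ennreal r * V (?E j) x + V (?R j) x))" .
  qed
  also have "\<dots> = mean_conjugate f N x + ennreal (e2 / \<delta>) * (ennreal r * mean_twisted f N x + mean_remainder f K N x)"
    unfolding mean_conjugate_def mean_twisted_def mean_remainder_def
    by (simp add: sum.distrib sum_distrib_left distrib_left mult_ac)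
  finally show ?thesis unfolding N_def e2_def r_def .
qed

text \<open>
  Shifting the index by \<open>2\<close> respects \<open>K \<ge> 2\<close> in the pointwise bound. Both error terms decay
  geometrically in the damped space.
\<close>

lemma mean_errors_vanish:
  assumes f: "f \<in> Lp_weighted p w"
  shows "AE x in lebesgue. (\<lambda>k. ennreal ((1 / 2) ^ (k + 2)) * mean_twisted f (2 * (k + 2)) x) \<longlonglongrightarrow> 0"
    and "AE x in lebesgue. (\<lambda>k. mean_remainder f (k + 2) (2 * (k + 2)) x) \<longlonglongrightarrow> 0"
proof -
  let ?A = "ennreal (C powr p) * mass f"
  have A: "?A < \<infinity>" using f by (simp add: Lp_weighted_iff[OF p_pos] ennreal_mult_less_top)
  have small: "ennreal (((1 / 2) ^ (k + 2)) powr p) * B \<le> ennreal ((1 / 2) ^ k) * B" for k :: nat and B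
  proof -
    have "(1 / 2 :: real) ^ (k + 2) \<le> 1" by (rule power_le_one) auto
    then have "((1 / 2) ^ (k + 2)) powr p \<le> ((1 / 2 :: real) ^ (k + 2)) powr 1"
      using p by (intro powr_mono') auto
    also have "\<dots> \<le> (1 / 2) ^ k" by simp
    finally show ?thesis by (intro mult_right_mono ennreal_leI) auto
  qed
  have z: "norm (circle_point \<delta> N j) = \<delta>" for N j by (rule norm_circle_point[OF \<delta>])
  note [measurable] = twisted_bounds(2)[OF f z] twist_remainder_bounds(2)[OF f z]
  show "AE x in lebesgue. (\<lambda>k. ennreal ((1 / 2) ^ (k + 2)) * mean_twisted f (2 * (k + 2)) x) \<longlonglongrightarrow> 0"
  proof (rule AE_tendsto_zero_Lp[OF p_pos _ _ damped_pos A])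
    fix k
    show "(\<lambda>x. ennreal ((1 / 2) ^ (k + 2)) * mean_twisted f (2 * (k + 2)) x) \<in> borel_measurable lebesgue"
      unfolding mean_twisted_def by measurable
    have "(\<integral>\<^sup>+x. epowr (mean_twisted f (2 * (k + 2)) x) p * ennreal (damped x) \<partial>lebesgue) \<le> ?A"
      unfolding mean_twisted_def using p
      by (intro nn_integral_epowr_average_le twisted_bounds[OF f z]) auto
    then have "ennreal (((1 / 2) ^ (k + 2)) powr p) * (\<integral>\<^sup>+x. epowr (mean_twisted f (2 * (k + 2)) x) p * ennreal (damped x) \<partial>lebesgue)
      \<le> ennreal ((1 / 2) ^ k) * ?A"
      by (intro order_trans[OF mult_left_mono small]) auto
    moreover have "(\<integral>\<^sup>+x. epowr (ennreal ((1 / 2) ^ (k + 2)) * mean_twisted f (2 * (k + 2)) x) p * ennreal (damped x) \<partial>lebesgue)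
      = ennreal (((1 / 2) ^ (k + 2)) powr p) * (\<integral>\<^sup>+x. epowr (mean_twisted f (2 * (k + 2)) x) p * ennreal (damped x) \<partial>lebesgue)"
      unfolding mean_twisted_def epowr_mult[OF p_pos] using p
      by (subst nn_integral_cmult[symmetric]) (auto simp: epowr_ennreal mult.assoc simp del: power_Suc)
    ultimately show "(\<integral>\<^sup>+x. epowr (ennreal ((1 / 2) ^ (k + 2)) * mean_twisted f (2 * (k + 2)) x) p * ennreal (damped x) \<partial>lebesgue)
      \<le> ennreal ((1 / 2) ^ k) * ?A" by simp
  qed measurable
  show "AE x in lebesgue. (\<lambda>k. mean_remainder f (k + 2) (2 * (k + 2)) x) \<longlonglongrightarrow> 0"
  proof (rule AE_tendsto_zero_Lp[OF p_pos _ _ damped_pos A])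
    fix k
    show "(\<lambda>x. mean_remainder f (k + 2) (2 * (k + 2)) x) \<in> borel_measurable lebesgue"
      unfolding mean_remainder_def by measurable
    show "(\<integral>\<^sup>+x. epowr (mean_remainder f (k + 2) (2 * (k + 2)) x) p * ennreal (damped x) \<partial>lebesgue)
      \<le> ennreal ((1 / 2) ^ k) * ?A"
      unfolding mean_remainder_def using p
      by (intro nn_integral_epowr_average_le order_trans[OF twist_remainder_bounds(3)[OF f z] small]
          twist_remainder_bounds(2)[OF f z]) auto
  qed measurable
qed

text \<open>
  By Jensen's inequality the circle average is bounded by the worst conjugated estimate, uniformly
  in the number of points, and Fatou's lemma removes the vanishing errors.
\<close>

theorem commutator_estimate:
  assumes f: "f \<in> Lp_weighted p w"
  shows "(\<integral>\<^sup>+x. epowr (variation_op \<rho> (\<lambda>t. commutator (T t) b) f x) p * ennreal (w x) \<partial>lebesgue)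
    \<le> ennreal ((C / \<delta>) powr p) * mass f"
proof -
  let ?Vc = "variation_op \<rho> (\<lambda>t. commutator (T t) b) f"
  let ?S = "\<lambda>k x. mean_conjugate f (2 * (k + 2)) x"
  have z: "norm (circle_point \<delta> N j) = \<delta>" for N j by (rule norm_circle_point[OF \<delta>])
  note [measurable] = twisted_bounds(2)[OF f z]
  have Sm[measurable]: "?S k \<in> borel_measurable lebesgue" for k
    unfolding mean_conjugate_def by measurable
  have S: "(\<integral>\<^sup>+x. epowr (?S k x) p * ennreal (w x) \<partial>lebesgue) \<le> ennreal ((C / \<delta>) powr p) * mass f" for k
    unfolding mean_conjugate_def
  proof (rule nn_integral_epowr_average_le)
    fix j
    let ?z = "circle_point \<delta> (2 * (k + 2)) j"
    let ?u = "\<lambda>x. ennreal (exp (Re (?z * b x))) * V (twisted f ?z) x"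
    have "(\<integral>\<^sup>+x. epowr (ennreal (1 / \<delta>) * ?u x) p * ennreal (w x) \<partial>lebesgue)
      = (\<integral>\<^sup>+x. ennreal ((1 / \<delta>) powr p) * (epowr (?u x) p * ennreal (w x)) \<partial>lebesgue)"
      using \<delta> by (intro nn_integral_cong) (simp add: epowr_mult[OF p_pos] epowr_ennreal mult.assoc)
    also have "\<dots> = ennreal ((1 / \<delta>) powr p) * (\<integral>\<^sup>+x. epowr (?u x) p * ennreal (w x) \<partial>lebesgue)"
      by (rule nn_integral_cmult) measurable
    also have "\<dots> \<le> ennreal ((1 / \<delta>) powr p) * (ennreal (C powr p) * mass f)"
      using conjugated_estimate[OF f z] twisted_bounds(2)[OF f z]
      unfolding twisted_def[abs_def] by (intro mult_left_mono) auto
    also have "\<dots> = ennreal ((C / \<delta>) powr p) * mass f"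
      using C \<delta> by (simp add: powr_divide ennreal_mult[symmetric] mult.assoc[symmetric] field_simps)
    finally show "(\<integral>\<^sup>+x. epowr (ennreal (1 / \<delta>) * ?u x) p * ennreal (w x) \<partial>lebesgue)
      \<le> ennreal ((C / \<delta>) powr p) * mass f" .
  qed (use p in \<open>auto simp: mult.assoc\<close>)
  have "(\<integral>\<^sup>+x. epowr (?Vc x) p * ennreal (w x) \<partial>lebesgue)
    \<le> (\<integral>\<^sup>+x. liminf (\<lambda>k. epowr (?S k x) p * ennreal (w x)) \<partial>lebesgue)"
  proof (rule nn_integral_mono_AE, use mean_errors_vanish[OF f] in eventually_elim)
    case (elim x)
    \<comment> \<open>Moving the weight inside the power lets the limit be taken for \<open>p\<close>-th powers alone.\<close>
    define W where "W = ennreal (w x powr (1 / p))"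
    define A where "A = ennreal (exp (2 * \<delta> * norm (b x)) / \<delta> * w x powr (1 / p))"
    let ?e = "\<lambda>k. ennreal ((1 / 2) ^ (k + 2)) * mean_twisted f (2 * (k + 2)) x + mean_remainder f (k + 2) (2 * (k + 2)) x"
    have W: "epowr (a * W) p = epowr a p * ennreal (w x)" for a
      using p w_nonneg[of x] by (simp add: epowr_mult W_def epowr_ennreal powr_powr)
    have alg: "(a + c * d) * W = a * W + (c * W) * d" for a c d :: ennreal
      by (simp add: distrib_left distrib_right mult_ac)
    have "?e \<longlonglongrightarrow> 0 + 0" by (intro tendsto_add elim)
    then have "(\<lambda>k. A * ?e k) \<longlonglongrightarrow> A * 0"
      by (intro ennreal_tendsto_cmult) (auto simp: A_def)
    then have e: "(\<lambda>k. A * ?e k) \<longlonglongrightarrow> 0" by simp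
    have "?Vc x * W \<le> ?S k x * W + A * ?e k" for k
    proof -
      have "?Vc x * W \<le> (?S k x + ennreal (exp (2 * \<delta> * norm (b x)) / \<delta>) * ?e k) * W"
        by (intro mult_right_mono commutator_pointwise_bound f) auto
      also have "\<dots> = ?S k x * W + (ennreal (exp (2 * \<delta> * norm (b x)) / \<delta>) * W) * ?e k"
        by (rule alg)
      also have "ennreal (exp (2 * \<delta> * norm (b x)) / \<delta>) * W = A"
        unfolding W_def A_def using \<delta> by (simp add: ennreal_mult del: times_divide_eq_left)
      finally show ?thesis .
    qed
    from epowr_le_liminf[OF p_pos this e] show ?case unfolding W .
  qed
  also have "\<dots> \<le> liminf (\<lambda>k. \<integral>\<^sup>+x. epowr (?S k x) p * ennreal (w x) \<partial>lebesgue)"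
    by (rule nn_integral_liminf) measurable
  also have "\<dots> \<le> liminf (\<lambda>k. ennreal ((C / \<delta>) powr p) * mass f)"
    by (intro Liminf_mono always_eventually allI S)
  finally show ?thesis by (simp add: Liminf_const)
qed

theorem commutator_bounded:
  "Lp_bounded_by p w (C / \<delta>) (variation_op \<rho> (\<lambda>t. commutator (T t) b))"
  unfolding Lp_bounded_by_def
  using commutator_variation_measurable Lp_wnorm_leI[OF p_pos _ commutator_estimate] C \<delta> by auto

end

section \<open>Lipschitz functions of BMO functions\<close>

lemma average_mono:
  fixes f g :: "'a::euclidean_space \<Rightarrow> real"
  assumes "set_integrable lebesgue Q f" "set_integrable lebesgue Q g" "\<And>x. f x \<le> g x"
  shows "average Q f \<le> average Q g"
  unfolding average_def using assms by (auto intro!: divide_right_mono set_integral_mono)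

lemma cubes_compact: "Q \<in> cubes \<Longrightarrow> compact Q"
  by (auto simp: cubes_def)

lemma average_const:
  fixes c :: "'b::{banach,second_countable_topology}"
  assumes "Q \<in> cubes"
  shows "average (Q :: 'a::euclidean_space set) (\<lambda>x. c) = c"
proof -
  obtain a r where r: "r > 0" "Q = cbox a (a + r *\<^sub>R One)" using assms by (rule cubesE)
  then have "measure lebesgue Q > 0" "emeasure lebesgue Q < \<infinity>"
    by (simp_all only: measure_cube[OF less_imp_le[OF r(1)]] emeasure_cube[OF less_imp_le[OF r(1)]]) auto
  moreover have "Q \<in> sets lebesgue" using r by auto
  ultimately show ?thesis
    unfolding average_def set_lebesgue_integral_def by (simp del: measure_completion emeasure_completion)
qed

lemma locally_integrable_const: "locally_integrable (\<lambda>x. c)"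
  by (rule continuous_imp_locally_integrable) simp

text \<open>
  The oscillation about \<open>G (average Q b)\<close> is at most \<open>L\<close> times that of \<open>b\<close>; passing to the
  oscillation about the average of \<open>G \<circ> b\<close> costs a factor \<open>2\<close>.
\<close>

lemma mean_oscillation_lipschitz:
  fixes b :: "'a::euclidean_space \<Rightarrow> 'b::{banach,second_countable_topology}" and G :: "'b \<Rightarrow> real"
  assumes b: "locally_integrable b" and Gb: "locally_integrable (\<lambda>x. G (b x))"
    and L: "\<And>u v. \<bar>G u - G v\<bar> \<le> L * norm (u - v)" and Q: "Q \<in> cubes"
  shows "mean_oscillation (\<lambda>x. G (b x)) Q \<le> 2 * L * mean_oscillation b Q"
proof -
  let ?c = "G (average Q b)" and ?m = "average Q (\<lambda>x. G (b x))"
  let ?h = "\<lambda>x. \<bar>G (b x) - ?c\<bar>"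
  have si: "set_integrable lebesgue Q g" if "locally_integrable g" for g :: "'a \<Rightarrow> 'c::{banach,second_countable_topology}"
    using that cubes_compact[OF Q] by (auto simp: locally_integrable_def)
  have i1: "set_integrable lebesgue Q (\<lambda>x. G (b x) - d)" for d
    by (intro si locally_integrable_diff Gb locally_integrable_const)
  note i2 = set_integrable_abs[OF i1]
  have "set_integrable lebesgue Q (\<lambda>x. b x - average Q b)"
    by (intro set_integral_diff(1) si b locally_integrable_const)
  then have i3: "set_integrable lebesgue Q (\<lambda>x. norm (b x - average Q b))" by (rule set_integrable_norm)
  have "\<bar>?m - ?c\<bar> = \<bar>average Q (\<lambda>x. G (b x) - ?c)\<bar>"
    using average_const[OF Q, of ?c] set_integral_diff(2)[OF si[OF Gb] si[OF locally_integrable_const[of ?c]]]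
    by (simp add: average_def diff_divide_distrib)
  also have "\<dots> \<le> average Q ?h"
    using set_integral_norm_bound[OF i1, of ?c] by (simp add: average_def abs_mult divide_right_mono)
  finally have mc: "\<bar>?m - ?c\<bar> \<le> average Q ?h" .
  have "mean_oscillation (\<lambda>x. G (b x)) Q \<le> average Q (\<lambda>x. ?h x + \<bar>?m - ?c\<bar>)"
    unfolding mean_oscillation_def real_norm_def
    by (intro average_mono i2 set_integral_add(1) si[OF locally_integrable_const]) linarith
  also have "\<dots> = average Q ?h + \<bar>?m - ?c\<bar>"
    using average_const[OF Q, of "\<bar>?m - ?c\<bar>"] set_integral_add(2)[OF i2 si[OF locally_integrable_const], of ?c "\<bar>?m - ?c\<bar>"]
    by (simp add: average_def add_divide_distrib)
  also have "\<dots> \<le> 2 * average Q ?h" using mc by simp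
  also have "average Q ?h \<le> average Q (\<lambda>x. L * norm (b x - average Q b))"
    using L by (intro average_mono i2 set_integrable_mult_right i3) auto
  also have "\<dots> = L * mean_oscillation b Q" by (simp add: average_cmult mean_oscillation_def)
  finally show ?thesis by simp
qed

lemma locally_integrable_lipschitz:
  fixes b :: "'a::euclidean_space \<Rightarrow> 'b::{banach,second_countable_topology}" and G :: "'b \<Rightarrow> real"
  assumes b: "locally_integrable b" and L: "\<And>u v. \<bar>G u - G v\<bar> \<le> L * norm (u - v)" and L0: "L \<ge> 0"
  shows "locally_integrable (\<lambda>x. G (b x))"
  unfolding locally_integrable_def
proof (intro allI impI)
  fix Q :: "'a set" assume Q: "compact Q"
  have bm[measurable]: "b \<in> borel_measurable lebesgue" using b by (rule locally_integrable_measurable)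
  have "L-lipschitz_on UNIV G" by (rule lipschitz_onI) (use L L0 in \<open>auto simp: dist_norm\<close>)
  then have "continuous_on UNIV G" by (rule lipschitz_on_continuous_on)
  then have [measurable]: "G \<in> borel_measurable borel" by (rule borel_measurable_continuous_onI)
  have Qm: "Q \<in> sets lebesgue" using lmeasurable_compact[OF Q] by (simp add: fmeasurableD)
  have "set_integrable lebesgue Q (\<lambda>x. \<bar>G 0\<bar>)" "set_integrable lebesgue Q (\<lambda>x. L * norm (b x))"
    using b locally_integrable_const[of "\<bar>G 0\<bar>"] Q
    unfolding locally_integrable_def by (auto intro!: set_integrable_mult_right set_integrable_norm)
  then have "set_integrable lebesgue Q (\<lambda>x. \<bar>G 0\<bar> + L * norm (b x))" by (rule set_integral_add(1))
  then show "set_integrable lebesgue Q (\<lambda>x. G (b x))"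
  proof (rule set_integrable_bound)
    show "set_borel_measurable lebesgue Q (\<lambda>x. G (b x))"
      using Qm unfolding set_borel_measurable_def by measurable
    have "\<bar>G u\<bar> \<le> \<bar>G 0\<bar> + L * norm u" for u using L[of u 0] by simp
    then show "AE x in lebesgue. x \<in> Q \<longrightarrow> norm (G (b x)) \<le> norm (\<bar>G 0\<bar> + L * norm (b x))"
      by (intro AE_I2 impI) (simp, smt (verit))
  qed
qed

lemma locally_integrable_exp_bounded:
  fixes w g :: "'a::euclidean_space \<Rightarrow> real"
  assumes w: "locally_integrable w" and [measurable]: "g \<in> borel_measurable lebesgue" and M: "\<And>x. g x \<le> M"
  shows "locally_integrable (\<lambda>x. w x * exp (g x))"
  unfolding locally_integrable_def
proof (intro allI impI)
  fix Q :: "'a set" assume Q: "compact Q"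
  have Qm: "Q \<in> sets lebesgue" using lmeasurable_compact[OF Q] by (simp add: fmeasurableD)
  have [measurable]: "w \<in> borel_measurable lebesgue" using w by (rule locally_integrable_measurable)
  have "set_integrable lebesgue Q (\<lambda>x. exp M * w x)"
    using locally_integrable_cmult[OF w, of "exp M"] Q by (simp add: locally_integrable_def)
  then show "set_integrable lebesgue Q (\<lambda>x. w x * exp (g x))"
  proof (rule set_integrable_bound)
    show "set_borel_measurable lebesgue Q (\<lambda>x. w x * exp (g x))"
      using Qm unfolding set_borel_measurable_def by measurable
    show "AE x in lebesgue. x \<in> Q \<longrightarrow> norm (w x * exp (g x)) \<le> norm (exp M * w x)"
      using M by (intro AE_I2 impI) (auto simp: abs_mult mult.commute[of "exp M"] intro!: mult_left_mono)
  qed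
qed

text \<open>
  The conjugation radius is proportional to \<open>1 / B\<close> for a positive bound \<open>B\<close> of the BMO norm. Letting
  \<open>B\<close> decrease to the norm includes functions with \<open>bmo_norm b = 0\<close>.
\<close>

lemma Lp_bounded_by_limit:
  assumes c: "c \<ge> 0" and \<beta>: "\<beta> \<ge> 0" and B: "\<And>B. B > \<beta> \<Longrightarrow> Lp_bounded_by p w (c * B) S"
  shows "Lp_bounded_by p w (c * \<beta>) S"
  unfolding Lp_bounded_by_def
proof (intro ballI conjI)
  fix f assume f: "f \<in> Lp_weighted p w"
  show "S f \<in> borel_measurable lebesgue"
    using B[of "\<beta> + 1"] f by (auto simp: Lp_bounded_by_def)
  obtain F where F: "Lp_wnorm p w (\<lambda>x. ennreal (norm (f x))) = ennreal F" "F \<ge> 0"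
    using f by (cases "Lp_wnorm p w (\<lambda>x. ennreal (norm (f x)))") (auto simp: Lp_weighted_def)
  show "Lp_wnorm p w (S f) \<le> ennreal (c * \<beta>) * Lp_wnorm p w (\<lambda>x. ennreal (norm (f x)))"
  proof (rule ennreal_le_epsilon)
    fix e :: real assume e: "e > 0"
    define B where "B = \<beta> + e / (c * F + 1)"
    have cF: "0 \<le> c * F" using c F by simp
    then have B\<beta>: "B > \<beta>" using e by (simp add: B_def)
    have "Lp_wnorm p w (S f) \<le> ennreal (c * B) * ennreal F"
      using assms(3)[OF B\<beta>] f F by (auto simp: Lp_bounded_by_def)
    also have "\<dots> = ennreal (c * \<beta> * F + c * F * (e / (c * F + 1)))"
    proof -
      have "0 \<le> c * B" using c \<beta> B\<beta> by simp
      then have "ennreal (c * B) * ennreal F = ennreal (c * B * F)" using F by (simp add: ennreal_mult)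
      also have "c * B * F = c * \<beta> * F + c * F * (e / (c * F + 1))"
        unfolding B_def by (simp only: distrib_left distrib_right mult_ac)
      finally show ?thesis .
    qed
    also have "\<dots> \<le> ennreal (c * \<beta> * F + e)"
    proof -
      have "c * F * e \<le> e * (c * F + 1)" using e by (simp add: algebra_simps)
      then have "c * F * (e / (c * F + 1)) \<le> e" using cF by (simp add: pos_divide_le_eq)
      then show ?thesis by (intro ennreal_leI) simp
    qed
    also have "\<dots> = ennreal (c * \<beta>) * ennreal F + ennreal e"
      using c \<beta> F e by (simp add: ennreal_mult ennreal_plus)
    finally show "Lp_wnorm p w (S f) \<le> ennreal (c * \<beta>) * Lp_wnorm p w (\<lambda>x. ennreal (norm (f x))) + ennreal e"
      using F by simp
  qed
qed

lemma bmo_norm_upper: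
  assumes "b \<in> BMO" "Q \<in> cubes" shows "mean_oscillation b Q \<le> bmo_norm b"
  using assms unfolding bmo_norm_def BMO_def by (auto intro: cSUP_upper)

lemma mean_oscillation_nonneg: "0 \<le> mean_oscillation b Q"
  unfolding mean_oscillation_def by (intro average_nonneg) simp

lemma bmo_norm_nonneg:
  fixes b :: "'a::euclidean_space \<Rightarrow> 'b::{banach,second_countable_topology}"
  assumes "b \<in> BMO" shows "0 \<le> bmo_norm b"
proof -
  have "cbox 0 (0 + 1 *\<^sub>R One) \<in> (cubes :: 'a set set)" unfolding cubes_def
    by (intro CollectI exI[of _ 0] exI[of _ 1]) simp
  from bmo_norm_upper[OF assms this] mean_oscillation_nonneg show ?thesis by (rule order_trans[rotated])
qed

text \<open>
  Raising \<open>w exp (G \<circ> b)\<close> to the power \<open>\<tau>\<close> perturbs \<open>w\<^sup>\<tau>\<close> by \<open>exp (\<tau> G \<circ> b)\<close>. The upper bound on \<open>G\<close>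
  serves the local integrability of the weight itself, about which \<open>w\<^sup>\<tau>\<close> says nothing.
\<close>

lemma admissible_perturbation:
  fixes w :: "'a::euclidean_space \<Rightarrow> real" and b :: "'a \<Rightarrow> 'b::{banach,second_countable_topology}"
  assumes pert: "\<And>v \<phi> :: 'a \<Rightarrow> real. muckenhoupt_le s K v \<Longrightarrow> locally_integrable \<phi> \<Longrightarrow>
      (\<And>Q. Q \<in> cubes \<Longrightarrow> mean_oscillation \<phi> Q \<le> \<kappa>) \<Longrightarrow> muckenhoupt_le s K' (\<lambda>x. v x * exp (\<phi> x))"
    and w: "\<And>x. 0 \<le> w x" "locally_integrable w" "muckenhoupt_le s K (\<lambda>x. w x powr \<tau>)"
    and b: "b \<in> BMO" and G: "\<And>u v. \<bar>G u - G v\<bar> \<le> L * norm (u - v)" "\<And>u. G u \<le> M"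
    and L: "L \<ge> 0" "2 * \<bar>\<tau>\<bar> * L * bmo_norm b \<le> \<kappa>"
  shows "(\<forall>x. 0 \<le> w x * exp (G (b x))) \<and> locally_integrable (\<lambda>x. w x * exp (G (b x))) \<and>
    muckenhoupt_le s K' (\<lambda>x. (w x * exp (G (b x))) powr \<tau>)"
proof (intro conjI)
  have bl: "locally_integrable b" using b by (simp add: BMO_def)
  have Gl: "locally_integrable (\<lambda>x. G (b x))" by (rule locally_integrable_lipschitz[OF bl G(1) L(1)])
  show "\<forall>x. 0 \<le> w x * exp (G (b x))" using w(1) by simp
  show "locally_integrable (\<lambda>x. w x * exp (G (b x)))"
    by (rule locally_integrable_exp_bounded[OF w(2) locally_integrable_measurable[OF Gl] G(2)])
  have "mean_oscillation (\<lambda>x. \<tau> * G (b x)) Q \<le> \<kappa>" if Q: "Q \<in> cubes" for Q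
  proof -
    have "mean_oscillation (\<lambda>x. G (b x)) Q \<le> 2 * L * mean_oscillation b Q"
      by (rule mean_oscillation_lipschitz[OF bl Gl G(1) Q])
    also have "\<dots> \<le> 2 * L * bmo_norm b"
      using L(1) by (intro mult_left_mono bmo_norm_upper[OF b Q]) auto
    finally have "\<bar>\<tau>\<bar> * mean_oscillation (\<lambda>x. G (b x)) Q \<le> \<bar>\<tau>\<bar> * (2 * L * bmo_norm b)"
      by (intro mult_left_mono) auto
    then show ?thesis using L(2) by (simp add: mean_oscillation_cmult mult_ac)
  qed
  from pert[OF w(3) locally_integrable_cmult[OF Gl] this]
  have "muckenhoupt_le s K' (\<lambda>x. w x powr \<tau> * exp (\<tau> * G (b x)))" .
  then show "muckenhoupt_le s K' (\<lambda>x. (w x * exp (G (b x))) powr \<tau>)"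
    using w(1) by (simp add: powr_mult exp_powr_real mult.commute)
qed

section \<open>Boundedness of the variation of commutators\<close>

theorem theorem1p1:
  fixes T :: "real \<Rightarrow> (real ^ 'n \<Rightarrow> complex) \<Rightarrow> (real ^ 'n \<Rightarrow> complex)"
    and D :: "(real ^ 'n \<Rightarrow> complex) set"
    and p \<rho> \<tau> s :: real
  assumes "1 < p" and "1 \<le> \<rho>" and "1 < s"
    and linear: "\<And>t. t > 0 \<Longrightarrow> linear_operator_on D (T t)"
    and domain: "\<And>w. (\<forall>x. 0 \<le> w x) \<Longrightarrow> locally_integrable w \<Longrightarrow>
           (\<lambda>x. w x powr \<tau>) \<in> muckenhoupt s \<Longrightarrow> Lp_weighted p w \<subseteq> D"
    and bounded: "\<forall>K>0. \<exists>C>0. \<forall>w.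
           (\<forall>x. 0 \<le> w x) \<and> locally_integrable w \<and> muckenhoupt_le s K (\<lambda>x. w x powr \<tau>)
           \<longrightarrow> Lp_bounded_by p w C (variation_op \<rho> T)"
  shows "\<forall>K>0. \<exists>C>0. \<forall>w. \<forall>b\<in>BMO.
           (\<forall>x. 0 \<le> w x) \<and> locally_integrable w \<and> muckenhoupt_le s K (\<lambda>x. w x powr \<tau>)
           \<longrightarrow> Lp_bounded_by p w (C * bmo_norm b) (variation_op \<rho> (\<lambda>t. commutator (T t) b))"
proof (intro allI impI)
  fix K :: real assume "K > 0"
  \<comment> \<open>The perturbation theorem asks for an \<open>A\<^sub>s\<close> bound of at least \<open>1\<close>.\<close>
  have "max K 1 \<ge> 1" by simp
  from muckenhoupt_perturbation[OF \<open>1 < s\<close> this, where 'a = "real ^ 'n"]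
  obtain \<kappa> K' where \<kappa>: "\<kappa> > 0" and K': "K' > 0"
    and pert: "\<And>v \<phi> :: real ^ 'n \<Rightarrow> real. muckenhoupt_le s (max K 1) v \<Longrightarrow> locally_integrable \<phi> \<Longrightarrow>
      (\<And>Q. Q \<in> cubes \<Longrightarrow> mean_oscillation \<phi> Q \<le> \<kappa>) \<Longrightarrow> muckenhoupt_le s K' (\<lambda>x. v x * exp (\<phi> x))"
    by blast
  obtain C where C: "C > 0" and bd: "\<And>w. (\<forall>x. 0 \<le> w x) \<and> locally_integrable w \<and>
      muckenhoupt_le s K' (\<lambda>x. w x powr \<tau>) \<Longrightarrow> Lp_bounded_by p w C (variation_op \<rho> T)"
    using bounded K' by blast
  define A where "A = 4 * p * (\<bar>\<tau>\<bar> + 1) / \<kappa>"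
  have A: "A > 0" using \<open>1 < p\<close> \<kappa> by (simp add: A_def)
  have "Lp_bounded_by p w (C * A * bmo_norm b) (variation_op \<rho> (\<lambda>t. commutator (T t) b))"
    if b: "b \<in> BMO" and w: "\<forall>x. 0 \<le> w x" "locally_integrable w" "muckenhoupt_le s K (\<lambda>x. w x powr \<tau>)"
    for w :: "real ^ 'n \<Rightarrow> real" and b :: "real ^ 'n \<Rightarrow> complex"
  proof (rule Lp_bounded_by_limit)
    show "0 \<le> C * A" using C A by simp
    show "0 \<le> bmo_norm b" by (rule bmo_norm_nonneg[OF b])
    fix B assume B: "B > bmo_norm b"
    then have B0: "B > 0" using bmo_norm_nonneg[OF b] by linarith
    \<comment> \<open>The factor \<open>A\<close> makes the oscillation of \<open>\<tau> G \<circ> b\<close> at most \<open>\<kappa>\<close> for every \<open>G\<close> with Lipschitz constant \<open>2 p \<delta>\<close>.\<close>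
    define \<delta> where "\<delta> = 1 / (A * B)"
    have \<delta>: "\<delta> > 0" using A B0 by (simp add: \<delta>_def)
    have small: "2 * \<bar>\<tau>\<bar> * (2 * p * \<delta>) * bmo_norm b \<le> \<kappa>"
    proof -
      have "2 * \<bar>\<tau>\<bar> * (2 * p * \<delta>) * bmo_norm b \<le> 2 * (\<bar>\<tau>\<bar> + 1) * (2 * p * \<delta>) * B"
        using \<open>1 < p\<close> \<delta> B bmo_norm_nonneg[OF b] by (intro mult_mono) auto
      also have "\<dots> = 4 * p * (\<bar>\<tau>\<bar> + 1) * (\<delta> * B)" by simp
      also have "\<delta> * B = 1 / A" using B0 by (simp add: \<delta>_def)
      also have "4 * p * (\<bar>\<tau>\<bar> + 1) = A * \<kappa>" using \<kappa> by (simp add: A_def)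
      also have "A * \<kappa> * (1 / A) = \<kappa>" using A by simp
      finally show ?thesis .
    qed
    have wK: "muckenhoupt_le s (max K 1) (\<lambda>x. w x powr \<tau>)"
      by (rule muckenhoupt_le_mono[OF w(3)]) simp
    have adm: "(\<forall>x. 0 \<le> w x * exp (G (b x))) \<and> locally_integrable (\<lambda>x. w x * exp (G (b x))) \<and>
        muckenhoupt_le s K' (\<lambda>x. (w x * exp (G (b x))) powr \<tau>)"
      if "\<And>u v. \<bar>G u - G v\<bar> \<le> 2 * p * \<delta> * norm (u - v)" "\<And>u. G u \<le> M" for G :: "complex \<Rightarrow> real" and M
      using w \<delta> \<open>1 < p\<close> by (intro admissible_perturbation[OF pert _ _ wK b that _ small]) auto
    have damped: "(\<forall>x. 0 \<le> w x * exp (- (2 * p * \<delta> * norm (b x)))) \<and>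
        locally_integrable (\<lambda>x. w x * exp (- (2 * p * \<delta> * norm (b x)))) \<and>
        muckenhoupt_le s K' (\<lambda>x. (w x * exp (- (2 * p * \<delta> * norm (b x)))) powr \<tau>)"
    proof (rule adm[where G = "\<lambda>u. - (2 * p * \<delta> * norm u)" and M = 0])
      fix u v :: complex
      have "\<bar>norm v - norm u\<bar> \<le> norm (u - v)"
        using norm_triangle_ineq3[of u v] by (simp add: abs_minus_commute)
      then have "2 * p * \<delta> * \<bar>norm v - norm u\<bar> \<le> 2 * p * \<delta> * norm (u - v)"
        using \<delta> \<open>1 < p\<close> by (intro mult_left_mono) auto
      moreover have "\<bar>- (2 * p * \<delta> * norm u) - - (2 * p * \<delta> * norm v)\<bar> = 2 * p * \<delta> * \<bar>norm v - norm u\<bar>"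
      proof -
        have "- (2 * p * \<delta> * norm u) - - (2 * p * \<delta> * norm v) = 2 * p * \<delta> * (norm v - norm u)"
          by (simp add: algebra_simps)
        then show ?thesis using \<delta> \<open>1 < p\<close> by (simp only: abs_mult)
      qed
      ultimately show "\<bar>- (2 * p * \<delta> * norm u) - - (2 * p * \<delta> * norm v)\<bar> \<le> 2 * p * \<delta> * norm (u - v)" by simp
    qed (use \<delta> \<open>1 < p\<close> in simp)
    have conj: "Lp_bounded_by p (\<lambda>x. w x * exp (p * min (Re (z * b x)) M)) C (variation_op \<rho> T)"
      if z: "norm z = \<delta>" for z M
    proof (rule bd, rule adm[where G = "\<lambda>u. p * min (Re (z * u)) M" and M = "p * M"])
      fix u v :: complex
      have "\<bar>Re (z * u) - Re (z * v)\<bar> \<le> norm (z * (u - v))"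
        using abs_Re_le_cmod[of "z * (u - v)"] by (simp add: algebra_simps)
      then have "\<bar>min (Re (z * u)) M - min (Re (z * v)) M\<bar> \<le> \<delta> * norm (u - v)"
        unfolding norm_mult z by linarith
      then have "p * \<bar>min (Re (z * u)) M - min (Re (z * v)) M\<bar> \<le> p * (\<delta> * norm (u - v))"
        using \<open>1 < p\<close> by (intro mult_left_mono) auto
      also have "\<dots> \<le> 2 * p * \<delta> * norm (u - v)" using \<open>1 < p\<close> \<delta> by simp
      finally show "\<bar>p * min (Re (z * u)) M - p * min (Re (z * v)) M\<bar> \<le> 2 * p * \<delta> * norm (u - v)"
        using \<open>1 < p\<close> by (simp add: abs_mult flip: right_diff_distrib)
    qed (use \<open>1 < p\<close> in simp)
    interpret conjugation T D p \<rho> C \<delta> w b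
    proof
      show "b \<in> borel_measurable lebesgue" "w \<in> borel_measurable lebesgue"
        using b w by (auto simp: BMO_def intro: locally_integrable_measurable)
      have "AE x in lebesgue. 0 < w x powr \<tau>" using w(3) by (auto simp: muckenhoupt_le_def Let_def)
      then show "AE x in lebesgue. 0 < w x"
      proof eventually_elim
        case (elim x)
        then show ?case using w(1) by (cases "w x = 0") (auto simp: less_le)
      qed
      show "Lp_weighted p (\<lambda>x. w x * exp (- (2 * p * \<delta> * norm (b x)))) \<subseteq> D"
        using damped K' by (intro domain) (auto simp: muckenhoupt_def)
      show "Lp_bounded_by p (\<lambda>x. w x * exp (- (2 * p * \<delta> * norm (b x)))) C (variation_op \<rho> T)"
        by (rule bd[OF damped])
    qed (use assms C \<delta> w conj in auto)
    have "C / \<delta> = C * A * B" by (simp add: \<delta>_def)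
    with commutator_bounded
    show "Lp_bounded_by p w (C * A * B) (variation_op \<rho> (\<lambda>t. commutator (T t) b))" by simp
  qed
  moreover have "C * A > 0" using C A by simp
  ultimately show "\<exists>C>0. \<forall>w. \<forall>b\<in>BMO.
           (\<forall>x. 0 \<le> w x) \<and> locally_integrable w \<and> muckenhoupt_le s K (\<lambda>x. w x powr \<tau>)
           \<longrightarrow> Lp_bounded_by p w (C * bmo_norm b) (variation_op \<rho> (\<lambda>t. commutator (T t) b))"
    by blast
qed

end
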